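(* Let $\vartheta=(p,a,b)'$ with $p\in\mathbb{R}$, $a>0$ and $b>0$ arbitrary. Then, for perturbation rates of order $n^{-1/2}$, the family of probability distributions $\{\mathrm{P}^{(n)}_{p,a,b}: p\in\mathbb{R},a>0,b>0\}$ (joint laws of $n$ i.i.d. $\mathrm{GIG}(p,a,b)$ observations $X_1,\dots,X_n$) is uniformly locally asymptotically normal (ULAN) at $\vartheta$, with central sequence $$\Delta^{(n)}(\vartheta)=\begin{pmatrix}\Delta^{(n)}_p(\vartheta)\\ \Delta^{(n)}_a(\vartheta)\\ \Delta^{(n)}_b(\vartheta)\end{pmatrix}:=\frac1{\sqrt n}\sum_{i=1}^n\begin{pmatrix}\frac{\partial_p c(p,a,b)}{c(p,a,b)}+\log X_i\\ \frac{\partial_a c(p,a,b)}{c(p,a,b)}-\frac{X_i}{2}\\ \frac{\partial_b c(p,a,b)}{c(p,a,b)}-\frac{1}{2X_i}\end{pmatrix}=\frac1{\sqrt n}\sum_{i=1}^n\begin{pmatrix}\frac12\log(a/b)-\partial_p\log K_p(\sqrt{ab})+\log X_i\\ \frac{p}{2a}-\partial_a\log K_p(\sqrt{ab})-\frac{X_i}{2}\\ -\frac{p}{2b}-\partial_b\log K_p(\sqrt{ab})-\frac{1}{2X_i}\end{pmatrix}$$ and corresponding Fisher information matrix $$\Gamma(\vartheta):=\begin{pmatrix}\Gamma_{p,p}(\vartheta)&\Gamma_{p,a}(\vartheta)&\Gamma_{p,b}(\vartheta)\\ \Gamma_{p,a}(\vartheta)&\Gamma_{a,a}(\vartheta)&\Gamma_{a,b}(\vartheta)\\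 \Gamma_{p,b}(\vartheta)&\Gamma_{a,b}(\vartheta)&\Gamma_{b,b}(\vartheta)\end{pmatrix},$$ where $\Gamma_{p,p}(\vartheta):=\partial^2_{pp}\log K_p(\sqrt{ab})$, $\Gamma_{a,a}(\vartheta):=\frac{p}{2a^2}+\partial^2_{aa}\log K_p(\sqrt{ab})$, $\Gamma_{b,b}(\vartheta):=-\frac{p}{2b^2}+\partial^2_{bb}\log K_p(\sqrt{ab})$, $\Gamma_{p,a}(\vartheta):=-\frac1{2a}+\partial^2_{ap}\log K_p(\sqrt{ab})$, $\Gamma_{p,b}(\vartheta):=\frac1{2b}+\partial^2_{bp}\log K_p(\sqrt{ab})$ and $\Gamma_{a,b}(\vartheta):=\partial^2_{ab}\log K_p(\sqrt{ab})$. More precisely, for any sequence $\vartheta^{(n)}=(p^{(n)},a^{(n)},b^{(n)})'\in\mathbb{R}\times(0,\infty)^2$ with $\vartheta^{(n)}=\vartheta+O(n^{-1/2})$ and for any bounded sequence $\tau^{(n)}=(\tau^{(n)}_1,\tau^{(n)}_2,\tau^{(n)}_3)'\in\mathbb{R}^3$ such that $a^{(n)}+n^{-1/2}\tau_2^{(n)}>0$ and $b^{(n)}+n^{-1/2}\tau_3^{(n)}>0$, we have $$\Lambda^{(n)}_{\vartheta^{(n)}+n^{-1/2}\tau^{(n)}/\vartheta^{(n)}}:=\log\left(\frac{d\mathrm{P}^{(n)}_{\vartheta^{(n)}+n^{-1/2}\tau^{(n)}}}{d\mathrm{P}^{(n)}_{\vartheta^{(n)}}}\right)=(\tau^{(n)})'\Delta^{(n)}(\vartheta^{(n)})-\frac12(\tau^{(n)})'\Gamma(\vartheta)\tau^{(n)}+o_{\mathrm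 P}(1)$$ and $\Delta^{(n)}(\vartheta^{(n)})\stackrel{\mathcal L}{\to}\mathcal N_3(0,\Gamma(\vartheta))$, both under $\mathrm{P}^{(n)}_{\vartheta^{(n)}}$ as $n\to\infty$.
   Context: The generalized inverse Gaussian distribution $\mathrm{GIG}(p,a,b)$, with $p\in\mathbb{R}$, $a>0$, $b>0$, has density $f_{p,a,b}(x)=c(p,a,b)x^{p-1}e^{-(ax+b/x)/2}$ for $x>0$, with $c(p,a,b)=\frac{(a/b)^{p/2}}{2K_p(\sqrt{ab})}$, where $K_p$ is the modified Bessel function of the third kind, $K_p(z)=\frac12\int_0^\infty t^{p-1}e^{-z(t+1/t)/2}\,dt$ for $z>0$. $\mathrm{P}^{(n)}_{p,a,b}=\mathrm{P}^{(n)}_{\vartheta}$ denotes the joint distribution of $n$ i.i.d. $\mathrm{GIG}(p,a,b)$ observations $X_1,\dots,X_n$. Partial derivatives such as $\partial_p\log K_p(\sqrt{ab})$ and $\partial^2_{ap}\log K_p(\sqrt{ab})$ are those of the function $(p,a,b)\mapsto\log K_p(\sqrt{ab})$. The prime denotes transposition. ULAN at $\vartheta$ with a given central sequence and information matrix means exactly the property spelled out in the "more precisely" part of the claim. *)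

theory Defs
  imports "HOL-Probability.Probability" "HOL-Library.Landau_Symbols"
begin

definition besselK :: "real \<Rightarrow> real \<Rightarrow> real" where
  "besselK p z = 1/2 * (LINT t:{0<..}|lborel. t powr (p - 1) * exp (- z * (t + 1/t) / 2))"

definition gig_const :: "real \<Rightarrow> real \<Rightarrow> real \<Rightarrow> real" where
  "gig_const p a b = (a / b) powr (p / 2) / (2 * besselK p (sqrt (a * b)))"

definition gig_density :: "real \<Rightarrow> real \<Rightarrow> real \<Rightarrow> real \<Rightarrow> real" where
  "gig_density p a b x =
     (if x > 0 then gig_const p a b * x powr (p - 1) * exp (- (a * x + b / x) / 2) else 0)"

definition gig :: "real \<Rightarrow> real \<Rightarrow> real \<Rightarrow> real measure" where
  "gig p a b = density lborel (\<lambda>x. ennreal (gig_density p a b x))"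

text \<open>From here on a parameter is the vector \<open>(p, a, b)\<close> in \<open>real ^ 3\<close>; the observations
  \<open>X\<^sub>1, \<dots>, X\<^sub>n\<close> are the coordinates \<open>x 1, \<dots>, x n\<close> of a sample point.\<close>

definition gig_params :: "(real ^ 3) set" where
  "gig_params = {\<theta>. \<theta> $ 2 > 0 \<and> \<theta> $ 3 > 0}"

definition gig_joint :: "nat \<Rightarrow> real ^ 3 \<Rightarrow> (nat \<Rightarrow> real) measure" where
  "gig_joint n \<theta> = (\<Pi>\<^sub>M i\<in>{1..n}. gig (\<theta> $ 1) (\<theta> $ 2) (\<theta> $ 3))"

definition pd_p :: "(real \<Rightarrow> real \<Rightarrow> real \<Rightarrow> real) \<Rightarrow> real \<Rightarrow> real \<Rightarrow> real \<Rightarrow> real" where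
  "pd_p F p a b = deriv (\<lambda>t. F t a b) p"

definition pd_a :: "(real \<Rightarrow> real \<Rightarrow> real \<Rightarrow> real) \<Rightarrow> real \<Rightarrow> real \<Rightarrow> real \<Rightarrow> real" where
  "pd_a F p a b = deriv (\<lambda>t. F p t b) a"

definition pd_b :: "(real \<Rightarrow> real \<Rightarrow> real \<Rightarrow> real) \<Rightarrow> real \<Rightarrow> real \<Rightarrow> real \<Rightarrow> real" where
  "pd_b F p a b = deriv (\<lambda>t. F p a t) b"

definition log_besselK :: "real \<Rightarrow> real \<Rightarrow> real \<Rightarrow> real" where
  "log_besselK p a b = ln (besselK p (sqrt (a * b)))"

definition gig_central :: "nat \<Rightarrow> real ^ 3 \<Rightarrow> (nat \<Rightarrow> real) \<Rightarrow> real ^ 3" where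
  "gig_central n \<theta> x =
     (let p = \<theta> $ 1; a = \<theta> $ 2; b = \<theta> $ 3 in
      (1 / sqrt (real n)) *\<^sub>R (\<Sum>i\<in>{1..n}. vector
        [pd_p gig_const p a b / gig_const p a b + ln (x i),
         pd_a gig_const p a b / gig_const p a b - x i / 2,
         pd_b gig_const p a b / gig_const p a b - 1 / (2 * x i)]))"

definition gig_fisher :: "real ^ 3 \<Rightarrow> real ^ 3 ^ 3" where
  "gig_fisher \<theta> =
     (let p = \<theta> $ 1; a = \<theta> $ 2; b = \<theta> $ 3;
          Gpp = pd_p (pd_p log_besselK) p a b;
          Gaa = p / (2 * a\<^sup>2) + pd_a (pd_a log_besselK) p a b;
          Gbb = - p / (2 * b\<^sup>2) + pd_b (pd_b log_besselK) p a b;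
          Gpa = - 1 / (2 * a) + pd_a (pd_p log_besselK) p a b;
          Gpb = 1 / (2 * b) + pd_b (pd_p log_besselK) p a b;
          Gab = pd_a (pd_b log_besselK) p a b
      in vector [vector [Gpp, Gpa, Gpb], vector [Gpa, Gaa, Gab], vector [Gpb, Gab, Gbb]])"

text \<open>\<open>N\<close> is the normal law \<open>\<N>(m, S)\<close>, i.e. the law of \<open>m + A Z\<close> with \<open>Z\<close> having i.i.d. standard
  normal entries and \<open>A A' = S\<close>. This law depends on \<open>A\<close> only through \<open>S\<close>, and such an \<open>A\<close>
  exists exactly when \<open>S\<close> is symmetric positive semidefinite.\<close>

definition mv_normal :: "real ^ 'k \<Rightarrow> real ^ 'k ^ 'k \<Rightarrow> (real ^ 'k) measure \<Rightarrow> bool" where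
  "mv_normal m S N \<longleftrightarrow>
     (\<exists>A :: real ^ 'k ^ 'k. A ** transpose A = S \<and>
        N = distr (\<Pi>\<^sub>M i\<in>(UNIV :: 'k set). density lborel (\<lambda>x. ennreal (std_normal_density x)))
              borel (\<lambda>z. m + A *v (\<chi> i. z i)))"

text \<open>Convergence in law and in probability, along a sequence \<open>P\<close> of laws on possibly different
  sample spaces. Measurability is required explicitly because the integral and the measure have
  default value 0 otherwise.\<close>

definition converges_in_law ::
    "(nat \<Rightarrow> 'a measure) \<Rightarrow> (nat \<Rightarrow> 'a \<Rightarrow> 'b::topological_space) \<Rightarrow> 'b measure \<Rightarrow> bool" where
  "converges_in_law P X N \<longleftrightarrow>
     (\<forall>n. X n \<in> borel_measurable (P n)) \<and>
     (\<forall>f :: 'b \<Rightarrow> real. continuous_on UNIV f \<and> bounded (range f) \<longrightarrow>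
        (\<lambda>n. \<integral>x. f (X n x) \<partial>P n) \<longlonglongrightarrow> (\<integral>y. f y \<partial>N))"

definition small_o_in_prob :: "(nat \<Rightarrow> 'a measure) \<Rightarrow> (nat \<Rightarrow> 'a \<Rightarrow> real) \<Rightarrow> bool" where
  "small_o_in_prob P R \<longleftrightarrow>
     (\<forall>n. R n \<in> borel_measurable (P n)) \<and>
     (\<forall>\<epsilon>>0. (\<lambda>n. measure (P n) {x \<in> space (P n). \<bar>R n x\<bar> > \<epsilon>}) \<longlonglongrightarrow> 0)"

text \<open>\<open>log_lik_ratio Q P\<close> is \<open>log (dQ/dP)\<close>; note that \<open>RN_deriv\<close> takes the dominating measure first.\<close>

definition log_lik_ratio :: "'a measure \<Rightarrow> 'a measure \<Rightarrow> 'a \<Rightarrow> real" where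
  "log_lik_ratio Q P x = ln (enn2real (RN_deriv P Q x))"

text \<open>ULAN at \<open>\<theta>\<close>, with contiguity rate \<open>n\<^sup>-\<^sup>1\<^sup>/\<^sup>2\<close>, of the experiments \<open>{P n \<eta> | \<eta> \<in> \<Theta>}\<close>, with central
  sequence \<open>\<Delta>\<close> and information matrix \<open>\<Gamma>\<close> (evaluated at \<open>\<theta>\<close>).\<close>

definition ulan_at ::
    "(nat \<Rightarrow> real ^ 'k \<Rightarrow> 'a measure) \<Rightarrow> (real ^ 'k) set \<Rightarrow> real ^ 'k
      \<Rightarrow> (nat \<Rightarrow> real ^ 'k \<Rightarrow> 'a \<Rightarrow> real ^ 'k) \<Rightarrow> real ^ 'k ^ 'k \<Rightarrow> bool" where
  "ulan_at P \<Theta> \<theta> \<Delta> \<Gamma> \<longleftrightarrow>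
     (\<forall>(\<eta> :: nat \<Rightarrow> real ^ 'k) (\<tau> :: nat \<Rightarrow> real ^ 'k).
        (\<forall>n\<ge>1. \<eta> n \<in> \<Theta>) \<and>
        (\<lambda>n. norm (\<eta> n - \<theta>)) \<in> O(\<lambda>n. 1 / sqrt (real n)) \<and>
        bounded (range \<tau>) \<and>
        (\<forall>n\<ge>1. \<eta> n + (1 / sqrt (real n)) *\<^sub>R \<tau> n \<in> \<Theta>) \<longrightarrow>
        small_o_in_prob (\<lambda>n. P n (\<eta> n))
          (\<lambda>n x. log_lik_ratio (P n (\<eta> n + (1 / sqrt (real n)) *\<^sub>R \<tau> n)) (P n (\<eta> n)) x
                 - (\<tau> n \<bullet> \<Delta> n (\<eta> n) x - 1/2 * (\<tau> n \<bullet> (\<Gamma> *v \<tau> n)))) \<and>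
        (\<exists>N. mv_normal 0 \<Gamma> N \<and>
             converges_in_law (\<lambda>n. P n (\<eta> n)) (\<lambda>n. \<Delta> n (\<eta> n)) N))"

end

(* The GIG laws form a full exponential family with natural parameter (p, a, b), sufficient statistic
   T(x) = (log x, -x/2, -1/(2x)) and base measure dx/x, and ULAN holds for every exponential family on
   an open parameter set. The log-likelihood ratio is exactly tau' Delta minus the deterministic number
   n log E exp (tau' (T - E T) / sqrt n). The one estimate needed is that, locally uniformly, for complex
   z in the unit disc the n-th power of E exp (z tau' (T - E T) / sqrt n) approaches
   exp (z^2 tau' Gamma tau / 2). The case z = 1 gives the quadratic expansion and, by Markov's
   inequality, tightness of the central sequence; the case z = i gives its characteristic function.
   Finally 1 / c(p, a, b) is the partition function, so the derivatives of log K_p are means and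
   covariances of T up to elementary terms. *)

theory Submission
  imports Defs "HOL-Real_Asymp.Real_Asymp"
begin

section \<open>Convergence in law from characteristic functions\<close>

text \<open>The parameter \<open>\<eta> n\<close> moves with the sample size and
  \<open>\<tau> n\<close> is merely bounded, so the observations form a triangular array and limit
  theorems for one fixed law do not apply. Every estimate needs constants shared by all parameters
  near \<theta>, and comparisons are stated as differences tending to 0 where no limit need exist.
  The shared constants have one source: an open parameter set leaves room for an integrable factor
  \<open>exp (r * norm (T x))\<close>, which pays for moving the parameter, for polynomial factors
  in T and for Taylor remainders alike. In dimension k, the passage from characteristic functions to
  bounded continuous test functions rests on tightness: on a large ball the test function is close
  to a trigonometric polynomial, whose expectation involves only finitely many values of the
  characteristic function. The case n = 0 leaves the parameters unrestricted; it is harmless because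
  a product over no observations does not depend on them.\<close>

text \<open>Trigonometric polynomials with arbitrary real frequency vectors. The phase
  \<open>c\<close> lets a single generator cover sines, cosines and constants; closure under
  products is a consequence of the product-to-sum formula.\<close>

inductive trigonometric :: "(real ^ 'k \<Rightarrow> real) \<Rightarrow> bool" where
  cos: "trigonometric (\<lambda>x. a * cos (t \<bullet> x + c))"
| add: "trigonometric f \<Longrightarrow> trigonometric g \<Longrightarrow> trigonometric (\<lambda>x. f x + g x)"

lemma trigonometric_const: "trigonometric (\<lambda>x. a)"
  using trigonometric.cos[of a 0 0] by simp

lemma trigonometric_sum:
  "finite I \<Longrightarrow> (\<And>i. i \<in> I \<Longrightarrow> trigonometric (f i)) \<Longrightarrow> trigonometric (\<lambda>x. \<Sum>i\<in>I. f i x)"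
  by (induction I rule: finite_induct) (auto intro: trigonometric_const trigonometric.add)

lemma trigonometric_mult:
  assumes "trigonometric f" and "trigonometric g"
  shows "trigonometric (\<lambda>x. f x * g x)"
  using assms
proof (induction rule: trigonometric.induct)
  case (cos a t c)
  from \<open>trigonometric g\<close> show ?case
  proof (induction rule: trigonometric.induct)
    case (cos a' t' c')
    have "trigonometric (\<lambda>x. (a * a' / 2) * cos ((t - t') \<bullet> x + (c - c'))
        + (a * a' / 2) * cos ((t + t') \<bullet> x + (c + c')))"
      by (intro trigonometric.intros)
    moreover have "a * cos (t \<bullet> x + c) * (a' * cos (t' \<bullet> x + c'))
        = (a * a' / 2) * cos ((t - t') \<bullet> x + (c - c')) + (a * a' / 2) * cos ((t + t') \<bullet> x + (c + c'))" for x
    proof -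
      have "cos ((t - t') \<bullet> x + (c - c')) = cos ((t \<bullet> x + c) - (t' \<bullet> x + c'))"
           "cos ((t + t') \<bullet> x + (c + c')) = cos ((t \<bullet> x + c) + (t' \<bullet> x + c'))"
        by (simp_all add: inner_diff_left inner_add_left algebra_simps)
      then show ?thesis by (simp only: cos_add cos_diff) (simp add: field_simps)
    qed
    ultimately show ?case by simp
  next
    case (add g h)
    then show ?case using trigonometric.add[OF add.IH] by (simp add: distrib_left)
  qed
next
  case (add f h)
  then show ?case using trigonometric.add[OF add.IH] by (simp add: distrib_right)
qed

text \<open>The coordinate sines belong to the class and the class is an algebra, so it absorbs
  every polynomial in them. This turns a Stone-Weierstrass approximation on a cube into a
  trigonometric one on the whole space.\<close>

lemma trigonometric_real_polynomial_of_sines: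
  fixes q :: "real ^ 'k \<Rightarrow> real"
  assumes "real_polynomial_function q"
  shows "trigonometric (\<lambda>x. q (\<chi> i. sin (\<omega> * x $ i)))"
  using assms
proof (induction rule: real_polynomial_function.induct)
  case (linear f)
  then interpret bounded_linear f .
  \<comment> \<open>The phase \<open>- (pi / 2)\<close> turns the cosine into a sine.\<close>
  have "trigonometric (\<lambda>x :: real ^ 'k. f (axis i 1) * cos (axis i \<omega> \<bullet> x + (- (pi / 2))))" for i
    by (rule trigonometric.cos)
  then have "trigonometric (\<lambda>x :: real ^ 'k. \<Sum>i\<in>UNIV. f (axis i 1) * cos (axis i \<omega> \<bullet> x + (- (pi / 2))))"
    by (intro trigonometric_sum) auto
  moreover have "f (\<chi> i. sin (\<omega> * x $ i)) = (\<Sum>i\<in>UNIV. f (axis i 1) * cos (axis i \<omega> \<bullet> x + (- (pi / 2))))"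
    for x :: "real ^ 'k"
  proof -
    have "(\<chi> i. sin (\<omega> * x $ i)) = (\<Sum>i\<in>UNIV. sin (\<omega> * x $ i) *\<^sub>R axis i 1)"
      by (simp add: vec_eq_iff axis_def if_distrib cong: if_cong)
    then have "f (\<chi> i. sin (\<omega> * x $ i)) = (\<Sum>i\<in>UNIV. sin (\<omega> * x $ i) * f (axis i 1))"
      by (simp add: sum scaleR)
    then show ?thesis by (simp add: inner_axis' cos_diff mult.commute)
  qed
  ultimately show ?case by simp
qed (auto intro: trigonometric_const trigonometric.add trigonometric_mult)

lemma trigonometric_bounded_continuous:
  assumes "trigonometric f"
  shows "continuous_on UNIV f \<and> bounded (range f)"
  using assms
proof (induction rule: trigonometric.induct)
  case (cos a t c)
  have "\<bar>a * cos (t \<bullet> x + c)\<bar> \<le> \<bar>a\<bar>" for x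
    using mult_left_mono[OF abs_cos_le_one[of "t \<bullet> x + c"] abs_ge_zero[of a]] by (simp add: abs_mult)
  then show ?case by (auto intro!: continuous_intros simp: bounded_iff)
next
  case (add f g)
  then show ?case by (auto intro!: continuous_intros intro: bounded_plus_comp)
qed

lemma integrable_bounded_continuous_compose:
  fixes f :: "'b::topological_space \<Rightarrow> real"
  assumes "prob_space M" "X \<in> borel_measurable M" "continuous_on UNIV f" "bounded (range f)"
  shows "integrable M (\<lambda>x. f (X x))"
proof -
  interpret prob_space M by fact
  obtain B where "\<And>x. norm (f x) \<le> B" using assms(4) by (auto simp: bounded_iff)
  moreover have "(\<lambda>x. f (X x)) \<in> borel_measurable M"
    using measurable_compose[OF assms(2) borel_measurable_continuous_onI[OF assms(3)]] .
  ultimately show ?thesis by (intro integrable_const_bound[of _ B]) auto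
qed

text \<open>A periodic \<open>g\<close> cannot follow \<open>f\<close> to infinity. The indicator
  term allows for a gap of order \<open>2 * B\<close> outside a ball, and the tail bound makes this
  gap cheap in expectation.\<close>

lemma integral_approx_off_ball:
  fixes f g :: "'b::{real_normed_vector, second_countable_topology} \<Rightarrow> real"
  assumes "prob_space M" and X[measurable]: "X \<in> borel_measurable M"
    and f: "continuous_on UNIV f" "bounded (range f)" and g: "continuous_on UNIV g" "bounded (range g)"
    and near: "\<And>x. \<bar>f x - g x\<bar> \<le> e + 2 * B * indicator {x. norm x > K} x"
    and tail: "measure M {x \<in> space M. norm (X x) > K} \<le> d" and B: "B \<ge> 0"
  shows "\<bar>(\<integral>x. f (X x) \<partial>M) - (\<integral>x. g (X x) \<partial>M)\<bar> \<le> e + 2 * B * d"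
proof -
  interpret prob_space M by fact
  let ?A = "{x \<in> space M. norm (X x) > K}"
  have A: "?A \<in> sets M" by measurable
  have int: "integrable M (\<lambda>x. f (X x))" "integrable M (\<lambda>x. g (X x))"
    using assms by (auto intro: integrable_bounded_continuous_compose)
  have "\<bar>(\<integral>x. f (X x) \<partial>M) - (\<integral>x. g (X x) \<partial>M)\<bar> = \<bar>\<integral>x. f (X x) - g (X x) \<partial>M\<bar>"
    using int by simp
  also have "\<dots> \<le> (\<integral>x. \<bar>f (X x) - g (X x)\<bar> \<partial>M)" by (rule integral_abs_bound)
  also have "\<dots> \<le> (\<integral>x. e + 2 * B * indicator ?A x \<partial>M)"
  proof (rule integral_mono)
    show "integrable M (\<lambda>x. e + 2 * B * indicator ?A x)"
      by (intro Bochner_Integration.integrable_add integrable_const integrable_mult_right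
          integrable_real_indicator A) (simp add: less_top[symmetric])
    show "\<bar>f (X x) - g (X x)\<bar> \<le> e + 2 * B * indicator ?A x" if "x \<in> space M" for x
      using near[of "X x"] that by (auto simp: indicator_def split: if_splits)
  qed (use int in auto)
  also have "\<dots> = e + 2 * B * measure M ?A"
    using A by (simp add: prob_space less_top[symmetric])
  also have "\<dots> \<le> e + 2 * B * d" using tail B by (simp add: mult_left_mono)
  finally show ?thesis .
qed

text \<open>The triangle wave \<open>arcsin (sin (\<omega> x))\<close> turns \<open>f\<close> into a periodic function without changing it on
  a large ball; as a continuous function of the sines it is uniformly approximated by polynomials.\<close>

lemma trigonometric_approx:
  fixes f :: "real ^ 'k \<Rightarrow> real"
  assumes f: "continuous_on UNIV f" and bd: "\<And>x. \<bar>f x\<bar> \<le> B" and "e > 0" "K > 0"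
  obtains g where "trigonometric g"
    "\<And>x. \<bar>f x - g x\<bar> \<le> e + 2 * B * indicator {x. norm x > K} x"
proof -
  \<comment> \<open>Chosen so that \<open>norm x \<le> K\<close> keeps every
    \<open>\<omega> * x $ i\<close> in [-pi/2, pi/2], where \<open>arcsin\<close> inverts
    \<open>sin\<close>.\<close>
  define \<omega> where "\<omega> = pi / (2 * K)"
  have \<omega>: "\<omega> > 0" using \<open>K > 0\<close> by (simp add: \<omega>_def)
  let ?h = "\<lambda>s :: real ^ 'k. f (\<chi> i. arcsin (s $ i) / \<omega>)"
  let ?S = "cbox (-1) (1 :: real ^ 'k)"
  have S: "s \<in> ?S \<longleftrightarrow> (\<forall>i. -1 \<le> s $ i \<and> s $ i \<le> 1)" for s by (simp add: mem_box_cart)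
  have "continuous_on ?S (\<lambda>s. arcsin (s $ i) / \<omega>)" for i
    using \<omega> by (intro continuous_intros) (auto simp: S)
  then have "continuous_on ?S ?h"
    by (intro continuous_on_compose2[OF f] continuous_on_vec_lambda) auto
  then obtain q where q: "real_polynomial_function q" "\<And>s. s \<in> ?S \<Longrightarrow> \<bar>?h s - q s\<bar> < e"
    using Stone_Weierstrass_real_polynomial_function[OF compact_cbox _ \<open>e > 0\<close>] by blast
  let ?sin = "\<lambda>x :: real ^ 'k. \<chi> i. sin (\<omega> * x $ i)"
  show thesis
  proof (rule that)
    show "trigonometric (\<lambda>x. q (?sin x))" by (rule trigonometric_real_polynomial_of_sines[OF q(1)])
    fix x :: "real ^ 'k"
    have close: "\<bar>?h (?sin x) - q (?sin x)\<bar> < e" by (rule q(2)) (simp add: S)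
    show "\<bar>f x - q (?sin x)\<bar> \<le> e + 2 * B * indicator {x. norm x > K} x"
    proof (cases "norm x > K")
      case True
      \<comment> \<open>Outside the ball \<open>f x\<close> and \<open>?h (?sin x)\<close> may be
        unrelated, but both are values of \<open>f\<close>, so they differ by at most
        \<open>2 * B\<close>.\<close>
      then show ?thesis using close bd[of x] bd[of "\<chi> i. arcsin (?sin x $ i) / \<omega>"] by simp
    next
      case False
      have "\<bar>\<omega> * x $ i\<bar> \<le> pi / 2" for i
      proof -
        have "\<bar>x $ i\<bar> \<le> K" using False component_le_norm_cart[of x i] by linarith
        then have "\<omega> * \<bar>x $ i\<bar> \<le> \<omega> * K" using \<omega> by simp
        then show ?thesis using \<open>K > 0\<close> \<omega> by (simp add: abs_mult \<omega>_def)
      qed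
      then have "arcsin (sin (\<omega> * x $ i)) = \<omega> * x $ i" for i
        by (intro arcsin_sin) (simp_all only: abs_le_iff minus_le_iff)
      then have "?h (?sin x) = f x" using \<omega> by (simp add: vec_lambda_eta)
      then show ?thesis using close False by simp
    qed
  qed
qed

lemma prob_tail_small:
  fixes N :: "(real ^ 'k) measure"
  assumes "prob_space N" "sets N = sets borel" "d > 0"
  obtains K where "K > 0" "measure N {x \<in> space N. norm x > K} \<le> d"
proof -
  interpret prob_space N by fact
  have [measurable_cong]: "sets N = sets borel" by fact
  let ?A = "\<lambda>n::nat. {x \<in> space N. norm x > real n}"
  have "(\<lambda>n. measure N (?A n)) \<longlonglongrightarrow> measure N (\<Inter>n. ?A n)"
    by (intro finite_Lim_measure_decseq) (auto simp: decseq_def image_subset_iff)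
  moreover have "x \<notin> (\<Inter>n. ?A n)" for x
  proof -
    obtain n :: nat where "norm x < real n" using reals_Archimedean2 by blast
    then have "x \<notin> ?A n" by simp
    then show ?thesis by blast
  qed
  then have "(\<Inter>n. ?A n) = {}" by blast
  ultimately have "(\<lambda>n. measure N (?A n)) \<longlonglongrightarrow> 0" by simp
  then have "\<forall>\<^sub>F n in sequentially. measure N (?A n) < d" using \<open>d > 0\<close> by (rule order_tendstoD)
  then obtain n where "n > 0" "measure N (?A n) < d"
    using eventually_happens'[OF sequentially_bot eventually_conj[OF eventually_gt_at_top[of 0]]] by blast
  then show thesis by (intro that[of "real n"]) auto
qed

text \<open>The phase \<open>c\<close> makes convergence of the cosine integrals the real form of
  convergence of characteristic functions. It extends to trigonometric polynomials by linearity, and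
  to bounded continuous functions by approximation on a ball that carries nearly all mass of
  \<open>N\<close> and, eventually, of the laws of \<open>X n\<close>.\<close>

theorem converges_in_law_cos:
  fixes X :: "nat \<Rightarrow> 'a \<Rightarrow> real ^ 'k" and N :: "(real ^ 'k) measure"
  assumes P: "\<And>n. prob_space (P n)" and X: "\<And>n. X n \<in> borel_measurable (P n)"
    and N: "prob_space N" and setsN: "sets N = sets borel"
    and lim: "\<And>t c. (\<lambda>n. \<integral>x. cos (t \<bullet> X n x + c) \<partial>P n) \<longlonglongrightarrow> (\<integral>y. cos (t \<bullet> y + c) \<partial>N)"
    and tight: "\<And>d. d > 0 \<Longrightarrow> \<exists>K. \<forall>\<^sub>F n in sequentially. measure (P n) {x \<in> space (P n). norm (X n x) > K} \<le> d"
  shows "converges_in_law P X N"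
proof -
  have idN: "(\<lambda>y. y) \<in> borel_measurable N" using setsN by measurable
  have trig_lim: "(\<lambda>n. \<integral>x. g (X n x) \<partial>P n) \<longlonglongrightarrow> (\<integral>y. g y \<partial>N)" if "trigonometric g" for g
    using that
  proof (induction rule: trigonometric.induct)
    case (cos a t c)
    then show ?case by (auto intro!: tendsto_intros lim)
  next
    case (add f g)
    note bc = trigonometric_bounded_continuous
    have "integrable (P n) (\<lambda>x. f (X n x))" "integrable (P n) (\<lambda>x. g (X n x))" for n
      using P X bc add.hyps by (auto intro: integrable_bounded_continuous_compose)
    moreover have "integrable N f" "integrable N g"
      using integrable_bounded_continuous_compose[OF N idN] bc add.hyps by auto
    ultimately show ?case using tendsto_add[OF add.IH] by simp
  qed
  have "(\<lambda>n. \<integral>x. f (X n x) \<partial>P n) \<longlonglongrightarrow> (\<integral>y. f y \<partial>N)"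
    if f: "continuous_on UNIV f" "bounded (range f)" for f :: "real ^ 'k \<Rightarrow> real"
  proof (rule LIMSEQ_I)
    fix r :: real assume "r > 0"
    obtain B where B: "\<And>x. \<bar>f x\<bar> \<le> B" using f(2) by (auto simp: bounded_iff)
    have "B \<ge> 0" using B[of 0] by linarith
    \<comment> \<open>Replacing \<open>f\<close> by \<open>g\<close> costs
      \<open>e + 2 * B * e\<close> under \<open>P n\<close> and again under \<open>N\<close>. This
      \<open>e\<close> keeps the sum of the two costs strictly below \<open>r\<close>, leaving room
      for the convergence of the integrals of \<open>g\<close>.\<close>
    define e where "e = r / (4 + 4 * B)"
    have e: "e > 0" using \<open>r > 0\<close> \<open>B \<ge> 0\<close> by (simp add: e_def)
    have er: "2 * (e + 2 * B * e) < r"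
    proof -
      have "2 * (e + 2 * B * e) = e * (2 + 4 * B)" by (simp add: algebra_simps)
      also have "\<dots> < e * (4 + 4 * B)" using e by simp
      also have "\<dots> = r" using \<open>B \<ge> 0\<close> by (simp add: e_def)
      finally show ?thesis .
    qed
    obtain K1 where K1: "\<forall>\<^sub>F n in sequentially. measure (P n) {x \<in> space (P n). norm (X n x) > K1} \<le> e"
      using tight[OF e] by blast
    obtain K2 where K2: "K2 > 0" "measure N {x \<in> space N. norm x > K2} \<le> e"
      using prob_tail_small[OF N setsN e] by blast
    \<comment> \<open>One radius has to serve both tails, since the approximant \<open>g\<close> is
      built for a single ball.\<close>
    define K where "K = max K1 K2"
    have "K > 0" using K2 by (simp add: K_def)
    have mono: "measure M {x \<in> space M. norm (Y x) > K} \<le> measure M {x \<in> space M. norm (Y x) > K'}"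
      if "prob_space M" "Y \<in> borel_measurable M" "K' \<le> K" for M K' and Y :: "'b \<Rightarrow> real ^ 'k"
    proof -
      interpret prob_space M by fact
      have [measurable]: "Y \<in> borel_measurable M" by fact
      show ?thesis using that by (intro finite_measure_mono) auto
    qed
    obtain g where g: "trigonometric g"
      "\<And>x. \<bar>f x - g x\<bar> \<le> e + 2 * B * indicator {x. norm x > K} x"
      using trigonometric_approx[OF f(1) B e \<open>K > 0\<close>] by blast
    note bg = trigonometric_bounded_continuous[OF g(1)]
    have tailN: "measure N {x \<in> space N. norm x > K} \<le> e"
      using mono[OF N idN, of K2] K2 by (simp add: K_def)
    have N_close: "\<bar>(\<integral>y. f y \<partial>N) - (\<integral>y. g y \<partial>N)\<bar> \<le> e + 2 * B * e"
      by (rule integral_approx_off_ball[OF N idN f _ _ g(2) tailN \<open>B \<ge> 0\<close>]) (use bg in auto)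
    have chain: "\<bar>u - v\<bar> \<le> s \<Longrightarrow> \<bar>v - w\<bar> < r - 2 * s \<Longrightarrow> \<bar>z - w\<bar> \<le> s \<Longrightarrow> \<bar>u - z\<bar> < r"
      for u v w z s :: real by linarith
    have "\<forall>\<^sub>F n in sequentially. \<bar>(\<integral>x. g (X n x) \<partial>P n) - (\<integral>y. g y \<partial>N)\<bar> < r - 2 * (e + 2 * B * e)"
      using tendstoD[OF trig_lim[OF g(1)], of "r - 2 * (e + 2 * B * e)"] er by (simp add: dist_real_def)
    then have "\<forall>\<^sub>F n in sequentially. norm ((\<integral>x. f (X n x) \<partial>P n) - (\<integral>y. f y \<partial>N)) < r"
      using K1
    proof eventually_elim
      case (elim n)
      have "measure (P n) {x \<in> space (P n). norm (X n x) > K} \<le> e"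
        using mono[OF P[of n] X[of n], of K1] elim(2) by (simp add: K_def)
      then have "\<bar>(\<integral>x. f (X n x) \<partial>P n) - (\<integral>x. g (X n x) \<partial>P n)\<bar> \<le> e + 2 * B * e"
        by (rule integral_approx_off_ball[OF P X f _ _ g(2) _ \<open>B \<ge> 0\<close>, rotated 2]) (use bg in auto)
      then show ?case using elim(1) N_close chain unfolding real_norm_def by blast
    qed
    then show "\<exists>no. \<forall>n\<ge>no. norm ((\<integral>x. f (X n x) \<partial>P n) - (\<integral>y. f y \<partial>N)) < r"
      by (simp add: eventually_sequentially)
  qed
  with X show ?thesis unfolding converges_in_law_def by blast
qed

section \<open>Factorization of covariance matrices and Gaussian characteristic functions\<close>

text \<open>Symmetric Gaussian elimination (Cholesky). Splitting off the pivot \<open>l\<close>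
  leaves the Schur complement, again positive semidefinite and supported on the remaining indices.
  The induction runs over the supporting index set because the matrix type is fixed.\<close>

lemma psd_factorization_on:
  fixes S :: "real ^ 'k ^ 'k"
  assumes "finite J"
    and "\<And>i j. S $ i $ j = S $ j $ i"
    and "\<And>x. 0 \<le> x \<bullet> (S *v x)"
    and "\<And>i j. i \<notin> J \<Longrightarrow> S $ i $ j = 0"
  shows "\<exists>A :: 'k \<Rightarrow> 'k \<Rightarrow> real. \<forall>i j. S $ i $ j = (\<Sum>k\<in>J. A i k * A j k)"
  using assms
proof (induction J arbitrary: S rule: finite_induct)
  case empty
  then show ?case by simp
next
  case (insert l J)
  note sym = insert.prems(1) and psd = insert.prems(2) and supp = insert.prems(3)
  have ax: "axis l 1 \<bullet> (S *v y) = (\<Sum>j\<in>UNIV. S $ l $ j * y $ j)" for y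
    by (simp add: inner_axis' matrix_vector_mult_def)
  have Sax: "(S *v axis l 1) $ i = S $ i $ l" for i
    by (simp add: matrix_vector_mult_basis column_def)
  have sw: "x \<bullet> (S *v y) = y \<bullet> (S *v x)" for x y
  proof -
    have "transpose S = S" using sym by (simp add: transpose_def vec_eq_iff)
    then show ?thesis by (metis dot_lmul_matrix inner_commute transpose_matrix_vector)
  qed
  have quad: "(x + c *\<^sub>R axis l 1) \<bullet> (S *v (x + c *\<^sub>R axis l 1))
      = x \<bullet> (S *v x) + 2 * c * (x \<bullet> (S *v axis l 1)) + c\<^sup>2 * S $ l $ l" for x c
    using sw[of x "axis l 1"]
    by (simp add: matrix_vector_right_distrib inner_add_left inner_add_right
        matrix_vector_mult_scaleR inner_axis' Sax power2_eq_square algebra_simps)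
  have nonneg: "0 \<le> S $ l $ l"
    using psd[of "axis l 1"] by (simp add: inner_axis' Sax)
  show ?case
  proof (cases "S $ l $ l = 0")
    case True
    have zero: "x \<bullet> (S *v axis l 1) = 0" for x
    proof (rule ccontr)
      \<comment> \<open>With a zero pivot, \<open>quad\<close> is affine in the coefficient of
        \<open>axis l 1\<close>, with slope \<open>2 * ?m\<close>. A nonzero slope would let the
        form reach any value; \<open>?c\<close> solves for -1. Hence a zero pivot has a zero row and
        column.\<close>
      let ?m = "x \<bullet> (S *v axis l 1)" let ?c = "- (x \<bullet> (S *v x) + 1) / (2 * ?m)"
      assume "?m \<noteq> 0"
      then have "(x + ?c *\<^sub>R axis l 1) \<bullet> (S *v (x + ?c *\<^sub>R axis l 1)) = -1"
        unfolding quad True by (simp add: field_simps)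
      with psd[of "x + ?c *\<^sub>R axis l 1"] show False by linarith
    qed
    have "S $ i $ l = 0" for i
      using zero[of "axis i 1"] by (simp add: inner_axis' Sax)
    then have "S $ l $ i = 0" for i using sym by metis
    then have "i \<notin> J \<Longrightarrow> S $ i $ j = 0" for i j
      using supp[of i j] by (cases "i = l") auto
    then obtain A where A: "\<And>i j. S $ i $ j = (\<Sum>k\<in>J. A i k * A j k)"
      using insert.IH[of S] sym psd by blast
    have "S $ i $ j = (\<Sum>k\<in>insert l J. (if k = l then 0 else A i k) * (if k = l then 0 else A j k))" for i j
      unfolding A using insert.hyps by (auto intro!: sum.cong)
    then show ?thesis by (intro exI[of _ "\<lambda>i k. if k = l then 0 else A i k"]) auto
  next
    case False
    define s where "s = S $ l $ l"
    have s: "s > 0" using False nonneg by (simp add: s_def)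
    define v where "v i = S $ i $ l / sqrt s" for i
    have vv: "v i * v j = S $ i $ l * S $ j $ l / s" for i j
      using s by (simp add: v_def)
    define S' :: "real ^ 'k ^ 'k" where "S' = (\<chi> i j. S $ i $ j - v i * v j)"
    \<comment> \<open>Completing the square: this \<open>c\<close> minimises the form of
      \<open>S\<close> along the direction \<open>axis l 1\<close>, and the minimum is the form of
      the Schur complement \<open>S'\<close>. Its nonnegativity is therefore inherited from
      \<open>S\<close>.\<close>
    have "x \<bullet> (S' *v x) = (x + c *\<^sub>R axis l 1) \<bullet> (S *v (x + c *\<^sub>R axis l 1))"
      if c: "c = - (x \<bullet> (S *v axis l 1)) / s" for x c
    proof -
      have "x \<bullet> (S' *v x) = x \<bullet> (S *v x) - (\<Sum>i\<in>UNIV. x $ i * v i)\<^sup>2"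
        unfolding S'_def inner_vec_def matrix_vector_mult_def
        by (simp add: sum_distrib_left sum_subtractf power2_eq_square sum_product algebra_simps)
      also have "(\<Sum>i\<in>UNIV. x $ i * v i) = (x \<bullet> (S *v axis l 1)) / sqrt s"
        by (simp add: v_def inner_vec_def Sax sum_divide_distrib)
      also have "x \<bullet> (S *v x) - ((x \<bullet> (S *v axis l 1)) / sqrt s)\<^sup>2
          = (x + c *\<^sub>R axis l 1) \<bullet> (S *v (x + c *\<^sub>R axis l 1))"
        unfolding quad c using s by (simp add: s_def[symmetric] field_simps power2_eq_square)
      finally show ?thesis .
    qed
    then have psd': "0 \<le> x \<bullet> (S' *v x)" for x using psd by simp
    have sym': "S' $ i $ j = S' $ j $ i" for i j
      using sym[of i j] by (simp add: S'_def mult.commute)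
    have "S' $ i $ j = 0" if "i \<notin> J" for i j
    proof (cases "i = l")
      case True
      then show ?thesis using s sym[of l j] by (simp add: S'_def vv s_def[symmetric])
    next
      case False
      then show ?thesis using that supp[of i] by (simp add: S'_def vv)
    qed
    then obtain A where A: "\<And>i j. S' $ i $ j = (\<Sum>k\<in>J. A i k * A j k)"
      using insert.IH[of S'] sym' psd' by blast
    have "S $ i $ j = (\<Sum>k\<in>insert l J. (if k = l then v i else A i k) * (if k = l then v j else A j k))" for i j
    proof -
      have "S $ i $ j = v i * v j + S' $ i $ j" by (simp add: S'_def)
      also have "S' $ i $ j = (\<Sum>k\<in>J. (if k = l then v i else A i k) * (if k = l then v j else A j k))"
        unfolding A using insert.hyps by (auto intro!: sum.cong)
      finally show ?thesis using insert.hyps by simp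
    qed
    then show ?thesis by (intro exI[of _ "\<lambda>i k. if k = l then v i else A i k"]) auto
  qed
qed

lemma psd_factorization:
  fixes S :: "real ^ 'k ^ 'k"
  assumes "\<And>i j. S $ i $ j = S $ j $ i" and "\<And>x. 0 \<le> x \<bullet> (S *v x)"
  obtains A :: "real ^ 'k ^ 'k" where "A ** transpose A = S"
proof -
  have "\<exists>A :: 'k \<Rightarrow> 'k \<Rightarrow> real. \<forall>i j. S $ i $ j = (\<Sum>k\<in>UNIV. A i k * A j k)"
    by (rule psd_factorization_on) (use assms in auto)
  then obtain B :: "'k \<Rightarrow> 'k \<Rightarrow> real" where B: "\<forall>i j. S $ i $ j = (\<Sum>k\<in>UNIV. B i k * B j k)" ..
  have "(\<chi> i j. B i j) ** transpose (\<chi> i j. B i j) = S"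
    by (simp add: matrix_matrix_mult_def transpose_def vec_eq_iff B)
  then show thesis by (rule that)
qed

text \<open>Transposing \<open>A\<close> reduces the form \<open>t \<bullet> y\<close> to a linear
  combination of independent standard normals, whose characteristic function is a product. The
  summand \<open>0 +\<close> keeps \<open>N\<close> literally in the shape demanded by
  \<open>mv_normal\<close> with mean 0.\<close>

lemma gaussian_cos:
  fixes A :: "real ^ 'k ^ 'k"
  defines "N \<equiv> distr (\<Pi>\<^sub>M i\<in>(UNIV :: 'k set). density lborel (\<lambda>x. ennreal (std_normal_density x)))
              borel (\<lambda>z. 0 + A *v (\<chi> i. z i))"
  shows "prob_space N" and "sets N = sets borel"
    and "(\<integral>y. cos (t \<bullet> y + c) \<partial>N) = cos c * exp (- (t \<bullet> ((A ** transpose A) *v t)) / 2)"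
proof -
  let ?n = "density lborel (\<lambda>x. ennreal (std_normal_density x))"
  let ?P = "\<Pi>\<^sub>M i\<in>(UNIV :: 'k set). ?n"
  interpret n: prob_space ?n by (rule prob_space_normal_density) simp
  interpret P: product_sigma_finite "\<lambda>_ :: 'k. ?n" by unfold_locales
  interpret PP: prob_space ?P by (intro prob_space_PiM n.prob_space_axioms)
  have vec_meas: "(\<lambda>z. (\<chi> i. z i) :: real ^ 'k) \<in> borel_measurable ?P"
  proof -
    have "(\<lambda>z. \<Sum>i\<in>UNIV. z i *\<^sub>R axis i 1 :: real ^ 'k) \<in> borel_measurable ?P"
      by (intro borel_measurable_sum borel_measurable_scaleR borel_measurable_const) measurable
    moreover have "(\<chi> i. z i) = (\<Sum>i\<in>UNIV. z i *\<^sub>R axis i 1 :: real ^ 'k)" for z :: "'k \<Rightarrow> real"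
      by (simp add: vec_eq_iff axis_def if_distrib cong: if_cong)
    ultimately show ?thesis by simp
  qed
  have meas: "(\<lambda>z. 0 + A *v (\<chi> i. z i)) \<in> borel_measurable ?P"
  proof -
    from vec_meas have "(\<lambda>z. A *v (\<chi> i. z i)) \<in> borel_measurable ?P"
      by (rule measurable_compose)
         (intro borel_measurable_continuous_onI linear_continuous_on matrix_vector_mul_bounded_linear)
    then show ?thesis by simp
  qed
  then show "prob_space N" unfolding N_def by (rule PP.prob_space_distr)
  show "sets N = sets borel" by (simp add: N_def)
  define s where "s = transpose A *v t"
  have ts: "t \<bullet> (A *v z) = s \<bullet> z" for z
    by (simp add: s_def dot_lmul_matrix[symmetric] matrix_transpose_mul)
  have ss: "s \<bullet> s = t \<bullet> ((A ** transpose A) *v t)"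
  proof -
    have "s \<bullet> s = t \<bullet> (A *v s)" by (simp only: ts)
    then show ?thesis by (simp only: s_def matrix_vector_mul_assoc)
  qed
  have int: "integrable ?n (\<lambda>x. exp (\<i> * of_real (u * x)))" for u :: real
    by (rule n.integrable_const_bound[of _ 1]) auto
  have "(\<integral>z. (\<Prod>k\<in>UNIV. exp (\<i> * of_real (s $ k * z k))) \<partial>?P) = (\<Prod>k\<in>UNIV. \<integral>x. exp (\<i> * of_real (s $ k * x)) \<partial>?n)"
    by (rule P.product_integral_prod) (use int in auto)
  also have "\<dots> = (\<Prod>k\<in>UNIV. of_real (exp (- ((s $ k)\<^sup>2) / 2)))"
    using char_std_normal_distribution by (simp add: char_def fun_eq_iff)
  also have "\<dots> = of_real (exp (- (s \<bullet> s) / 2))"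
    by (simp add: exp_sum[symmetric] inner_vec_def power2_eq_square sum_negf[symmetric] sum_divide_distrib
        flip: of_real_prod)
  finally have char: "(\<integral>z. exp (\<i> * of_real (s \<bullet> (\<chi> i. z i))) \<partial>?P) = of_real (exp (- (s \<bullet> s) / 2))"
    by (simp add: exp_sum[symmetric] inner_vec_def sum_distrib_left)
  have int': "integrable ?P (\<lambda>z. exp (\<i> * of_real (s \<bullet> (\<chi> i. z i))))"
  proof (rule PP.integrable_const_bound[of _ 1])
    have "(\<lambda>z. s \<bullet> (\<chi> i. z i)) \<in> borel_measurable ?P"
      by (intro borel_measurable_inner borel_measurable_const vec_meas)
    then show "(\<lambda>z. exp (\<i> * of_real (s \<bullet> (\<chi> i. z i)))) \<in> borel_measurable ?P" by measurable
  qed auto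
  have "(\<integral>y. cos (t \<bullet> y + c) \<partial>N) = (\<integral>z. cos (s \<bullet> (\<chi> i. z i) + c) \<partial>?P)"
    unfolding N_def by (subst integral_distr[OF meas]) (auto simp: ts)
  also have "\<dots> = (\<integral>z. Re (exp (\<i> * of_real c) * exp (\<i> * of_real (s \<bullet> (\<chi> i. z i)))) \<partial>?P)"
    by (simp add: exp_add[symmetric] Re_exp add.commute)
  also have "\<dots> = Re (exp (\<i> * of_real c) * of_real (exp (- (s \<bullet> s) / 2)))"
    using int' by (simp only: integral_Re integrable_mult_right integral_mult_right_zero char)
  also have "\<dots> = cos c * exp (- (s \<bullet> s) / 2)" by (simp add: Re_exp)
  finally show "(\<integral>y. cos (t \<bullet> y + c) \<partial>N) = cos c * exp (- (t \<bullet> ((A ** transpose A) *v t)) / 2)"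
    by (simp add: ss)
qed

section \<open>Exponential families\<close>

lemma abs_exp_minus_linear_le: "\<bar>exp s - 1 - s\<bar> \<le> s\<^sup>2 * exp \<bar>s\<bar>" for s :: real
  using Taylor_exp_field[of s 1] by (simp add: mult.commute algebra_simps power2_eq_square)

lemma norm_exp_minus_linear_le: "norm (exp w - 1 - w) \<le> norm w ^ 2 * exp (norm w)" for w :: complex
  using Taylor_exp_field[of w 1] by (simp add: mult.commute algebra_simps power2_eq_square)

lemma norm_exp_minus_quadratic_le: "norm (exp w - 1 - w - w\<^sup>2 / 2) \<le> norm w ^ 3 * exp (norm w)" for w :: complex
proof -
  have "norm (exp w - 1 - w - w\<^sup>2 / 2) \<le> exp (norm w) * norm w ^ 3 / 2"
    using Taylor_exp_field[of w 2] by (simp add: numeral_2_eq_2 numeral_3_eq_3 algebra_simps)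
  also have "\<dots> \<le> norm w ^ 3 * exp (norm w)" by simp
  finally show ?thesis .
qed

text \<open>The sequence \<open>q\<close> is only bounded, as the local directions need not
  converge, so the claim is about a difference. Comparing powers with those of
  \<open>exp (q n / n)\<close> avoids a complex logarithm: telescoping loses a factor n, which an
  error of order n^(-3/2) can afford.\<close>

lemma power_diff_exp_tendsto_0:
  fixes \<phi> q :: "nat \<Rightarrow> complex"
  assumes \<phi>: "\<forall>\<^sub>F n in sequentially. norm (\<phi> n - 1 - q n / of_nat n) \<le> C / (real n * sqrt (real n))"
    and q: "\<And>n. norm (q n) \<le> B" and "C \<ge> 0"
  shows "(\<lambda>n. \<phi> n ^ n - exp (q n)) \<longlonglongrightarrow> 0"
proof -
  have "B \<ge> 0" using q[of 0] norm_ge_zero order_trans by blast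
  define D where "D = C + B\<^sup>2 * exp B"
  have "(\<lambda>n. exp (B + C) * D * (1 / sqrt (real n))) \<longlonglongrightarrow> exp (B + C) * D * 0"
    by (intro tendsto_intros) real_asymp
  then have lim: "(\<lambda>n. exp (B + C) * D / sqrt (real n)) \<longlonglongrightarrow> 0" by simp
  have "\<forall>\<^sub>F n in sequentially. norm (\<phi> n ^ n - exp (q n)) \<le> exp (B + C) * D / sqrt (real n)"
    using \<phi> eventually_gt_at_top[of 0]
  proof eventually_elim
    case (elim n)
    define v where "v = exp (q n / of_nat n)"
    \<comment> \<open>A common bound for the norms of \<open>\<phi> n\<close> and \<open>v\<close>
      whose n-th power is the constant \<open>exp (B + C)\<close>. Dividing by \<open>E\<close> puts
      both in the closed unit disc, where n-th powers differ by at most n times the difference of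
      the bases.\<close>
    define E where "E = exp ((B + C) / real n)"
    have n: "real n \<ge> 1" using elim by simp
    have sn: "sqrt (real n) \<ge> 1" "sqrt (real n) \<le> real n"
      using n by (auto intro: real_sqrt_ge_one simp: real_le_lsqrt power2_eq_square)
    have nn: "real n \<le> real n * sqrt (real n)" "real n * sqrt (real n) \<le> (real n)\<^sup>2"
      using n sn by (auto simp: power2_eq_square)
    have qn: "norm (q n / of_nat n) \<le> B / real n"
      using q[of n] by (simp add: norm_divide divide_right_mono)
    have qB: "norm (q n / of_nat n) \<le> B"
      using qn n \<open>B \<ge> 0\<close> by (smt (verit) div_by_1 frac_le)
    have "norm (v - 1 - q n / of_nat n) \<le> norm (q n / of_nat n) ^ 2 * exp (norm (q n / of_nat n))"
      unfolding v_def by (rule norm_exp_minus_linear_le)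
    also have "\<dots> \<le> (B / real n)\<^sup>2 * exp B"
      using qn qB by (intro mult_mono power_mono) auto
    also have "\<dots> \<le> B\<^sup>2 * exp B / (real n * sqrt (real n))"
      using nn n by (simp add: power_divide frac_le)
    finally have v: "norm (v - 1 - q n / of_nat n) \<le> B\<^sup>2 * exp B / (real n * sqrt (real n))" .
    have "norm (\<phi> n - v) \<le> norm (\<phi> n - 1 - q n / of_nat n) + norm (v - 1 - q n / of_nat n)"
      using norm_triangle_ineq4[of "\<phi> n - 1 - q n / of_nat n" "v - 1 - q n / of_nat n"] by simp
    also have "\<dots> \<le> D / (real n * sqrt (real n))"
      using elim(1) v by (simp add: D_def add_divide_distrib)
    finally have diff: "norm (\<phi> n - v) \<le> D / (real n * sqrt (real n))" .
    have "norm (\<phi> n) \<le> norm (\<phi> n - 1 - q n / of_nat n) + norm (1 + q n / of_nat n)"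
      using norm_triangle_ineq[of "\<phi> n - 1 - q n / of_nat n" "1 + q n / of_nat n"] by simp
    also have "\<dots> \<le> C / real n + (1 + B / real n)"
    proof (rule add_mono)
      show "norm (\<phi> n - 1 - q n / of_nat n) \<le> C / real n"
        using elim(1) nn n \<open>C \<ge> 0\<close> by (smt (verit) frac_le)
      show "norm (1 + q n / of_nat n) \<le> 1 + B / real n"
        using qn norm_triangle_ineq[of 1 "q n / of_nat n"] by simp
    qed
    also have "\<dots> = 1 + (B + C) / real n" by (simp add: add_divide_distrib)
    also have "\<dots> \<le> E" unfolding E_def by (rule exp_ge_add_one_self)
    finally have \<phi>E: "norm (\<phi> n) \<le> E" .
    have "norm v \<le> exp (norm (q n / of_nat n))" unfolding v_def by (rule norm_exp)
    also have "\<dots> \<le> E" unfolding E_def using qn \<open>C \<ge> 0\<close> n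
      by (simp add: add_divide_distrib) (smt (verit) divide_nonneg_nonneg of_nat_0_le_iff)
    finally have vE: "norm v \<le> E" .
    have E1: "E \<ge> 1" using \<open>B \<ge> 0\<close> \<open>C \<ge> 0\<close> by (simp add: E_def)
    have En: "E ^ n = exp (B + C)" using n by (simp add: E_def exp_of_nat_mult[symmetric])
    have vn: "v ^ n = exp (q n)" using n by (simp add: v_def exp_of_nat_mult[symmetric])
    have "norm ((\<phi> n / of_real E) ^ n - (v / of_real E) ^ n) \<le> n * norm (\<phi> n / of_real E - v / of_real E)"
      using \<phi>E vE E1 by (intro norm_power_diff) (auto simp: norm_divide)
    also have "\<dots> \<le> n * norm (\<phi> n - v)"
    proof -
      have "norm (\<phi> n / of_real E - v / of_real E) = norm (\<phi> n - v) / E"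
        using E1 by (simp add: diff_divide_distrib[symmetric] norm_divide)
      also have "\<dots> \<le> norm (\<phi> n - v)" using E1 by (simp add: divide_le_eq mult_left_le mult_le_cancel_left1)
      finally show ?thesis by (simp add: mult_left_mono)
    qed
    also have "\<dots> \<le> n * (D / (real n * sqrt (real n)))" by (intro mult_left_mono diff) simp
    also have "\<dots> = D / sqrt (real n)" using n by simp
    finally have "norm ((\<phi> n / of_real E) ^ n - (v / of_real E) ^ n) \<le> D / sqrt (real n)" .
    moreover have "(\<phi> n / of_real E) ^ n - (v / of_real E) ^ n = (\<phi> n ^ n - exp (q n)) / of_real (exp (B + C))"
      using En[symmetric] by (simp add: power_divide vn diff_divide_distrib)
    ultimately have "norm (\<phi> n ^ n - exp (q n)) / exp (B + C) \<le> D / sqrt (real n)"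
      by (simp add: norm_divide)
    then show ?case by (simp add: divide_le_eq mult.commute)
  qed
  then show ?thesis using lim by (rule Lim_null_comparison)
qed

lemma norm_axis_real: "norm (axis i c) = \<bar>c\<bar>" for c :: real
proof -
  have "axis i c = c *\<^sub>R axis i (1 :: real)" by (simp add: vec_eq_iff axis_def)
  then show ?thesis by simp
qed

text \<open>The norm is at most the dimension times the largest absolute coordinate, and the sum
  over both signs removes the absolute value. Thus an exponential of the norm is controlled by
  finitely many exponentials of linear functionals, which are what an exponential family can
  integrate.\<close>

lemma exp_norm_le_sum:
  fixes v :: "real ^ 'k" and r :: real
  assumes "r \<ge> 0"
  shows "exp (r * norm v) \<le> (\<Sum>i\<in>UNIV. exp (axis i (real CARD('k) * r) \<bullet> v) + exp (axis i (- (real CARD('k) * r)) \<bullet> v))"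
proof -
  let ?e = "real CARD('k) * r"
  let ?A = "range (\<lambda>i. \<bar>v $ i\<bar>)"
  have "Max ?A \<in> ?A" by (rule Max_in) auto
  then obtain j where "Max ?A = \<bar>v $ j\<bar>" by blast
  then have j: "\<bar>v $ i\<bar> \<le> \<bar>v $ j\<bar>" for i by (metis Max_ge finite finite_imageI rangeI)
  have "norm v \<le> (\<Sum>i\<in>UNIV. \<bar>v $ i\<bar>)" by (rule norm_le_l1_cart)
  also have "\<dots> \<le> (\<Sum>i\<in>(UNIV :: 'k set). \<bar>v $ j\<bar>)" by (intro sum_mono j)
  finally have "norm v \<le> CARD('k) * \<bar>v $ j\<bar>" by simp
  from mult_left_mono[OF this assms] have "exp (r * norm v) \<le> exp (?e * \<bar>v $ j\<bar>)"
    by (simp add: mult_ac)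
  also have "\<dots> \<le> exp (axis j ?e \<bullet> v) + exp (axis j (- ?e) \<bullet> v)"
    by (cases "v $ j \<ge> 0") (auto simp: inner_axis')
  also have "\<dots> \<le> (\<Sum>i\<in>UNIV. exp (axis i ?e \<bullet> v) + exp (axis i (- ?e) \<bullet> v))"
    by (rule member_le_sum[of j UNIV "\<lambda>j. exp (axis j ?e \<bullet> v) + exp (axis j (- ?e) \<bullet> v)"]) auto
  finally show ?thesis .
qed

text \<open>A crude bound by the entries suffices, since covariance matrices are compared entry by
  entry.\<close>

lemma inner_matrix_vector_bound:
  fixes S :: "real ^ 'k ^ 'k"
  shows "\<bar>u \<bullet> (S *v v)\<bar> \<le> norm u * norm v * (\<Sum>i\<in>UNIV. \<Sum>j\<in>UNIV. \<bar>S $ i $ j\<bar>)"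
proof -
  have "u \<bullet> (S *v v) = (\<Sum>i\<in>UNIV. \<Sum>j\<in>UNIV. u $ i * S $ i $ j * v $ j)"
    by (simp add: inner_vec_def matrix_vector_mult_def sum_distrib_left mult_ac)
  also have "\<bar>\<dots>\<bar> \<le> (\<Sum>i\<in>UNIV. \<Sum>j\<in>UNIV. \<bar>u $ i * S $ i $ j * v $ j\<bar>)"
    by (intro order_trans[OF sum_abs] sum_mono sum_abs)
  also have "\<dots> \<le> (\<Sum>i\<in>UNIV. \<Sum>j\<in>UNIV. norm u * norm v * \<bar>S $ i $ j\<bar>)"
  proof (intro sum_mono)
    fix i j
    have "\<bar>u $ i * S $ i $ j * v $ j\<bar> = (\<bar>u $ i\<bar> * \<bar>v $ j\<bar>) * \<bar>S $ i $ j\<bar>" by (simp add: abs_mult)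
    also have "\<dots> \<le> norm u * norm v * \<bar>S $ i $ j\<bar>"
      by (intro mult_right_mono mult_mono component_le_norm_cart) auto
    finally show "\<bar>u $ i * S $ i $ j * v $ j\<bar> \<le> norm u * norm v * \<bar>S $ i $ j\<bar>" .
  qed
  finally show ?thesis by (simp add: sum_distrib_left)
qed

lemma prob_space_PiM_nat:
  fixes M :: "nat \<Rightarrow> 'a measure"
  assumes "\<And>i. i \<in> {1..n} \<Longrightarrow> prob_space (M i)"
  shows "prob_space (\<Pi>\<^sub>M i\<in>{1..n}. M i)"
proof (cases "n = 0")
  case True
  show ?thesis unfolding True by (intro prob_spaceI) (simp add: space_PiM PiM_empty)
next
  \<comment> \<open>The rule for products asks for a probability measure at every index; indices
    outside the range are redirected to 1, which is in the range as n is positive.\<close>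
  case False
  have "(\<Pi>\<^sub>M i\<in>{1..n}. M i) = (\<Pi>\<^sub>M i\<in>{1..n}. M (if i \<in> {1..n} then i else 1))"
    by (intro PiM_cong) auto
  also have "prob_space \<dots>" using False by (intro prob_space_PiM assms) auto
  finally show ?thesis .
qed

text \<open>Product measures are determined by boxes, and on a box the integral of a product of
  coordinate functions factorises by Tonelli.\<close>

lemma PiM_density:
  fixes M :: "'i \<Rightarrow> 'a measure"
  assumes I: "finite I" and M: "\<And>i. sigma_finite_measure (M i)" and f: "\<And>i. f i \<in> borel_measurable (M i)"
    and D: "\<And>i. sigma_finite_measure (density (M i) (f i))"
  shows "(\<Pi>\<^sub>M i\<in>I. density (M i) (f i)) = density (\<Pi>\<^sub>M i\<in>I. M i) (\<lambda>x. \<Prod>i\<in>I. f i (x i))"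
proof -
  interpret M: product_sigma_finite M using M by (rule product_sigma_finite.intro)
  interpret D: product_sigma_finite "\<lambda>i. density (M i) (f i)" using D by (rule product_sigma_finite.intro)
  note f[measurable]
  have "density (\<Pi>\<^sub>M i\<in>I. M i) (\<lambda>x. \<Prod>i\<in>I. f i (x i)) = (\<Pi>\<^sub>M i\<in>I. density (M i) (f i))"
  proof (rule D.PiM_eqI[OF I])
    show "sets (density (\<Pi>\<^sub>M i\<in>I. M i) (\<lambda>x. \<Prod>i\<in>I. f i (x i))) = sets (\<Pi>\<^sub>M i\<in>I. density (M i) (f i))"
      by (simp cong: sets_PiM_cong)
    fix A assume "\<And>i. i \<in> I \<Longrightarrow> A i \<in> sets (density (M i) (f i))"
    then have A: "\<And>i. i \<in> I \<Longrightarrow> A i \<in> sets (M i)" by simp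
    have "emeasure (density (\<Pi>\<^sub>M i\<in>I. M i) (\<lambda>x. \<Prod>i\<in>I. f i (x i))) (Pi\<^sub>E I A)
        = (\<integral>\<^sup>+x. (\<Prod>i\<in>I. f i (x i)) * indicator (Pi\<^sub>E I A) x \<partial>(\<Pi>\<^sub>M i\<in>I. M i))"
      using I A by (intro emeasure_density sets_PiM_I_finite) auto
    also have "\<dots> = (\<integral>\<^sup>+x. (\<Prod>i\<in>I. f i (x i) * indicator (A i) (x i)) \<partial>(\<Pi>\<^sub>M i\<in>I. M i))"
    proof (rule nn_integral_cong)
      fix x assume "x \<in> space (\<Pi>\<^sub>M i\<in>I. M i)"
      then have "x \<in> extensional I" by (simp add: space_PiM PiE_def)
      \<comment> \<open>Extensionality of \<open>x\<close> is what reduces membership in the box to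
        its coordinates.\<close>
      then have "indicator (Pi\<^sub>E I A) x = (\<Prod>i\<in>I. indicator (A i) (x i) :: ennreal)"
        using I by (auto simp: indicator_def PiE_def Pi_def prod_zero_iff intro!: prod.neutral[symmetric])
      then show "(\<Prod>i\<in>I. f i (x i)) * indicator (Pi\<^sub>E I A) x = (\<Prod>i\<in>I. f i (x i) * indicator (A i) (x i))"
        by (simp add: prod.distrib)
    qed
    also have "\<dots> = (\<Prod>i\<in>I. \<integral>\<^sup>+y. f i y * indicator (A i) y \<partial>M i)"
      using A by (intro M.product_nn_integral_prod I) auto
    also have "\<dots> = (\<Prod>i\<in>I. emeasure (density (M i) (f i)) (A i))"
      using A by (intro prod.cong refl) (simp add: emeasure_density)
    finally show "emeasure (density (\<Pi>\<^sub>M i\<in>I. M i) (\<lambda>x. \<Prod>i\<in>I. f i (x i))) (Pi\<^sub>E I A)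
        = (\<Prod>i\<in>I. emeasure (density (M i) (f i)) (A i))" .
  qed
  then show ?thesis ..
qed

text \<open>Since \<open>v n \<ge> 1\<close>, the absolute error also bounds the relative error, so
  the ratio tends to 1 and its logarithm to 0.\<close>

lemma ln_diff_tendsto_0:
  fixes u v :: "nat \<Rightarrow> real"
  assumes "(\<lambda>n. u n - v n) \<longlonglongrightarrow> 0" "\<And>n. v n \<ge> 1" "\<forall>\<^sub>F n in sequentially. u n > 0"
  shows "(\<lambda>n. ln (u n) - ln (v n)) \<longlonglongrightarrow> 0"
proof -
  have "(\<lambda>n. (u n - v n) / v n) \<longlonglongrightarrow> 0"
  proof (rule Lim_null_comparison[OF always_eventually tendsto_norm_zero[OF assms(1)]], rule allI)
    fix n
    have "norm ((u n - v n) / v n) = norm (u n - v n) / v n" using assms(2)[of n] by simp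
    also have "\<dots> \<le> norm (u n - v n)"
      using assms(2)[of n] by (simp add: divide_le_eq mult_le_cancel_left1)
    finally show "norm ((u n - v n) / v n) \<le> norm (u n - v n)" .
  qed
  then have "(\<lambda>n. ln (1 + (u n - v n) / v n)) \<longlonglongrightarrow> ln (1 + 0)"
    by (intro tendsto_intros) auto
  then have "(\<lambda>n. ln (1 + (u n - v n) / v n)) \<longlonglongrightarrow> 0" by simp
  moreover have "\<forall>\<^sub>F n in sequentially. ln (1 + (u n - v n) / v n) = ln (u n) - ln (v n)"
    using assms(3)
  proof eventually_elim
    case (elim n)
    have v: "v n > 0" using assms(2)[of n] by linarith
    then have "1 + (u n - v n) / v n = u n / v n" by (simp add: field_simps)
    then show ?case using elim v by (simp add: ln_div)
  qed
  ultimately show ?thesis by (rule Lim_transform_eventually)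
qed

section \<open>Exponential families: moments and their derivatives\<close>

locale exponential_family =
  fixes \<mu> :: "'x measure" and T :: "'x \<Rightarrow> real ^ 'k" and \<Theta> :: "(real ^ 'k) set"
  assumes T_measurable [measurable]: "T \<in> borel_measurable \<mu>"
    and open_parameters: "open \<Theta>"
    and integrable_exp: "\<And>\<theta>. \<theta> \<in> \<Theta> \<Longrightarrow> integrable \<mu> (\<lambda>x. exp (\<theta> \<bullet> T x))"
    and base_nonzero: "emeasure \<mu> (space \<mu>) \<noteq> 0"
begin

text \<open>Growth below every exponential of \<open>norm (T x)\<close>. The class contains the
  polynomials in T and is closed under products, so a derivative of a moment, which brings in a
  further factor of T, is again the moment of a tempered function.\<close>

definition tempered :: "('x \<Rightarrow> real) \<Rightarrow> bool" where
  "tempered g \<longleftrightarrow> g \<in> borel_measurable \<mu> \<and>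
     (\<forall>r>0. \<exists>C\<ge>0. \<forall>x. \<bar>g x\<bar> \<le> C * exp (r * norm (T x)))"

text \<open>Deliberately not normalised: differentiating in \<theta> then merely inserts a factor of
  T, and means and covariances are quotients of such moments.\<close>

definition moment :: "('x \<Rightarrow> real) \<Rightarrow> real ^ 'k \<Rightarrow> real" where
  "moment g \<theta> = (\<integral>x. g x * exp (\<theta> \<bullet> T x) \<partial>\<mu>)"

definition partition_function :: "real ^ 'k \<Rightarrow> real" where
  "partition_function \<theta> = (\<integral>x. exp (\<theta> \<bullet> T x) \<partial>\<mu>)"

definition law :: "real ^ 'k \<Rightarrow> 'x measure" where
  "law \<theta> = density \<mu> (\<lambda>x. ennreal (exp (\<theta> \<bullet> T x) / partition_function \<theta>))"

definition mean :: "real ^ 'k \<Rightarrow> real ^ 'k" where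
  "mean \<theta> = (\<chi> i. \<integral>x. T x $ i \<partial>law \<theta>)"

definition cov :: "real ^ 'k \<Rightarrow> real ^ 'k ^ 'k" where
  "cov \<theta> = (\<chi> i j. \<integral>x. (T x $ i - mean \<theta> $ i) * (T x $ j - mean \<theta> $ j) \<partial>law \<theta>)"

lemma temperedI:
  assumes "g \<in> borel_measurable \<mu>" "\<And>r. r > 0 \<Longrightarrow> \<exists>C\<ge>0. \<forall>x. \<bar>g x\<bar> \<le> C * exp (r * norm (T x))"
  shows "tempered g"
  using assms by (simp add: tempered_def)

lemma tempered_measurable [measurable_dest]: "tempered g \<Longrightarrow> g \<in> borel_measurable \<mu>"
  by (simp add: tempered_def)

lemma temperedE:
  assumes "tempered g" "r > 0"
  obtains C where "C \<ge> 0" "\<And>x. \<bar>g x\<bar> \<le> C * exp (r * norm (T x))"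
  using assms unfolding tempered_def by blast

lemma tempered_const: "tempered (\<lambda>x. c)"
  by (rule temperedI) (auto intro!: exI[of _ "\<bar>c\<bar>"] simp: mult_le_cancel_left1)

lemma tempered_norm: "tempered (\<lambda>x. norm (T x))"
proof (rule temperedI)
  fix r :: real assume "r > 0"
  have "norm (T x) \<le> (1 / r) * exp (r * norm (T x))" for x
  proof -
    have "r * norm (T x) \<le> exp (r * norm (T x))"
      using exp_ge_add_one_self[of "r * norm (T x)"] by linarith
    then show ?thesis using \<open>r > 0\<close> by (simp add: field_simps)
  qed
  then show "\<exists>C\<ge>0. \<forall>x. \<bar>norm (T x)\<bar> \<le> C * exp (r * norm (T x))"
    using \<open>r > 0\<close> by (intro exI[of _ "1 / r"]) auto
qed measurable

lemma tempered_mult: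
  assumes "tempered f" "tempered g"
  shows "tempered (\<lambda>x. f x * g x)"
proof (rule temperedI)
  fix r :: real assume "r > 0"
  then have r2: "r / 2 > 0" by simp
  obtain C where C: "C \<ge> 0" "\<And>x. \<bar>f x\<bar> \<le> C * exp (r / 2 * norm (T x))" using temperedE[OF assms(1) r2] by blast
  obtain D where D: "D \<ge> 0" "\<And>x. \<bar>g x\<bar> \<le> D * exp (r / 2 * norm (T x))" using temperedE[OF assms(2) r2] by blast
  have "\<bar>f x * g x\<bar> \<le> C * D * exp (r * norm (T x))" for x
  proof -
    have "\<bar>f x * g x\<bar> \<le> (C * exp (r / 2 * norm (T x))) * (D * exp (r / 2 * norm (T x)))"
      unfolding abs_mult using C D by (intro mult_mono) auto
    also have "\<dots> = C * D * (exp (r / 2 * norm (T x)) * exp (r / 2 * norm (T x)))" by simp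
    also have "exp (r / 2 * norm (T x)) * exp (r / 2 * norm (T x)) = exp (r * norm (T x))"
      by (simp add: exp_add[symmetric])
    finally show ?thesis .
  qed
  then show "\<exists>C\<ge>0. \<forall>x. \<bar>f x * g x\<bar> \<le> C * exp (r * norm (T x))"
    using C(1) D(1) by (intro exI[of _ "C * D"]) auto
qed (use assms in measurable)

lemma tempered_add:
  assumes "tempered f" "tempered g"
  shows "tempered (\<lambda>x. f x + g x)"
proof (rule temperedI)
  fix r :: real assume "r > 0"
  obtain C where C: "C \<ge> 0" "\<And>x. \<bar>f x\<bar> \<le> C * exp (r * norm (T x))" using temperedE[OF assms(1) \<open>r > 0\<close>] by blast
  obtain D where D: "D \<ge> 0" "\<And>x. \<bar>g x\<bar> \<le> D * exp (r * norm (T x))" using temperedE[OF assms(2) \<open>r > 0\<close>] by blast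
  have "\<bar>f x + g x\<bar> \<le> (C + D) * exp (r * norm (T x))" for x
    using C(2)[of x] D(2)[of x] abs_triangle_ineq[of "f x" "g x"] by (simp add: distrib_right)
  then show "\<exists>C\<ge>0. \<forall>x. \<bar>f x + g x\<bar> \<le> C * exp (r * norm (T x))"
    using C(1) D(1) by (intro exI[of _ "C + D"]) auto
qed (use assms in measurable)

lemma tempered_diff: "tempered f \<Longrightarrow> tempered g \<Longrightarrow> tempered (\<lambda>x. f x - g x)"
  using tempered_add[of f "\<lambda>x. - 1 * g x"] tempered_mult[OF tempered_const, of g "- 1"] by simp

lemma tempered_inner: "tempered (\<lambda>x. u \<bullet> T x)"
proof (rule temperedI)
  fix r :: real assume "r > 0"
  obtain C where C: "C \<ge> 0" "\<And>x. \<bar>norm u * norm (T x)\<bar> \<le> C * exp (r * norm (T x))"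
    using temperedE[OF tempered_mult[OF tempered_const[of "norm u"] tempered_norm] \<open>r > 0\<close>] by blast
  have "\<bar>u \<bullet> T x\<bar> \<le> C * exp (r * norm (T x))" for x
    using C(2)[of x] Cauchy_Schwarz_ineq2[of u "T x"] by linarith
  then show "\<exists>C\<ge>0. \<forall>x. \<bar>u \<bullet> T x\<bar> \<le> C * exp (r * norm (T x))" using C(1) by blast
qed measurable

lemma tempered_component: "tempered (\<lambda>x. T x $ i)"
  using tempered_inner[of "axis i 1"] by (simp add: inner_axis')

text \<open>Openness provides the shifts of \<theta> by a fixed amount along each axis in both
  directions. The sum of these finitely many integrable exponentials dominates the exponential of
  the norm.\<close>

lemma integrable_exp_norm:
  assumes "\<theta> \<in> \<Theta>"
  obtains r where "r > 0" "integrable \<mu> (\<lambda>x. exp (\<theta> \<bullet> T x + r * norm (T x)))"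
proof -
  obtain e where e: "e > 0" "cball \<theta> e \<subseteq> \<Theta>"
    using open_parameters assms open_contains_cball by blast
  \<comment> \<open>\<open>exp_norm_le_sum\<close> multiplies the rate by the dimension; dividing
    beforehand makes the axis shifts exactly \<open>e\<close>.\<close>
  define r where "r = e / CARD('k)"
  let ?F = "\<lambda>x. \<Sum>i\<in>UNIV. exp ((\<theta> + axis i e) \<bullet> T x) + exp ((\<theta> + axis i (-e)) \<bullet> T x)"
  have "\<theta> + axis i e \<in> \<Theta>" "\<theta> + axis i (- e) \<in> \<Theta>" for i
    using e by (auto intro!: subsetD[OF e(2)] simp: dist_norm norm_axis_real)
  then have F: "integrable \<mu> ?F"
    by (intro Bochner_Integration.integrable_sum Bochner_Integration.integrable_add integrable_exp)
  have bound: "exp (\<theta> \<bullet> T x + r * norm (T x)) \<le> ?F x" for x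
  proof -
    have "exp (\<theta> \<bullet> T x) * exp (r * norm (T x))
        \<le> exp (\<theta> \<bullet> T x) * (\<Sum>i\<in>UNIV. exp (axis i e \<bullet> T x) + exp (axis i (- e) \<bullet> T x))"
      using exp_norm_le_sum[of r "T x"] e(1) by (intro mult_left_mono) (auto simp: r_def)
    then show ?thesis by (simp add: sum_distrib_left distrib_left exp_add inner_add_left)
  qed
  have "integrable \<mu> (\<lambda>x. exp (\<theta> \<bullet> T x + r * norm (T x)))"
    by (rule Bochner_Integration.integrable_bound[OF F])
       (auto simp del: abs_exp_cancel intro!: AE_I2 order_trans[OF _ order_trans[OF bound abs_ge_self]])
  moreover have "r > 0" using e(1) by (simp add: r_def)
  ultimately show thesis by (rule that[rotated])
qed

lemma tempered_integrable:
  assumes "\<theta> \<in> \<Theta>" "tempered g"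
  shows "integrable \<mu> (\<lambda>x. g x * exp (\<theta> \<bullet> T x))"
proof -
  obtain r where r: "r > 0" "integrable \<mu> (\<lambda>x. exp (\<theta> \<bullet> T x + r * norm (T x)))"
    using integrable_exp_norm[OF assms(1)] .
  obtain C where C: "C \<ge> 0" "\<And>x. \<bar>g x\<bar> \<le> C * exp (r * norm (T x))" using temperedE[OF assms(2) r(1)] by blast
  have "integrable \<mu> (\<lambda>x. C * exp (\<theta> \<bullet> T x + r * norm (T x)))" using r(2) by simp
  then show ?thesis
  proof (rule Bochner_Integration.integrable_bound)
    show "(\<lambda>x. g x * exp (\<theta> \<bullet> T x)) \<in> borel_measurable \<mu>" using assms(2) by measurable
    show "AE x in \<mu>. norm (g x * exp (\<theta> \<bullet> T x)) \<le> norm (C * exp (\<theta> \<bullet> T x + r * norm (T x)))"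
    proof (rule AE_I2)
      fix x
      show "norm (g x * exp (\<theta> \<bullet> T x)) \<le> norm (C * exp (\<theta> \<bullet> T x + r * norm (T x)))"
        using mult_right_mono[OF C(2)[of x], of "exp (\<theta> \<bullet> T x)"] C(1)
        by (simp add: abs_mult exp_add mult_ac)
    qed
  qed
qed

text \<open>The first-order Taylor remainder of \<open>exp (h \<bullet> T x)\<close> is quadratic in
  \<open>h\<close>. Half of the exponential room \<open>r\<close> absorbs the factor
  \<open>exp \<bar>h \<bullet> T x\<bar>\<close>, the other half absorbs g and the two powers of
  \<open>norm (T x)\<close>, leaving one integrable bound for all small \<open>h\<close>.\<close>

lemma moment_has_derivative:
  assumes \<theta>: "\<theta> \<in> \<Theta>" and g: "tempered g"
  shows "(moment g has_derivative (\<lambda>h. moment (\<lambda>x. g x * (h \<bullet> T x)) \<theta>)) (at \<theta>)"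
proof -
  let ?D = "\<lambda>h. moment (\<lambda>x. g x * (h \<bullet> T x)) \<theta>"
  have int_D: "integrable \<mu> (\<lambda>x. g x * (h \<bullet> T x) * exp (\<theta> \<bullet> T x))" for h
    by (intro tempered_integrable \<theta> tempered_mult g tempered_inner)
  have "linear ?D"
  proof (rule linearI)
    show "?D (h + h') = ?D h + ?D h'" for h h'
      unfolding moment_def using Bochner_Integration.integral_add[OF int_D[of h] int_D[of h']]
      by (simp add: inner_add_left algebra_simps)
    show "?D (c *\<^sub>R h) = c *\<^sub>R ?D h" for c h
      unfolding moment_def by (simp add: mult_ac)
  qed
  then have bl: "bounded_linear ?D" by (simp add: linear_conv_bounded_linear)
  obtain r where r: "r > 0" "integrable \<mu> (\<lambda>x. exp (\<theta> \<bullet> T x + r * norm (T x)))"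
    using integrable_exp_norm[OF \<theta>] .
  obtain C where C: "C \<ge> 0"
    "\<And>x. \<bar>g x * (norm (T x) * norm (T x))\<bar> \<le> C * exp (r / 2 * norm (T x))"
    using temperedE[OF tempered_mult[OF g tempered_mult[OF tempered_norm tempered_norm]] half_gt_zero[OF r(1)]]
    by blast
  obtain e where e: "e > 0" "ball \<theta> e \<subseteq> \<Theta>" using open_parameters \<theta> open_contains_ball by blast
  define K where "K = C * (\<integral>x. exp (\<theta> \<bullet> T x + r * norm (T x)) \<partial>\<mu>)"
  have bound: "\<bar>moment g (\<theta> + h) - moment g \<theta> - ?D h\<bar> \<le> K * (norm h)\<^sup>2"
    if h: "norm h < min e (r / 2)" for h
  proof -
    have "\<theta> + h \<in> \<Theta>" using h by (intro subsetD[OF e(2)]) (simp add: dist_norm)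
    note int1 = tempered_integrable[OF this g] and int0 = tempered_integrable[OF \<theta> g]
    let ?R = "\<lambda>x. g x * exp ((\<theta> + h) \<bullet> T x) - g x * exp (\<theta> \<bullet> T x) - g x * (h \<bullet> T x) * exp (\<theta> \<bullet> T x)"
    have "moment g (\<theta> + h) - moment g \<theta> - ?D h = (\<integral>x. ?R x \<partial>\<mu>)"
      unfolding moment_def using int0 int1 int_D[of h] by simp
    moreover have "\<bar>\<integral>x. ?R x \<partial>\<mu>\<bar> \<le> (\<integral>x. \<bar>?R x\<bar> \<partial>\<mu>)" by (rule integral_abs_bound)
    moreover have "\<dots> \<le> (\<integral>x. C * (norm h)\<^sup>2 * exp (\<theta> \<bullet> T x + r * norm (T x)) \<partial>\<mu>)"
    proof (rule integral_mono)
      fix x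
      have le: "\<bar>h \<bullet> T x\<bar> \<le> norm h * norm (T x)" by (rule Cauchy_Schwarz_ineq2)
      have "?R x = g x * exp (\<theta> \<bullet> T x) * (exp (h \<bullet> T x) - 1 - h \<bullet> T x)"
        by (simp add: inner_add_left exp_add algebra_simps)
      then have "\<bar>?R x\<bar> = \<bar>g x\<bar> * exp (\<theta> \<bullet> T x) * \<bar>exp (h \<bullet> T x) - 1 - h \<bullet> T x\<bar>" by (simp add: abs_mult)
      also have "\<dots> \<le> \<bar>g x\<bar> * exp (\<theta> \<bullet> T x) * ((h \<bullet> T x)\<^sup>2 * exp \<bar>h \<bullet> T x\<bar>)"
        by (intro mult_left_mono abs_exp_minus_linear_le) auto
      also have "\<dots> \<le> \<bar>g x\<bar> * exp (\<theta> \<bullet> T x) * ((norm h * norm (T x))\<^sup>2 * exp (r / 2 * norm (T x)))"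
      proof (intro mult_left_mono mult_mono)
        show "(h \<bullet> T x)\<^sup>2 \<le> (norm h * norm (T x))\<^sup>2"
          using power_mono[OF le abs_ge_zero, of 2] by simp
        have "norm h * norm (T x) \<le> r / 2 * norm (T x)" using h by (intro mult_right_mono) auto
        then show "exp \<bar>h \<bullet> T x\<bar> \<le> exp (r / 2 * norm (T x))" using le by simp
      qed auto
      also have "\<dots> = (norm h)\<^sup>2 * exp (\<theta> \<bullet> T x) * exp (r / 2 * norm (T x)) * \<bar>g x * (norm (T x) * norm (T x))\<bar>"
        by (simp add: abs_mult power2_eq_square mult_ac)
      also have "\<dots> \<le> (norm h)\<^sup>2 * exp (\<theta> \<bullet> T x) * exp (r / 2 * norm (T x)) * (C * exp (r / 2 * norm (T x)))"
        by (intro mult_left_mono C(2)) auto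
      also have "\<dots> = C * (norm h)\<^sup>2 * exp (\<theta> \<bullet> T x + r * norm (T x))"
        by (simp add: mult_ac exp_add[symmetric])
      finally show "\<bar>?R x\<bar> \<le> C * (norm h)\<^sup>2 * exp (\<theta> \<bullet> T x + r * norm (T x))" .
    qed (use int0 int1 int_D[of h] r(2) in auto)
    ultimately have "\<bar>moment g (\<theta> + h) - moment g \<theta> - ?D h\<bar>
        \<le> (\<integral>x. C * (norm h)\<^sup>2 * exp (\<theta> \<bullet> T x + r * norm (T x)) \<partial>\<mu>)" by linarith
    then show ?thesis by (simp add: K_def mult_ac)
  qed
  have "(\<lambda>h. norm (moment g (\<theta> + h) - moment g \<theta> - ?D h) / norm h) \<midarrow>0\<rightarrow> 0"
  proof (rule Lim_null_comparison)
    show "(\<lambda>h :: real ^ 'k. K * norm h) \<midarrow>0\<rightarrow> 0"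
      by (auto intro!: tendsto_eq_intros)
    have "\<forall>\<^sub>F h in at (0 :: real ^ 'k). norm h < min e (r / 2)"
      using e(1) r(1) by (auto simp: eventually_at dist_norm intro!: exI[of _ "min e (r / 2)"])
    then show "\<forall>\<^sub>F h in at 0. norm (norm (moment g (\<theta> + h) - moment g \<theta> - ?D h) / norm h) \<le> K * norm h"
    proof eventually_elim
      case (elim h)
      show ?case
      proof (cases "h = 0")
        case False
        then show ?thesis using bound[OF elim] by (simp add: divide_le_eq power2_eq_square mult_ac)
      qed simp
    qed
  qed
  with bl show ?thesis by (simp add: has_derivative_at)
qed

lemma moment_isCont: "\<theta> \<in> \<Theta> \<Longrightarrow> tempered g \<Longrightarrow> isCont (moment g) \<theta>"
  by (rule has_derivative_continuous[OF moment_has_derivative])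

section \<open>The normalised laws, their means and covariances\<close>

lemma partition_function_eq_moment: "partition_function = moment (\<lambda>_. 1)"
  by (simp add: fun_eq_iff partition_function_def moment_def)

lemma partition_function_pos:
  assumes "\<theta> \<in> \<Theta>" shows "partition_function \<theta> > 0"
proof -
  have "partition_function \<theta> \<noteq> 0"
  proof
    assume "partition_function \<theta> = 0"
    then have "AE x in \<mu>. exp (\<theta> \<bullet> T x) = 0"
      unfolding partition_function_def
      using integral_nonneg_eq_0_iff_AE[OF integrable_exp[OF assms]] by simp
    then have "AE x in \<mu>. False" by simp
    then show False using base_nonzero by (simp add: AE_iff_measurable[OF _ refl])
  qed
  moreover have "partition_function \<theta> \<ge> 0" unfolding partition_function_def by simp
  ultimately show ?thesis by simp
qed

lemma sets_law [simp, measurable_cong]: "sets (law \<theta>) = sets \<mu>"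
  and space_law [simp]: "space (law \<theta>) = space \<mu>"
  by (simp_all add: law_def)

lemma prob_space_law:
  assumes "\<theta> \<in> \<Theta>" shows "prob_space (law \<theta>)"
proof
  have "emeasure (law \<theta>) (space (law \<theta>))
      = (\<integral>\<^sup>+x. ennreal (exp (\<theta> \<bullet> T x) / partition_function \<theta>) \<partial>\<mu>)"
    by (simp add: law_def emeasure_density cong: nn_integral_cong)
  also have "\<dots> = ennreal (\<integral>x. exp (\<theta> \<bullet> T x) / partition_function \<theta> \<partial>\<mu>)"
    using integrable_exp[OF assms] partition_function_pos[OF assms]
    by (intro nn_integral_eq_integral) auto
  also have "\<dots> = 1"
    using partition_function_pos[OF assms] by (simp add: partition_function_def)
  finally show "emeasure (law \<theta>) (space (law \<theta>)) = 1" .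
qed

lemma measure_law_space: "\<theta> \<in> \<Theta> \<Longrightarrow> measure (law \<theta>) (space \<mu>) = 1"
  using prob_space.prob_space[OF prob_space_law] by simp

lemma integrable_law:
  fixes f :: "'x \<Rightarrow> 'b::{banach, second_countable_topology}"
  assumes "\<theta> \<in> \<Theta>" "f \<in> borel_measurable \<mu>"
  shows "integrable (law \<theta>) f \<longleftrightarrow> integrable \<mu> (\<lambda>x. exp (\<theta> \<bullet> T x) *\<^sub>R f x)"
proof -
  let ?Z = "partition_function \<theta>"
  have Z: "?Z > 0" by (rule partition_function_pos[OF assms(1)])
  have "integrable (law \<theta>) f \<longleftrightarrow> integrable \<mu> (\<lambda>x. (1 / ?Z) *\<^sub>R (exp (\<theta> \<bullet> T x) *\<^sub>R f x))"
    using Z assms(2) by (simp add: law_def integrable_density divide_inverse_commute)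
  also have "\<dots> \<longleftrightarrow> integrable \<mu> (\<lambda>x. exp (\<theta> \<bullet> T x) *\<^sub>R f x)"
  proof
    assume *: "integrable \<mu> (\<lambda>x. (1 / ?Z) *\<^sub>R (exp (\<theta> \<bullet> T x) *\<^sub>R f x))"
    have "integrable \<mu> (\<lambda>x. ?Z *\<^sub>R ((1 / ?Z) *\<^sub>R (exp (\<theta> \<bullet> T x) *\<^sub>R f x)))"
      by (rule integrable_scaleR_right) (rule *)
    then show "integrable \<mu> (\<lambda>x. exp (\<theta> \<bullet> T x) *\<^sub>R f x)" using Z by simp
  qed (rule integrable_scaleR_right)
  finally show ?thesis .
qed

lemma integral_law:
  assumes "\<theta> \<in> \<Theta>" "f \<in> borel_measurable \<mu>"
  shows "(\<integral>x. f x \<partial>law \<theta>) = moment f \<theta> / partition_function \<theta>"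
  using partition_function_pos[OF assms(1)] assms(2)
  by (simp add: law_def integral_density moment_def mult.commute)

lemma tempered_integrable_law:
  assumes "\<theta> \<in> \<Theta>" "tempered f" shows "integrable (law \<theta>) f"
  using tempered_integrable[OF assms] assms by (simp add: integrable_law tempered_measurable mult.commute)

lemma tempered_centered: "tempered (\<lambda>x. u \<bullet> (T x - m))"
  using tempered_diff[OF tempered_inner tempered_const] by (simp add: inner_diff_right)

lemma tempered_centered_component: "tempered (\<lambda>x. T x $ i - m)"
  by (intro tempered_diff tempered_component tempered_const)

lemma inner_mean:
  assumes "\<theta> \<in> \<Theta>" shows "u \<bullet> mean \<theta> = (\<integral>x. u \<bullet> T x \<partial>law \<theta>)"
proof -
  have "(\<integral>x. u \<bullet> T x \<partial>law \<theta>) = (\<Sum>i\<in>UNIV. \<integral>x. u $ i * T x $ i \<partial>law \<theta>)"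
    unfolding inner_vec_def inner_real_def
    by (intro Bochner_Integration.integral_sum integrable_mult_right tempered_integrable_law assms tempered_component)
  also have "\<dots> = u \<bullet> mean \<theta>" by (simp add: inner_vec_def mean_def)
  finally show ?thesis ..
qed

lemma integral_centered:
  assumes "\<theta> \<in> \<Theta>" shows "(\<integral>x. u \<bullet> (T x - mean \<theta>) \<partial>law \<theta>) = 0"
proof -
  interpret prob_space "law \<theta>" by (rule prob_space_law[OF assms])
  have "integrable (law \<theta>) (\<lambda>x. u \<bullet> T x)" by (intro tempered_integrable_law assms tempered_inner)
  then show ?thesis by (simp add: inner_diff_right inner_mean[OF assms] measure_law_space[OF assms])
qed

lemma inner_cov:
  assumes "\<theta> \<in> \<Theta>"
  shows "u \<bullet> (cov \<theta> *v v) = (\<integral>x. (u \<bullet> (T x - mean \<theta>)) * (v \<bullet> (T x - mean \<theta>)) \<partial>law \<theta>)"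
proof -
  let ?Y = "\<lambda>x i. T x $ i - mean \<theta> $ i"
  have "(u \<bullet> (T x - mean \<theta>)) * (v \<bullet> (T x - mean \<theta>))
      = (\<Sum>i\<in>UNIV. \<Sum>j\<in>UNIV. (u $ i * v $ j) * (?Y x i * ?Y x j))" for x
    by (simp add: inner_vec_def sum_product mult_ac)
  then have "(\<integral>x. (u \<bullet> (T x - mean \<theta>)) * (v \<bullet> (T x - mean \<theta>)) \<partial>law \<theta>)
      = (\<integral>x. (\<Sum>i\<in>UNIV. \<Sum>j\<in>UNIV. (u $ i * v $ j) * (?Y x i * ?Y x j)) \<partial>law \<theta>)" by simp
  also have "\<dots> = (\<Sum>i\<in>UNIV. \<Sum>j\<in>UNIV. (u $ i * v $ j) * (\<integral>x. ?Y x i * ?Y x j \<partial>law \<theta>))"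
  proof -
    have int: "integrable (law \<theta>) (\<lambda>x. (u $ i * v $ j) * (?Y x i * ?Y x j))" for i j
      by (intro integrable_mult_right tempered_integrable_law assms tempered_mult tempered_centered_component)
    show ?thesis
      by (subst Bochner_Integration.integral_sum, intro Bochner_Integration.integrable_sum int,
          subst Bochner_Integration.integral_sum, rule int) simp
  qed
  also have "\<dots> = u \<bullet> (cov \<theta> *v v)"
    by (simp add: inner_vec_def matrix_vector_mult_def cov_def sum_distrib_left mult_ac)
  finally show ?thesis ..
qed

lemma cov_symmetric: "cov \<theta> $ i $ j = cov \<theta> $ j $ i"
  by (simp add: cov_def mult.commute)

lemma cov_psd: "\<theta> \<in> \<Theta> \<Longrightarrow> 0 \<le> u \<bullet> (cov \<theta> *v u)"
  by (simp add: inner_cov)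

lemma mean_component: "\<theta> \<in> \<Theta> \<Longrightarrow> mean \<theta> $ i = moment (\<lambda>x. T x $ i) \<theta> / partition_function \<theta>"
  by (simp add: mean_def integral_law tempered_measurable[OF tempered_component])

text \<open>In terms of unnormalised moments the covariance inherits their continuity, and it
  becomes recognisable as the derivative of a quotient.\<close>

lemma cov_component:
  assumes "\<theta> \<in> \<Theta>"
  shows "cov \<theta> $ i $ j = moment (\<lambda>x. T x $ i * T x $ j) \<theta> / partition_function \<theta> - mean \<theta> $ i * mean \<theta> $ j"
proof -
  interpret prob_space "law \<theta>" by (rule prob_space_law[OF assms])
  have int: "integrable (law \<theta>) (\<lambda>x. T x $ i * T x $ j)" "integrable (law \<theta>) (\<lambda>x. T x $ i)"
    "integrable (law \<theta>) (\<lambda>x. T x $ j)"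
    by (intro tempered_integrable_law assms tempered_mult tempered_component)+
  have "cov \<theta> $ i $ j = (\<integral>x. T x $ i * T x $ j - mean \<theta> $ j * T x $ i - mean \<theta> $ i * T x $ j
      + mean \<theta> $ i * mean \<theta> $ j \<partial>law \<theta>)"
    by (simp add: cov_def algebra_simps)
  also have "\<dots> = (\<integral>x. T x $ i * T x $ j \<partial>law \<theta>) - mean \<theta> $ i * mean \<theta> $ j"
    using int by (simp add: measure_law_space[OF assms] mean_def)
  finally show ?thesis using assms by (simp add: integral_law tempered_measurable tempered_mult tempered_component)
qed

section \<open>Locally uniform control of moment generating functions\<close>

lemma tendsto_parameters:
  assumes "\<theta> \<in> \<Theta>" "\<eta> \<longlonglongrightarrow> \<theta>"
  shows "(\<lambda>n. partition_function (\<eta> n)) \<longlonglongrightarrow> partition_function \<theta>"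
    and "(\<lambda>n. mean (\<eta> n)) \<longlonglongrightarrow> mean \<theta>"
    and "(\<lambda>n. cov (\<eta> n) $ i $ j) \<longlonglongrightarrow> cov \<theta> $ i $ j"
proof -
  have ev: "\<forall>\<^sub>F n in sequentially. \<eta> n \<in> \<Theta>"
    using topological_tendstoD[OF assms(2) open_parameters assms(1)] .
  have mom: "(\<lambda>n. moment g (\<eta> n)) \<longlonglongrightarrow> moment g \<theta>" if "tempered g" for g
    using isCont_tendsto_compose[OF moment_isCont[OF assms(1) that] assms(2)] .
  show Z: "(\<lambda>n. partition_function (\<eta> n)) \<longlonglongrightarrow> partition_function \<theta>"
    unfolding partition_function_eq_moment by (rule mom[OF tempered_const])
  have Z0: "partition_function \<theta> \<noteq> 0" using partition_function_pos[OF assms(1)] by simp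
  have mean: "(\<lambda>n. mean (\<eta> n) $ i) \<longlonglongrightarrow> mean \<theta> $ i" for i
  proof -
    have "(\<lambda>n. moment (\<lambda>x. T x $ i) (\<eta> n) / partition_function (\<eta> n)) \<longlonglongrightarrow> mean \<theta> $ i"
      unfolding mean_component[OF assms(1)] by (intro tendsto_divide mom Z Z0 tempered_component)
    then show ?thesis by (rule Lim_transform_eventually) (use ev in eventually_elim, simp add: mean_component)
  qed
  then show "(\<lambda>n. mean (\<eta> n)) \<longlonglongrightarrow> mean \<theta>" by (rule vec_tendstoI)
  have "(\<lambda>n. moment (\<lambda>x. T x $ i * T x $ j) (\<eta> n) / partition_function (\<eta> n)
      - mean (\<eta> n) $ i * mean (\<eta> n) $ j) \<longlonglongrightarrow> cov \<theta> $ i $ j"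
    unfolding cov_component[OF assms(1)]
    by (intro tendsto_diff tendsto_mult tendsto_divide mom Z Z0 tempered_mult tempered_component mean)
  then show "(\<lambda>n. cov (\<eta> n) $ i $ j) \<longlonglongrightarrow> cov \<theta> $ i $ j"
    by (rule Lim_transform_eventually) (use ev in eventually_elim, simp add: cov_component)
qed

text \<open>All laws near \<theta> are compared with one integrable function of the base measure,
  which makes the bound uniform along the moving parameter.\<close>

lemma exponential_moment_bounded:
  assumes "\<theta> \<in> \<Theta>" "\<eta> \<longlonglongrightarrow> \<theta>"
  obtains \<delta> C where "\<delta> > 0" "C \<ge> 0"
    "\<forall>\<^sub>F n in sequentially. integrable (law (\<eta> n)) (\<lambda>x. exp (\<delta> * norm (T x - mean (\<eta> n)))) \<and>
       (\<integral>x. exp (\<delta> * norm (T x - mean (\<eta> n))) \<partial>law (\<eta> n)) \<le> C"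
proof -
  obtain r where r: "r > 0" "integrable \<mu> (\<lambda>x. exp (\<theta> \<bullet> T x + r * norm (T x)))"
    using integrable_exp_norm[OF assms(1)] .
  \<comment> \<open>One half of \<open>r\<close> goes to the exponential moment itself, the other to
    replacing \<open>\<eta> n\<close> by \<theta> in the exponent.\<close>
  define \<delta> where "\<delta> = r / 2"
  have \<delta>: "\<delta> > 0" using r by (simp add: \<delta>_def)
  define I where "I = (\<integral>x. exp (\<theta> \<bullet> T x + r * norm (T x)) \<partial>\<mu>)"
  define E where "E = exp (\<delta> * (norm (mean \<theta>) + 1))"
  \<comment> \<open>\<open>E\<close> accounts for the centring, as the means eventually stay within
    distance 1 of \<open>mean \<theta>\<close>. The partition functions eventually exceed half of
    their limit, whence the denominator.\<close>
  define C where "C = E * I / (partition_function \<theta> / 2)"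
  have Z: "partition_function \<theta> > 0" by (rule partition_function_pos[OF assms(1)])
  have I: "I \<ge> 0" by (simp add: I_def)
  have "C \<ge> 0" using Z I by (simp add: C_def E_def)
  have "\<forall>\<^sub>F n in sequentially. \<eta> n \<in> \<Theta>"
    using topological_tendstoD[OF assms(2) open_parameters assms(1)] .
  moreover have "\<forall>\<^sub>F n in sequentially. dist (\<eta> n) \<theta> < \<delta>" by (rule tendstoD[OF assms(2) \<delta>])
  moreover have "\<forall>\<^sub>F n in sequentially. partition_function (\<eta> n) > partition_function \<theta> / 2"
    by (rule order_tendstoD(1)[OF tendsto_parameters(1)[OF assms]]) (use Z in simp)
  moreover have "\<forall>\<^sub>F n in sequentially. dist (mean (\<eta> n)) (mean \<theta>) < 1"
    by (rule tendstoD[OF tendsto_parameters(2)[OF assms]]) simp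
  ultimately have "\<forall>\<^sub>F n in sequentially. integrable (law (\<eta> n)) (\<lambda>x. exp (\<delta> * norm (T x - mean (\<eta> n)))) \<and>
       (\<integral>x. exp (\<delta> * norm (T x - mean (\<eta> n))) \<partial>law (\<eta> n)) \<le> C"
  proof eventually_elim
    case (elim n)
    let ?f = "\<lambda>x. exp (\<delta> * norm (T x - mean (\<eta> n)))"
    have bound: "?f x * exp (\<eta> n \<bullet> T x) \<le> E * exp (\<theta> \<bullet> T x + r * norm (T x))" for x
    proof -
      have "norm (mean (\<eta> n)) \<le> norm (mean \<theta>) + 1"
        using elim(4) norm_triangle_ineq2[of "mean (\<eta> n)" "mean \<theta>"] by (simp add: dist_norm)
      then have "norm (T x - mean (\<eta> n)) \<le> norm (T x) + (norm (mean \<theta>) + 1)"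
        using norm_triangle_ineq4[of "T x" "mean (\<eta> n)"] by linarith
      then have 1: "\<delta> * norm (T x - mean (\<eta> n)) \<le> \<delta> * norm (T x) + \<delta> * (norm (mean \<theta>) + 1)"
        using mult_left_mono[OF _ less_imp_le[OF \<delta>]] by (metis distrib_left)
      have "(\<eta> n - \<theta>) \<bullet> T x \<le> norm (\<eta> n - \<theta>) * norm (T x)" by (rule norm_cauchy_schwarz)
      also have "\<dots> \<le> \<delta> * norm (T x)" using elim(2) by (intro mult_right_mono) (auto simp: dist_norm)
      finally have "\<eta> n \<bullet> T x \<le> \<theta> \<bullet> T x + \<delta> * norm (T x)" by (simp add: inner_diff_left)
      with 1 have "\<delta> * norm (T x - mean (\<eta> n)) + \<eta> n \<bullet> T x
          \<le> \<delta> * (norm (mean \<theta>) + 1) + (\<theta> \<bullet> T x + r * norm (T x))"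
        unfolding \<delta>_def by linarith
      then show ?thesis by (simp add: E_def exp_add[symmetric])
    qed
    have int: "integrable \<mu> (\<lambda>x. E * exp (\<theta> \<bullet> T x + r * norm (T x)))" using r(2) by simp
    have int_f: "integrable \<mu> (\<lambda>x. ?f x * exp (\<eta> n \<bullet> T x))"
      by (rule Bochner_Integration.integrable_bound[OF int])
         (use bound in \<open>auto intro!: AE_I2 simp: E_def\<close>)
    have meas: "?f \<in> borel_measurable \<mu>" by measurable
    have "moment ?f (\<eta> n) \<le> (\<integral>x. E * exp (\<theta> \<bullet> T x + r * norm (T x)) \<partial>\<mu>)"
      unfolding moment_def by (rule integral_mono[OF int_f int bound])
    also have "\<dots> = E * I" by (simp add: I_def)
    finally have "moment ?f (\<eta> n) \<le> E * I" .
    then have "moment ?f (\<eta> n) / partition_function (\<eta> n) \<le> C"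
      unfolding C_def using elim(3) Z I by (intro frac_le) (auto simp: E_def)
    then have "(\<integral>x. ?f x \<partial>law (\<eta> n)) \<le> C" using integral_law[OF elim(1) meas] by simp
    moreover have "integrable (law (\<eta> n)) ?f"
      using int_f by (simp add: integrable_law[OF elim(1) meas] mult.commute)
    ultimately show ?case by blast
  qed
  with \<delta> \<open>C \<ge> 0\<close> show thesis by (rule that)
qed

text \<open>In the second-order Taylor expansion the linear term integrates to 0 by centring and the
  quadratic term to the covariance form. The cubic remainder is absorbed by the exponential
  moment.\<close>

lemma mgf_expansion:
  fixes z :: complex
  assumes \<theta>: "\<theta> \<in> \<Theta>" and z: "norm z \<le> 1" and \<delta>: "\<delta> > 0" and h: "norm h \<le> \<delta> / 2"
    and int: "integrable (law \<theta>) (\<lambda>x. exp (\<delta> * norm (T x - mean \<theta>)))"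
  shows "integrable (law \<theta>) (\<lambda>x. exp (z * of_real (h \<bullet> (T x - mean \<theta>))))" (is ?thesis1)
    and "norm ((\<integral>x. exp (z * of_real (h \<bullet> (T x - mean \<theta>))) \<partial>law \<theta>) - 1 - z\<^sup>2 / 2 * of_real (h \<bullet> (cov \<theta> *v h)))
      \<le> norm h ^ 3 * (6 / \<delta>) ^ 3 * (\<integral>x. exp (\<delta> * norm (T x - mean \<theta>)) \<partial>law \<theta>)" (is ?thesis2)
proof -
  interpret prob_space "law \<theta>" by (rule prob_space_law[OF \<theta>])
  define Y where "Y x = T x - mean \<theta>" for x
  define s where "s x = h \<bullet> Y x" for x
  have [measurable]: "Y \<in> borel_measurable \<mu>" "s \<in> borel_measurable \<mu>"
    unfolding Y_def s_def by measurable
  have s_le: "\<bar>s x\<bar> \<le> norm h * norm (Y x)" for x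
    unfolding s_def by (rule Cauchy_Schwarz_ineq2)
  have s_le': "\<bar>s x\<bar> \<le> \<delta> / 2 * norm (Y x)" for x
    using s_le[of x] mult_right_mono[OF h, of "norm (Y x)"] by simp
  have zs: "norm (z * of_real (s x)) \<le> \<bar>s x\<bar>" for x
    using mult_right_mono[OF z, of "\<bar>s x\<bar>"] by (simp add: norm_mult)
  let ?e = "\<lambda>x. exp (z * of_real (s x))"
  have int': "integrable (law \<theta>) (\<lambda>x. exp (\<delta> * norm (Y x)))" using int by (simp add: Y_def)
  have int_e: "integrable (law \<theta>) ?e"
  proof (rule Bochner_Integration.integrable_bound[OF int'])
    show "AE x in law \<theta>. norm (?e x) \<le> norm (exp (\<delta> * norm (Y x)))"
    proof (rule AE_I2)
      fix x
      have "norm (?e x) \<le> exp (norm (z * of_real (s x)))" by (rule norm_exp)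
      also have "\<dots> \<le> exp (\<delta> * norm (Y x))"
        using zs[of x] s_le'[of x] \<delta> mult_nonneg_nonneg[of \<delta> "norm (Y x)"] by simp
      finally show "norm (?e x) \<le> norm (exp (\<delta> * norm (Y x)))" by simp
    qed
  qed measurable
  then show ?thesis1 by (simp add: s_def Y_def)
  have ts: "tempered s" unfolding s_def Y_def by (rule tempered_centered)
  have int_s: "integrable (law \<theta>) s" "integrable (law \<theta>) (\<lambda>x. s x * s x)"
    by (intro tempered_integrable_law \<theta> tempered_mult ts)+
  have int_cs: "integrable (law \<theta>) (\<lambda>x. z * of_real (s x))"
    "integrable (law \<theta>) (\<lambda>x. z\<^sup>2 / 2 * of_real (s x * s x))"
    using int_s by (auto intro!: integrable_mult_right simp del: of_real_mult)
  have "(\<integral>x. z * of_real (s x) \<partial>law \<theta>) = z * of_real (\<integral>x. s x \<partial>law \<theta>)" by simp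
  also have "\<dots> = 0" by (simp add: s_def Y_def integral_centered[OF \<theta>])
  finally have lin: "(\<integral>x. z * of_real (s x) \<partial>law \<theta>) = 0" .
  have quad: "(\<integral>x. z\<^sup>2 / 2 * of_real (s x * s x) \<partial>law \<theta>) = z\<^sup>2 / 2 * of_real (h \<bullet> (cov \<theta> *v h))"
  proof -
    have "(\<integral>x. z\<^sup>2 / 2 * of_real (s x * s x) \<partial>law \<theta>) = z\<^sup>2 / 2 * of_real (\<integral>x. s x * s x \<partial>law \<theta>)"
      by (simp del: of_real_mult)
    then show ?thesis by (simp add: inner_cov[OF \<theta>] s_def Y_def)
  qed
  let ?R = "\<lambda>x. ?e x - 1 - z * of_real (s x) - z\<^sup>2 / 2 * of_real (s x * s x)"
  have int_R: "integrable (law \<theta>) ?R"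
    by (intro Bochner_Integration.integrable_diff int_e int_cs integrable_const)
  have "(\<integral>x. ?R x \<partial>law \<theta>) = (\<integral>x. ?e x \<partial>law \<theta>) - 1 - z\<^sup>2 / 2 * of_real (h \<bullet> (cov \<theta> *v h))"
    using int_e int_cs
    by (subst Bochner_Integration.integral_diff, (intro Bochner_Integration.integrable_diff int_e int_cs integrable_const)+)
       (simp only: Bochner_Integration.integral_diff Bochner_Integration.integrable_diff integrable_const
         lin quad lebesgue_integral_const measure_law_space[OF \<theta>] space_law, simp)
  moreover have "norm (\<integral>x. ?R x \<partial>law \<theta>) \<le> (\<integral>x. norm (?R x) \<partial>law \<theta>)" by (rule integral_norm_bound)
  moreover have "\<dots> \<le> (\<integral>x. norm h ^ 3 * (6 / \<delta>) ^ 3 * exp (\<delta> * norm (Y x)) \<partial>law \<theta>)"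
  proof (rule integral_mono)
    fix x
    let ?w = "z * of_real (s x)"
    have "?R x = exp ?w - 1 - ?w - ?w\<^sup>2 / 2" by (simp add: power2_eq_square)
    then have "norm (?R x) \<le> norm ?w ^ 3 * exp (norm ?w)" using norm_exp_minus_quadratic_le[of ?w] by simp
    also have "\<dots> \<le> (norm h * norm (Y x)) ^ 3 * exp (\<delta> / 2 * norm (Y x))"
      using zs[of x] s_le[of x] s_le'[of x] by (intro mult_mono power_mono) auto
    \<comment> \<open>The cube of \<open>\<delta> / 6 * norm (Y x)\<close> is at most
      \<open>exp (\<delta> / 2 * norm (Y x))\<close>. Together with the equal factor from the Taylor
      remainder this uses up exactly the available rate \<delta>; the rescaling is the origin of
      \<open>(6 / \<delta>) ^ 3\<close>.\<close>
    also have "\<dots> = norm h ^ 3 * (6 / \<delta>) ^ 3 * ((\<delta> / 6 * norm (Y x)) ^ 3 * exp (\<delta> / 2 * norm (Y x)))"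
      using \<delta> by (simp add: power_mult_distrib power_divide)
    also have "\<dots> \<le> norm h ^ 3 * (6 / \<delta>) ^ 3 * (exp (\<delta> / 6 * norm (Y x)) ^ 3 * exp (\<delta> / 2 * norm (Y x)))"
    proof (intro mult_left_mono mult_right_mono power_mono)
      show "\<delta> / 6 * norm (Y x) \<le> exp (\<delta> / 6 * norm (Y x))"
        using exp_ge_add_one_self[of "\<delta> / 6 * norm (Y x)"] by linarith
    qed (use \<delta> in auto)
    also have "exp (\<delta> / 6 * norm (Y x)) ^ 3 * exp (\<delta> / 2 * norm (Y x)) = exp (\<delta> * norm (Y x))"
      by (simp add: exp_of_nat_mult[symmetric] exp_add[symmetric])
    finally show "norm (?R x) \<le> norm h ^ 3 * (6 / \<delta>) ^ 3 * exp (\<delta> * norm (Y x))" .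
  qed (use int_R int' in auto)
  ultimately show ?thesis2 by (simp add: s_def Y_def)
qed

text \<open>Writing the line with \<open>t - s\<close> makes it pass through \<theta> at
  \<open>t = s\<close>. With \<open>s\<close> the value of the varied coordinate, these are ordinary
  partial derivatives; the logarithm of the partition function generates mean and
  covariance.\<close>

lemma has_derivative_axis:
  assumes \<theta>: "\<theta> \<in> \<Theta>"
  shows moment_has_derivative_axis: "tempered g \<Longrightarrow>
      ((\<lambda>t. moment g (\<theta> + (t - s) *\<^sub>R axis i 1)) has_real_derivative moment (\<lambda>x. g x * T x $ i) \<theta>) (at s)"
    and ln_partition_has_derivative_axis:
      "((\<lambda>t. ln (partition_function (\<theta> + (t - s) *\<^sub>R axis i 1))) has_real_derivative mean \<theta> $ i) (at s)"
    and mean_has_derivative_axis: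
      "((\<lambda>t. mean (\<theta> + (t - s) *\<^sub>R axis i 1) $ j) has_real_derivative cov \<theta> $ j $ i) (at s)"
proof -
  let ?line = "\<lambda>t. \<theta> + (t - s) *\<^sub>R axis i (1 :: real)"
  show mom: "((\<lambda>t. moment g (?line t)) has_real_derivative moment (\<lambda>x. g x * T x $ i) \<theta>) (at s)"
    if "tempered g" for g
  proof -
    have "(?line has_derivative (\<lambda>t. t *\<^sub>R axis i 1)) (at s)"
      by (auto intro!: derivative_eq_intros)
    moreover have "(moment g has_derivative (\<lambda>h. moment (\<lambda>x. g x * (h \<bullet> T x)) \<theta>)) (at (?line s))"
      using moment_has_derivative[OF \<theta> that] by simp
    ultimately have "((\<lambda>t. moment g (?line t)) has_derivative
        (\<lambda>t. moment (\<lambda>x. g x * ((t *\<^sub>R axis i 1) \<bullet> T x)) \<theta>)) (at s)"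
      by (rule has_derivative_compose)
    moreover have "moment (\<lambda>x. g x * ((t *\<^sub>R axis i 1) \<bullet> T x)) \<theta> = moment (\<lambda>x. g x * T x $ i) \<theta> * t" for t
      unfolding moment_def by (simp add: inner_axis' mult_ac)
    ultimately show ?thesis by (simp add: has_field_derivative_def mult_commute_abs)
  qed
  have Z0: "partition_function \<theta> > 0" by (rule partition_function_pos[OF \<theta>])
  have Z: "((\<lambda>t. partition_function (?line t)) has_real_derivative moment (\<lambda>x. T x $ i) \<theta>) (at s)"
    using mom[OF tempered_const[of 1]] by (simp add: partition_function_eq_moment)
  show "((\<lambda>t. ln (partition_function (?line t))) has_real_derivative mean \<theta> $ i) (at s)"
    using Z Z0 by (auto intro!: derivative_eq_intros simp: mean_component[OF \<theta>] divide_inverse mult.commute)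
  have "((\<lambda>t. moment (\<lambda>x. T x $ j) (?line t) / partition_function (?line t)) has_real_derivative
      (moment (\<lambda>x. T x $ j * T x $ i) \<theta> * partition_function (?line s) - moment (\<lambda>x. T x $ j) (?line s) * moment (\<lambda>x. T x $ i) \<theta>)
        / (partition_function (?line s) * partition_function (?line s))) (at s)"
    using Z0 by (intro DERIV_divide mom Z tempered_component) simp
  also have "(moment (\<lambda>x. T x $ j * T x $ i) \<theta> * partition_function (?line s) - moment (\<lambda>x. T x $ j) (?line s) * moment (\<lambda>x. T x $ i) \<theta>)
        / (partition_function (?line s) * partition_function (?line s)) = cov \<theta> $ j $ i"
    using Z0 by (simp add: cov_component[OF \<theta>] mean_component[OF \<theta>] field_simps)
  finally have quot: "((\<lambda>t. moment (\<lambda>x. T x $ j) (?line t) / partition_function (?line t))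
      has_real_derivative cov \<theta> $ j $ i) (at s)" .
  show "((\<lambda>t. mean (?line t) $ j) has_real_derivative cov \<theta> $ j $ i) (at s)"
  proof (rule has_field_derivative_transform_within_open[OF quot])
    \<comment> \<open>The quotient formula for the mean is available on \<Theta> only, so it is
      differentiated on the part of the line inside \<Theta>.\<close>
    show "open (?line -` \<Theta>)"
      by (intro open_vimage open_parameters continuous_intros)
  qed (use \<theta> in \<open>auto simp: mean_component\<close>)
qed

section \<open>The central sequence of an i.i.d. sample\<close>

definition joint :: "nat \<Rightarrow> real ^ 'k \<Rightarrow> (nat \<Rightarrow> 'x) measure" where
  "joint n \<theta> = (\<Pi>\<^sub>M i\<in>{1..n}. law \<theta>)"

definition score :: "nat \<Rightarrow> real ^ 'k \<Rightarrow> (nat \<Rightarrow> 'x) \<Rightarrow> real ^ 'k" where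
  "score n \<theta> x = (1 / sqrt (real n)) *\<^sub>R (\<Sum>i\<in>{1..n}. T (x i) - mean \<theta>)"

lemma T_component_measurable: "i \<in> {1..n} \<Longrightarrow> (\<lambda>x. T (x i)) \<in> borel_measurable (joint n \<theta>)"
  unfolding joint_def by (rule measurable_compose[OF measurable_component_singleton]) auto

lemma score_measurable [measurable]: "score n \<theta> \<in> borel_measurable (joint n \<theta>')"
  unfolding score_def
  by (intro borel_measurable_scaleR borel_measurable_const borel_measurable_sum borel_measurable_diff
      T_component_measurable)

lemma prob_space_joint: "(n \<ge> 1 \<Longrightarrow> \<theta> \<in> \<Theta>) \<Longrightarrow> prob_space (joint n \<theta>)"
  unfolding joint_def by (intro prob_space_PiM_nat prob_space_law) auto

text \<open>The expansion naturally produces the covariance at \<open>\<eta> n\<close>; it enters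
  the power estimate as a bounded sequence \<open>q\<close> and is exchanged for the covariance at
  \<theta> only afterwards, by continuity.\<close>

lemma mgf_power_tendsto:
  fixes z :: complex
  assumes \<theta>: "\<theta> \<in> \<Theta>" and \<eta>: "\<eta> \<longlonglongrightarrow> \<theta>" and \<tau>: "\<And>n. norm (\<tau> n) \<le> B" and z: "norm z \<le> 1"
  shows "\<forall>\<^sub>F n in sequentially. integrable (law (\<eta> n))
           (\<lambda>x. exp (z * of_real (((1 / sqrt (real n)) *\<^sub>R \<tau> n) \<bullet> (T x - mean (\<eta> n)))))" (is ?thesis1)
    and "(\<lambda>n. (\<integral>x. exp (z * of_real (((1 / sqrt (real n)) *\<^sub>R \<tau> n) \<bullet> (T x - mean (\<eta> n)))) \<partial>law (\<eta> n)) ^ n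
           - exp (z\<^sup>2 / 2 * of_real (\<tau> n \<bullet> (cov \<theta> *v \<tau> n)))) \<longlonglongrightarrow> 0" (is ?thesis2)
proof -
  have "B \<ge> 0" using \<tau>[of 0] norm_ge_zero order_trans by blast
  define h where "h n = (1 / sqrt (real n)) *\<^sub>R \<tau> n" for n
  define \<phi> where "\<phi> n = (\<integral>x. exp (z * of_real (h n \<bullet> (T x - mean (\<eta> n)))) \<partial>law (\<eta> n))" for n
  define q where "q n = z\<^sup>2 / 2 * of_real (\<tau> n \<bullet> (cov (\<eta> n) *v \<tau> n))" for n
  define q' where "q' n = z\<^sup>2 / 2 * of_real (\<tau> n \<bullet> (cov \<theta> *v \<tau> n))" for n
  obtain \<delta> C where \<delta>: "\<delta> > 0" and C: "C \<ge> 0" and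
    ev: "\<forall>\<^sub>F n in sequentially. integrable (law (\<eta> n)) (\<lambda>x. exp (\<delta> * norm (T x - mean (\<eta> n)))) \<and>
       (\<integral>x. exp (\<delta> * norm (T x - mean (\<eta> n))) \<partial>law (\<eta> n)) \<le> C"
    using exponential_moment_bounded[OF \<theta> \<eta>] by blast
  have ev\<Theta>: "\<forall>\<^sub>F n in sequentially. \<eta> n \<in> \<Theta>"
    using topological_tendstoD[OF \<eta> open_parameters \<theta>] .
  have h_le: "norm (h n) \<le> B / sqrt (real n)" for n
    using \<tau>[of n] by (simp add: h_def divide_right_mono)
  have "(\<lambda>n. B / sqrt (real n)) \<longlonglongrightarrow> 0" by real_asymp
  then have evh: "\<forall>\<^sub>F n in sequentially. B / sqrt (real n) < \<delta> / 2"
    by (rule order_tendstoD) (use \<delta> in simp)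
  show ?thesis1
    using ev ev\<Theta> evh
  proof eventually_elim
    case (elim n)
    have "norm (h n) \<le> \<delta> / 2" using elim(3) h_le[of n] by linarith
    from mgf_expansion(1)[OF elim(2) z \<delta> this] elim(1) show ?case by (simp only: h_def)
  qed
  \<comment> \<open>The cube of \<open>B / sqrt n\<close> supplies the order n^(-3/2) that the power
    estimate asks for.\<close>
  define K where "K = B ^ 3 * (6 / \<delta>) ^ 3 * C"
  have K: "K \<ge> 0" using \<open>B \<ge> 0\<close> \<delta> C by (simp add: K_def)
  have \<phi>: "\<forall>\<^sub>F n in sequentially. norm (\<phi> n - 1 - q n / of_nat n) \<le> K / (real n * sqrt (real n))"
    using ev ev\<Theta> evh eventually_gt_at_top[of 0]
  proof eventually_elim
    case (elim n)
    have hq: "z\<^sup>2 / 2 * of_real (h n \<bullet> (cov (\<eta> n) *v h n)) = q n / of_nat n"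
    proof -
      have "h n \<bullet> (cov (\<eta> n) *v h n) = (\<tau> n \<bullet> (cov (\<eta> n) *v \<tau> n)) / real n"
        by (simp add: h_def matrix_vector_mult_scaleR)
      then show ?thesis by (simp add: q_def)
    qed
    have "norm (h n) \<le> \<delta> / 2" using elim(3) h_le[of n] by linarith
    then have "norm (\<phi> n - 1 - q n / of_nat n)
        \<le> norm (h n) ^ 3 * (6 / \<delta>) ^ 3 * (\<integral>x. exp (\<delta> * norm (T x - mean (\<eta> n))) \<partial>law (\<eta> n))"
      using mgf_expansion(2)[OF elim(2) z \<delta>, of "h n"] elim(1) unfolding hq \<phi>_def by blast
    also have "\<dots> \<le> (B / sqrt (real n)) ^ 3 * (6 / \<delta>) ^ 3 * C"
      using elim h_le[of n] \<delta> \<open>B \<ge> 0\<close> by (intro mult_mono power_mono) auto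
    also have "\<dots> = K / (real n * sqrt (real n))"
      using elim(4) by (simp add: K_def power_divide power3_eq_cube)
    finally show ?case .
  qed
  have z2: "norm (z\<^sup>2 / 2) \<le> 1"
    using power_mono[OF z, of 2] by (simp add: norm_divide norm_power)
  let ?s = "\<lambda>S :: real ^ 'k ^ 'k. \<Sum>i\<in>UNIV. \<Sum>j\<in>UNIV. \<bar>S $ i $ j\<bar>"
  have quad: "\<bar>\<tau> n \<bullet> (S *v \<tau> n)\<bar> \<le> B * B * ?s S" for n S
    using inner_matrix_vector_bound[of "\<tau> n" S "\<tau> n"] \<tau>[of n] \<open>B \<ge> 0\<close>
    by (elim order_trans) (auto intro!: mult_right_mono mult_mono sum_nonneg)
  have quad_c: "norm (z\<^sup>2 / 2 * of_real (\<tau> n \<bullet> (S *v \<tau> n))) \<le> B * B * ?s S" for n S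
  proof -
    have "norm (z\<^sup>2 / 2 * of_real (\<tau> n \<bullet> (S *v \<tau> n))) = norm (z\<^sup>2 / 2) * \<bar>\<tau> n \<bullet> (S *v \<tau> n)\<bar>"
      by (simp only: norm_mult norm_of_real)
    also have "\<dots> \<le> 1 * (B * B * ?s S)" by (intro mult_mono z2 quad) auto
    finally show ?thesis by simp
  qed
  have cov_lim: "(\<lambda>n. cov (\<eta> n) $ i $ j) \<longlonglongrightarrow> cov \<theta> $ i $ j" for i j
    by (rule tendsto_parameters(3)[OF \<theta> \<eta>])
  have "(\<lambda>n. B * B * ?s (cov (\<eta> n))) \<longlonglongrightarrow> B * B * ?s (cov \<theta>)"
    by (intro tendsto_intros cov_lim)
  \<comment> \<open>The power estimate wants a bound on \<open>q\<close> for every index.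
    Convergence of the entries gives one, including the early indices at which
    \<open>\<eta> n\<close> may lie outside \<Theta>.\<close>
  then have "Bseq (\<lambda>n. B * B * ?s (cov (\<eta> n)))"
    by (intro convergent_imp_Bseq convergentI)
  then obtain B' where B': "\<forall>n. norm (B * B * ?s (cov (\<eta> n))) \<le> B'"
    by (rule BseqE)
  have qB: "norm (q n) \<le> B'" for n
    using quad_c[of n "cov (\<eta> n)"] spec[OF B', of n] unfolding q_def real_norm_def by linarith
  have main: "(\<lambda>n. \<phi> n ^ n - exp (q n)) \<longlonglongrightarrow> 0"
    by (rule power_diff_exp_tendsto_0[OF \<phi> qB K])
  have qq: "(\<lambda>n. q n - q' n) \<longlonglongrightarrow> 0"
  proof (rule Lim_null_comparison)
    show "\<forall>\<^sub>F n in sequentially. norm (q n - q' n) \<le> B * B * ?s (cov (\<eta> n) - cov \<theta>)"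
    proof (rule always_eventually, rule allI)
      fix n
      have "q n - q' n = z\<^sup>2 / 2 * of_real (\<tau> n \<bullet> ((cov (\<eta> n) - cov \<theta>) *v \<tau> n))"
        by (simp add: q_def q'_def matrix_vector_mult_diff_rdistrib inner_diff_right algebra_simps)
      then show "norm (q n - q' n) \<le> B * B * ?s (cov (\<eta> n) - cov \<theta>)" by (simp only: quad_c)
    qed
    have "(\<lambda>n. B * B * (\<Sum>i\<in>UNIV. \<Sum>j\<in>UNIV. \<bar>cov (\<eta> n) $ i $ j - cov \<theta> $ i $ j\<bar>))
        \<longlonglongrightarrow> B * B * (\<Sum>i\<in>UNIV. \<Sum>j\<in>UNIV. \<bar>cov \<theta> $ i $ j - cov \<theta> $ i $ j\<bar>)"
      by (intro tendsto_intros cov_lim)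
    then show "(\<lambda>n. B * B * ?s (cov (\<eta> n) - cov \<theta>)) \<longlonglongrightarrow> 0" by simp
  qed
  \<comment> \<open>The exponential is not uniformly continuous, so the factor
    \<open>exp (q' n)\<close> is split off; it is bounded because the \<tau> are.\<close>
  have "(\<lambda>n. exp (q' n) * (exp (q n - q' n) - 1)) \<longlonglongrightarrow> 0"
  proof (rule Lim_null_comparison)
    have bound: "norm (exp (q' n)) \<le> exp (B * B * ?s (cov \<theta>))" for n
    proof (rule order_trans[OF norm_exp])
      show "exp (norm (q' n)) \<le> exp (B * B * ?s (cov \<theta>))"
        unfolding exp_le_cancel_iff q'_def by (rule quad_c)
    qed
    show "\<forall>\<^sub>F n in sequentially. norm (exp (q' n) * (exp (q n - q' n) - 1))
        \<le> exp (B * B * ?s (cov \<theta>)) * norm (exp (q n - q' n) - 1)"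
      unfolding norm_mult by (intro always_eventually allI mult_right_mono bound) simp
    have "(\<lambda>n. exp (B * B * ?s (cov \<theta>)) * norm (exp (q n - q' n) - 1))
        \<longlonglongrightarrow> exp (B * B * ?s (cov \<theta>)) * norm (exp 0 - 1 :: complex)"
      by (intro tendsto_intros qq)
    then show "(\<lambda>n. exp (B * B * ?s (cov \<theta>)) * norm (exp (q n - q' n) - 1)) \<longlonglongrightarrow> 0" by simp
  qed
  then have "(\<lambda>n. exp (q n) - exp (q' n)) \<longlonglongrightarrow> 0"
    by (simp add: right_diff_distrib exp_add[symmetric])
  from tendsto_add[OF main this] have "(\<lambda>n. \<phi> n ^ n - exp (q' n)) \<longlonglongrightarrow> 0" by simp
  then show ?thesis2 by (simp add: \<phi>_def q'_def h_def)
qed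

text \<open>Scaled by the root of n, the score is a sum over independent observations, so its
  generating function is the n-th power of that of one observation.\<close>

lemma score_mgf:
  fixes z :: complex
  assumes \<theta>: "\<theta> \<in> \<Theta>"
    and int: "integrable (law \<theta>) (\<lambda>x. exp (z * of_real (((1 / sqrt (real n)) *\<^sub>R u) \<bullet> (T x - mean \<theta>))))"
  shows "integrable (joint n \<theta>) (\<lambda>x. exp (z * of_real (u \<bullet> score n \<theta> x)))" (is ?thesis1)
    and "(\<integral>x. exp (z * of_real (u \<bullet> score n \<theta> x)) \<partial>joint n \<theta>)
      = (\<integral>x. exp (z * of_real (((1 / sqrt (real n)) *\<^sub>R u) \<bullet> (T x - mean \<theta>))) \<partial>law \<theta>) ^ n" (is ?thesis2)
proof -
  interpret l: prob_space "law \<theta>" by (rule prob_space_law[OF \<theta>])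
  interpret P: product_sigma_finite "\<lambda>_ :: nat. law \<theta>" by unfold_locales
  let ?f = "\<lambda>x. exp (z * of_real (((1 / sqrt (real n)) *\<^sub>R u) \<bullet> (T x - mean \<theta>)))"
  have eq: "exp (z * of_real (u \<bullet> score n \<theta> x)) = (\<Prod>i\<in>{1..n}. ?f (x i))" for x
    by (simp add: score_def exp_sum[symmetric] inner_sum_right sum_distrib_left)
  show ?thesis1 unfolding eq joint_def by (rule P.product_integrable_prod) (use int in auto)
  have "(\<integral>x. (\<Prod>i\<in>{1..n}. ?f (x i)) \<partial>joint n \<theta>) = (\<Prod>i\<in>{1..n}. \<integral>x. ?f x \<partial>law \<theta>)"
    unfolding joint_def by (rule P.product_integral_prod) (use int in auto)
  then show ?thesis2 unfolding eq by simp
qed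

lemma score_mgf_tendsto:
  fixes z :: complex
  assumes \<theta>: "\<theta> \<in> \<Theta>" and \<eta>: "\<eta> \<longlonglongrightarrow> \<theta>" and z: "norm z \<le> 1"
  shows "\<forall>\<^sub>F n in sequentially. integrable (joint n (\<eta> n)) (\<lambda>x. exp (z * of_real (u \<bullet> score n (\<eta> n) x)))" (is ?thesis1)
    and "(\<lambda>n. \<integral>x. exp (z * of_real (u \<bullet> score n (\<eta> n) x)) \<partial>joint n (\<eta> n))
      \<longlonglongrightarrow> exp (z\<^sup>2 / 2 * of_real (u \<bullet> (cov \<theta> *v u)))" (is ?thesis2)
proof -
  note mgf = mgf_power_tendsto[OF \<theta> \<eta>, of "\<lambda>_. u" "norm u" z, OF order_refl z]
  have ev\<Theta>: "\<forall>\<^sub>F n in sequentially. \<eta> n \<in> \<Theta>"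
    using topological_tendstoD[OF \<eta> open_parameters \<theta>] .
  show ?thesis1 using mgf(1) ev\<Theta> by eventually_elim (rule score_mgf(1))
  have "\<forall>\<^sub>F n in sequentially. (\<integral>x. exp (z * of_real (((1 / sqrt (real n)) *\<^sub>R u) \<bullet> (T x - mean (\<eta> n)))) \<partial>law (\<eta> n)) ^ n
      = (\<integral>x. exp (z * of_real (u \<bullet> score n (\<eta> n) x)) \<partial>joint n (\<eta> n))"
    using mgf(1) ev\<Theta> by eventually_elim (rule score_mgf(2)[symmetric])
  moreover from Lim_null[THEN iffD2, OF mgf(2)]
  have "(\<lambda>n. (\<integral>x. exp (z * of_real (((1 / sqrt (real n)) *\<^sub>R u) \<bullet> (T x - mean (\<eta> n)))) \<partial>law (\<eta> n)) ^ n)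
      \<longlonglongrightarrow> exp (z\<^sup>2 / 2 * of_real (u \<bullet> (cov \<theta> *v u)))" .
  ultimately show ?thesis2 by (rule Lim_transform_eventually[rotated])
qed

text \<open>Only finitely many real exponential moments of the score are involved, and each
  converges, so their sum is eventually bounded.\<close>

lemma score_tight:
  assumes \<theta>: "\<theta> \<in> \<Theta>" and \<eta>: "\<eta> \<longlonglongrightarrow> \<theta>" and d: "d > 0"
  shows "\<exists>K. \<forall>\<^sub>F n in sequentially.
    measure (joint n (\<eta> n)) {x \<in> space (joint n (\<eta> n)). norm (score n (\<eta> n) x) > K} \<le> d"
proof -
  let ?E = "\<lambda>n u. \<integral>x. exp (u \<bullet> score n (\<eta> n) x) \<partial>joint n (\<eta> n)"
  have int: "\<forall>\<^sub>F n in sequentially. integrable (joint n (\<eta> n)) (\<lambda>x. exp (u \<bullet> score n (\<eta> n) x))" for u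
    using score_mgf_tendsto(1)[OF \<theta> \<eta>, of 1 u] by (simp add: complex_of_real_integrable_eq exp_of_real)
  have lim: "(\<lambda>n. ?E n u) \<longlonglongrightarrow> exp (u \<bullet> (cov \<theta> *v u) / 2)" for u
  proof -
    have "(\<lambda>n. complex_of_real (?E n u)) \<longlonglongrightarrow> of_real (exp (u \<bullet> (cov \<theta> *v u) / 2))"
      using score_mgf_tendsto(2)[OF \<theta> \<eta>, of 1 u] exp_of_real[of "u \<bullet> (cov \<theta> *v u) / 2", where 'a = complex]
      by (simp add: exp_of_real)
    then show ?thesis by (simp only: tendsto_of_real_iff)
  qed
  \<comment> \<open>The shift that makes the sum \<open>?F\<close> dominate
    \<open>exp (norm (score n (\<eta> n) x))\<close>, by \<open>exp_norm_le_sum\<close> at rate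
    1.\<close>
  let ?c = "real CARD('k)"
  let ?F = "\<lambda>n x. \<Sum>i\<in>UNIV. exp (axis i ?c \<bullet> score n (\<eta> n) x) + exp (axis i (- ?c) \<bullet> score n (\<eta> n) x)"
  define S where "S = (\<Sum>i\<in>UNIV. exp (axis i ?c \<bullet> (cov \<theta> *v axis i ?c) / 2)
      + exp (axis i (- ?c) \<bullet> (cov \<theta> *v axis i (- ?c)) / 2))"
  have "S \<ge> 0" unfolding S_def by (intro sum_nonneg) simp
  have intF: "\<forall>\<^sub>F n in sequentially. integrable (joint n (\<eta> n)) (?F n) \<and> (\<integral>x. ?F n x \<partial>joint n (\<eta> n))
      = (\<Sum>i\<in>UNIV. ?E n (axis i ?c) + ?E n (axis i (- ?c)))"
  proof -
    have "\<forall>\<^sub>F n in sequentially. \<forall>i\<in>UNIV. integrable (joint n (\<eta> n)) (\<lambda>x. exp (axis i ?c \<bullet> score n (\<eta> n) x))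
        \<and> integrable (joint n (\<eta> n)) (\<lambda>x. exp (axis i (- ?c) \<bullet> score n (\<eta> n) x))"
      by (intro eventually_ball_finite finite ballI eventually_conj int)
    then show ?thesis by eventually_elim simp
  qed
  have "(\<lambda>n. \<Sum>i\<in>UNIV. ?E n (axis i ?c) + ?E n (axis i (- ?c))) \<longlonglongrightarrow> S"
    unfolding S_def by (intro tendsto_sum tendsto_add lim)
  then have evS: "\<forall>\<^sub>F n in sequentially. (\<Sum>i\<in>UNIV. ?E n (axis i ?c) + ?E n (axis i (- ?c))) < S + 1"
    by (rule order_tendstoD) simp
  have ev\<Theta>: "\<forall>\<^sub>F n in sequentially. \<eta> n \<in> \<Theta>"
    using topological_tendstoD[OF \<eta> open_parameters \<theta>] .
  \<comment> \<open>Solves \<open>(S + 1) / exp K = d\<close>, so that Markov's inequality gives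
    precisely \<open>d\<close>.\<close>
  define K where "K = ln ((S + 1) / d)"
  have K: "exp K = (S + 1) / d" using \<open>S \<ge> 0\<close> d by (simp add: K_def)
  have "\<forall>\<^sub>F n in sequentially.
    measure (joint n (\<eta> n)) {x \<in> space (joint n (\<eta> n)). norm (score n (\<eta> n) x) > K} \<le> d"
    using intF evS ev\<Theta>
  proof eventually_elim
    case (elim n)
    interpret prob_space "joint n (\<eta> n)" using elim(3) by (intro prob_space_joint)
    have "measure (joint n (\<eta> n)) {x \<in> space (joint n (\<eta> n)). norm (score n (\<eta> n) x) > K}
        \<le> measure (joint n (\<eta> n)) {x \<in> space (joint n (\<eta> n)). ?F n x \<ge> exp K}"
    proof (rule finite_measure_mono)
      show "{x \<in> space (joint n (\<eta> n)). norm (score n (\<eta> n) x) > K}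
          \<subseteq> {x \<in> space (joint n (\<eta> n)). ?F n x \<ge> exp K}"
      proof safe
        fix x assume "norm (score n (\<eta> n) x) > K"
        then have "exp K \<le> exp (1 * norm (score n (\<eta> n) x))" by simp
        also have "\<dots> \<le> ?F n x" using exp_norm_le_sum[of 1 "score n (\<eta> n) x"] by simp
        finally show "exp K \<le> ?F n x" .
      qed
    qed measurable
    also have "\<dots> \<le> (\<integral>x. ?F n x \<partial>joint n (\<eta> n)) / exp K"
      by (rule integral_Markov_inequality_measure[of _ _ "space (joint n (\<eta> n))"])
         (use elim(1) in \<open>auto intro!: AE_I2 sum_nonneg\<close>)
    also have "\<dots> \<le> (S + 1) / exp K" using elim(1,2) by (intro divide_right_mono) auto
    also have "\<dots> = d" using K d \<open>S \<ge> 0\<close> by simp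
    finally show ?case .
  qed
  then show ?thesis ..
qed

theorem score_asymptotically_normal:
  assumes \<theta>: "\<theta> \<in> \<Theta>" and \<eta>: "\<eta> \<longlonglongrightarrow> \<theta>" and \<eta>\<Theta>: "\<And>n. n \<ge> 1 \<Longrightarrow> \<eta> n \<in> \<Theta>"
  shows "\<exists>N. mv_normal 0 (cov \<theta>) N \<and> converges_in_law (\<lambda>n. joint n (\<eta> n)) (\<lambda>n. score n (\<eta> n)) N"
proof -
  obtain A :: "real ^ 'k ^ 'k" where A: "A ** transpose A = cov \<theta>"
    by (rule psd_factorization[of "cov \<theta>", OF cov_symmetric cov_psd[OF \<theta>]])
  define N where "N = distr (\<Pi>\<^sub>M i\<in>(UNIV :: 'k set). density lborel (\<lambda>x. ennreal (std_normal_density x)))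
              borel (\<lambda>z. 0 + A *v (\<chi> i. z i))"
  note gauss = gaussian_cos[of A, folded N_def, unfolded A]
  have "converges_in_law (\<lambda>n. joint n (\<eta> n)) (\<lambda>n. score n (\<eta> n)) N"
  proof (rule converges_in_law_cos[OF prob_space_joint[OF \<eta>\<Theta>] score_measurable gauss(1,2) _ score_tight[OF \<theta> \<eta>]])
    fix t :: "real ^ 'k" and c :: real
    have int: "\<forall>\<^sub>F n in sequentially. integrable (joint n (\<eta> n)) (\<lambda>x. exp (\<i> * of_real (t \<bullet> score n (\<eta> n) x)))"
      by (rule score_mgf_tendsto(1)[OF \<theta> \<eta>]) simp
    \<comment> \<open>The phase is a constant factor \<open>exp (\<i> * c)\<close>; taking real
      parts afterwards recovers the cosine of the shifted argument.\<close>
    have lim_Re: "(\<lambda>n. Re (exp (\<i> * of_real c) * (\<integral>x. exp (\<i> * of_real (t \<bullet> score n (\<eta> n) x)) \<partial>joint n (\<eta> n))))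
        \<longlonglongrightarrow> Re (exp (\<i> * of_real c) * exp (\<i>\<^sup>2 / 2 * of_real (t \<bullet> (cov \<theta> *v t))))"
      by (intro tendsto_intros score_mgf_tendsto(2)[OF \<theta> \<eta>]) simp
    have limit: "Re (exp (\<i> * of_real c) * exp (\<i>\<^sup>2 / 2 * of_real (t \<bullet> (cov \<theta> *v t)))) = (\<integral>y. cos (t \<bullet> y + c) \<partial>N)"
    proof -
      have "\<i>\<^sup>2 / 2 * of_real (t \<bullet> (cov \<theta> *v t)) = complex_of_real (- (t \<bullet> (cov \<theta> *v t)) / 2)" by simp
      then show ?thesis by (simp only: gauss(3) exp_of_real) (simp add: Re_exp)
    qed
    have eq: "\<forall>\<^sub>F n in sequentially. Re (exp (\<i> * of_real c) * (\<integral>x. exp (\<i> * of_real (t \<bullet> score n (\<eta> n) x)) \<partial>joint n (\<eta> n)))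
        = (\<integral>x. cos (t \<bullet> score n (\<eta> n) x + c) \<partial>joint n (\<eta> n))"
      using int
    proof eventually_elim
      case (elim n)
      have "(\<integral>x. cos (t \<bullet> score n (\<eta> n) x + c) \<partial>joint n (\<eta> n))
          = (\<integral>x. Re (exp (\<i> * of_real c) * exp (\<i> * of_real (t \<bullet> score n (\<eta> n) x))) \<partial>joint n (\<eta> n))"
        by (simp add: exp_add[symmetric] Re_exp add.commute)
      also have "\<dots> = Re (exp (\<i> * of_real c) * (\<integral>x. exp (\<i> * of_real (t \<bullet> score n (\<eta> n) x)) \<partial>joint n (\<eta> n)))"
        using elim by (simp only: integral_Re integrable_mult_right integral_mult_right_zero)
      finally show ?case ..
    qed
    show "(\<lambda>n. \<integral>x. cos (t \<bullet> score n (\<eta> n) x + c) \<partial>joint n (\<eta> n)) \<longlonglongrightarrow> (\<integral>y. cos (t \<bullet> y + c) \<partial>N)"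
      using lim_Re[unfolded limit] eq by (rule Lim_transform_eventually)
  qed
  moreover have "mv_normal 0 (cov \<theta>) N" using A unfolding mv_normal_def N_def by blast
  ultimately show ?thesis by blast
qed

section \<open>Likelihood ratios and local asymptotic normality\<close>

lemma law_shift:
  assumes "\<theta> \<in> \<Theta>" "\<theta> + h \<in> \<Theta>"
  shows "law (\<theta> + h) = density (law \<theta>)
    (\<lambda>x. ennreal (exp (h \<bullet> T x) * (partition_function \<theta> / partition_function (\<theta> + h))))"
proof -
  note Z = partition_function_pos[OF assms(1)] partition_function_pos[OF assms(2)]
  have "exp (\<theta> \<bullet> T x) / partition_function \<theta> * (exp (h \<bullet> T x) * (partition_function \<theta> / partition_function (\<theta> + h)))
      = exp ((\<theta> + h) \<bullet> T x) / partition_function (\<theta> + h)" for x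
    using Z by (simp add: inner_add_left exp_add)
  then have eq: "ennreal (exp (\<theta> \<bullet> T x) / partition_function \<theta>)
      * ennreal (exp (h \<bullet> T x) * (partition_function \<theta> / partition_function (\<theta> + h)))
      = ennreal (exp ((\<theta> + h) \<bullet> T x) / partition_function (\<theta> + h))" for x
    using Z by (simp add: ennreal_mult'[symmetric])
  have "density (law \<theta>) (\<lambda>x. ennreal (exp (h \<bullet> T x) * (partition_function \<theta> / partition_function (\<theta> + h))))
      = density \<mu> (\<lambda>x. ennreal (exp (\<theta> \<bullet> T x) / partition_function \<theta>)
      * ennreal (exp (h \<bullet> T x) * (partition_function \<theta> / partition_function (\<theta> + h))))"
    unfolding law_def by (rule density_density_eq) measurable
  then show ?thesis by (simp only: eq) (simp add: law_def)
qed

text \<open>Links the ratio of normalising constants in a likelihood ratio to the generating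
  function whose powers have been expanded.\<close>

lemma centered_mgf:
  assumes "\<theta> \<in> \<Theta>"
  shows "(\<integral>x. exp (h \<bullet> (T x - mean \<theta>)) \<partial>law \<theta>)
    = exp (- (h \<bullet> mean \<theta>)) * partition_function (\<theta> + h) / partition_function \<theta>"
proof -
  have "(\<integral>x. exp (h \<bullet> (T x - mean \<theta>)) \<partial>law \<theta>) = moment (\<lambda>x. exp (h \<bullet> (T x - mean \<theta>))) \<theta> / partition_function \<theta>"
    by (rule integral_law[OF assms]) measurable
  also have "moment (\<lambda>x. exp (h \<bullet> (T x - mean \<theta>))) \<theta>
      = (\<integral>x. exp (- (h \<bullet> mean \<theta>)) * exp ((\<theta> + h) \<bullet> T x) \<partial>\<mu>)"
    by (simp add: moment_def exp_add[symmetric] inner_diff_right inner_add_left algebra_simps)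
  also have "\<dots> = exp (- (h \<bullet> mean \<theta>)) * partition_function (\<theta> + h)"
    by (simp add: partition_function_def)
  finally show ?thesis .
qed

text \<open>The explicit product density is one version of the Radon-Nikodym derivative, which is
  determined only up to null sets. Subtracting \<open>h \<bullet> mean \<theta>\<close> in each
  summand is compensated in the deterministic term.\<close>

lemma log_lik_ratio_AE:
  assumes \<theta>: "\<theta> \<in> \<Theta>" "\<theta> + h \<in> \<Theta>"
  shows "AE x in joint n \<theta>. log_lik_ratio (joint n (\<theta> + h)) (joint n \<theta>) x
    = (\<Sum>i\<in>{1..n}. h \<bullet> (T (x i) - mean \<theta>)) - real n * ln (\<integral>x. exp (h \<bullet> (T x - mean \<theta>)) \<partial>law \<theta>)"
proof -
  note Z = partition_function_pos[OF \<theta>(1)] partition_function_pos[OF \<theta>(2)]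
  define c where "c = partition_function \<theta> / partition_function (\<theta> + h)"
  have c: "c > 0" using Z by (simp add: c_def)
  let ?r = "\<lambda>x. exp (h \<bullet> T x) * c"
  interpret J: prob_space "joint n \<theta>" by (rule prob_space_joint[OF \<theta>(1)])
  interpret L: prob_space "law \<theta>" by (rule prob_space_law[OF \<theta>(1)])
  interpret L': prob_space "law (\<theta> + h)" by (rule prob_space_law[OF \<theta>(2)])
  have eq: "law (\<theta> + h) = density (law \<theta>) (\<lambda>x. ennreal (?r x))"
    using law_shift[OF \<theta>] by (simp add: c_def)
  have "joint n (\<theta> + h) = density (joint n \<theta>) (\<lambda>x. \<Prod>i\<in>{1..n}. ennreal (?r (x i)))"
    unfolding joint_def eq
    by (rule PiM_density) (auto simp: eq[symmetric] intro: L.sigma_finite_measure_axioms L'.sigma_finite_measure_axioms)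
  then have dens: "density (joint n \<theta>) (\<lambda>x. ennreal (\<Prod>i\<in>{1..n}. ?r (x i))) = joint n (\<theta> + h)"
    using c by (simp add: prod_ennreal)
  have "(\<lambda>x. ennreal (\<Prod>i\<in>{1..n}. ?r (x i))) \<in> borel_measurable (joint n \<theta>)"
    by (intro measurable_compose[OF _ measurable_ennreal] borel_measurable_prod borel_measurable_times
        borel_measurable_const measurable_compose[OF _ borel_measurable_exp] borel_measurable_inner
        T_component_measurable)
  from J.RN_deriv_unique[OF this dens] show ?thesis
  proof eventually_elim
    case (elim x)
    have "log_lik_ratio (joint n (\<theta> + h)) (joint n \<theta>) x = ln (\<Prod>i\<in>{1..n}. ?r (x i))"
      using c by (simp add: log_lik_ratio_def elim[symmetric] prod_nonneg)
    also have "\<dots> = (\<Sum>i\<in>{1..n}. h \<bullet> T (x i) + ln c)"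
      using c by (subst ln_prod) (auto simp: ln_mult)
    also have "\<dots> = (\<Sum>i\<in>{1..n}. h \<bullet> (T (x i) - mean \<theta>)) - real n * (- (h \<bullet> mean \<theta>) - ln c)"
      by (simp add: sum.distrib inner_diff_right sum_subtractf algebra_simps)
    also have "- (h \<bullet> mean \<theta>) - ln c = ln (\<integral>x. exp (h \<bullet> (T x - mean \<theta>)) \<partial>law \<theta>)"
      using Z by (simp add: centered_mgf[OF \<theta>(1)] c_def ln_div ln_mult)
    finally show ?case .
  qed
qed

lemma log_lik_ratio_expansion:
  assumes \<theta>: "\<theta> \<in> \<Theta>" and \<eta>: "\<eta> \<longlonglongrightarrow> \<theta>" and \<eta>\<Theta>: "\<And>n. n \<ge> 1 \<Longrightarrow> \<eta> n \<in> \<Theta>"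
    and \<tau>: "\<And>n. norm (\<tau> n) \<le> B"
    and \<tau>\<Theta>: "\<And>n. n \<ge> 1 \<Longrightarrow> \<eta> n + (1 / sqrt (real n)) *\<^sub>R \<tau> n \<in> \<Theta>"
  shows "small_o_in_prob (\<lambda>n. joint n (\<eta> n))
    (\<lambda>n x. log_lik_ratio (joint n (\<eta> n + (1 / sqrt (real n)) *\<^sub>R \<tau> n)) (joint n (\<eta> n)) x
       - (\<tau> n \<bullet> score n (\<eta> n) x - 1/2 * (\<tau> n \<bullet> (cov \<theta> *v \<tau> n))))"
proof -
  define h where "h n = (1 / sqrt (real n)) *\<^sub>R \<tau> n" for n
  define \<phi> where "\<phi> n = (\<integral>x. exp (h n \<bullet> (T x - mean (\<eta> n))) \<partial>law (\<eta> n))" for n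
  \<comment> \<open>The random parts of the log-likelihood ratio and of its expansion agree almost
    surely, so this number is the whole remainder, and convergence in probability reduces to
    \<open>r n\<close> tending to 0.\<close>
  define r where "r n = 1/2 * (\<tau> n \<bullet> (cov \<theta> *v \<tau> n)) - real n * ln (\<phi> n)" for n
  let ?R = "\<lambda>n x. log_lik_ratio (joint n (\<eta> n + h n)) (joint n (\<eta> n)) x
       - (\<tau> n \<bullet> score n (\<eta> n) x - 1/2 * (\<tau> n \<bullet> (cov \<theta> *v \<tau> n)))"
  have \<phi>_pos: "\<phi> n > 0" if "n \<ge> 1" for n
    using partition_function_pos[OF \<eta>\<Theta>[OF that]] partition_function_pos[OF \<tau>\<Theta>[OF that]]
    unfolding \<phi>_def centered_mgf[OF \<eta>\<Theta>[OF that]] by (simp add: h_def)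
  have R: "AE x in joint n (\<eta> n). ?R n x = r n" if n: "n \<ge> 1" for n
    using log_lik_ratio_AE[OF \<eta>\<Theta>[OF n] \<tau>\<Theta>[OF n, folded h_def], of n]
  proof eventually_elim
    case (elim x)
    have "\<tau> n \<bullet> score n (\<eta> n) x = (\<Sum>i\<in>{1..n}. h n \<bullet> (T (x i) - mean (\<eta> n)))"
      by (simp add: score_def h_def inner_sum_right sum_distrib_left)
    then show ?case using elim by (simp add: r_def \<phi>_def)
  qed
  have \<phi>_complex: "(\<integral>x. exp (1 * complex_of_real (h n \<bullet> (T x - mean (\<eta> n)))) \<partial>law (\<eta> n)) = of_real (\<phi> n)" for n
    by (simp add: \<phi>_def exp_of_real)
  have limit_complex: "exp (1\<^sup>2 / 2 * complex_of_real (\<tau> n \<bullet> (cov \<theta> *v \<tau> n)))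
      = of_real (exp (1/2 * (\<tau> n \<bullet> (cov \<theta> *v \<tau> n))))" for n
    by (simp add: exp_of_real[symmetric])
  have "(\<lambda>n. complex_of_real (\<phi> n ^ n - exp (1/2 * (\<tau> n \<bullet> (cov \<theta> *v \<tau> n))))) \<longlonglongrightarrow> of_real 0"
    using mgf_power_tendsto(2)[OF \<theta> \<eta>, of \<tau> B 1, OF \<tau>, folded h_def, unfolded \<phi>_complex limit_complex]
    by simp
  then have "(\<lambda>n. \<phi> n ^ n - exp (1/2 * (\<tau> n \<bullet> (cov \<theta> *v \<tau> n)))) \<longlonglongrightarrow> 0"
    by (simp only: tendsto_of_real_iff)
  then have "(\<lambda>n. ln (\<phi> n ^ n) - ln (exp (1/2 * (\<tau> n \<bullet> (cov \<theta> *v \<tau> n))))) \<longlonglongrightarrow> 0"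
  proof (rule ln_diff_tendsto_0)
    \<comment> \<open>Positive semidefiniteness keeps the limiting exponentials away from 0, where
      the logarithm would be uncontrolled.\<close>
    show "exp (1/2 * (\<tau> n \<bullet> (cov \<theta> *v \<tau> n))) \<ge> 1" for n using cov_psd[OF \<theta>, of "\<tau> n"] by simp
    show "\<forall>\<^sub>F n in sequentially. \<phi> n ^ n > 0"
      using eventually_ge_at_top[of 1] by eventually_elim (simp add: \<phi>_pos)
  qed
  from tendsto_minus[OF this]
  have "(\<lambda>n. - (ln (\<phi> n ^ n) - ln (exp (1/2 * (\<tau> n \<bullet> (cov \<theta> *v \<tau> n)))))) \<longlonglongrightarrow> 0"
    by (simp only: minus_zero)
  moreover have "\<forall>\<^sub>F n in sequentially. - (ln (\<phi> n ^ n) - ln (exp (1/2 * (\<tau> n \<bullet> (cov \<theta> *v \<tau> n))))) = r n"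
    using eventually_ge_at_top[of 1]
    by eventually_elim (simp add: r_def ln_realpow \<phi>_pos)
  ultimately have r_lim: "r \<longlonglongrightarrow> 0" by (rule Lim_transform_eventually)
  have "(\<lambda>n. measure (joint n (\<eta> n)) {x \<in> space (joint n (\<eta> n)). \<bar>?R n x\<bar> > \<epsilon>}) \<longlonglongrightarrow> 0" if "\<epsilon> > 0" for \<epsilon>
  \<comment> \<open>The probabilities are eventually exactly 0, because the remainder is almost
    surely a constant below \<epsilon> in absolute value.\<close>
  proof (rule tendsto_eventually)
    have "\<forall>\<^sub>F n in sequentially. \<bar>r n\<bar> < \<epsilon>"
      using tendstoD[OF r_lim that] by simp
    then show "\<forall>\<^sub>F n in sequentially. measure (joint n (\<eta> n)) {x \<in> space (joint n (\<eta> n)). \<bar>?R n x\<bar> > \<epsilon>} = 0"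
      using eventually_ge_at_top[of 1]
    proof eventually_elim
      case (elim n)
      have "AE x in joint n (\<eta> n). \<not> \<bar>?R n x\<bar> > \<epsilon>"
        using R[OF elim(2)] by eventually_elim (use elim in simp)
      then show ?case by (simp add: measure_def emeasure_eq_0_AE)
    qed
  qed
  \<comment> \<open>Measurability is demanded for every n; at n = 0 no density formula is available,
    but \<open>RN_deriv\<close> is measurable by construction.\<close>
  moreover have "?R n \<in> borel_measurable (joint n (\<eta> n))" for n
    unfolding log_lik_ratio_def by measurable
  ultimately show ?thesis unfolding small_o_in_prob_def h_def by blast
qed

theorem ulan:
  assumes \<theta>: "\<theta> \<in> \<Theta>"
  shows "ulan_at joint \<Theta> \<theta> score (cov \<theta>)"
  unfolding ulan_at_def
proof (intro allI impI, elim conjE, rule conjI)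
  fix \<eta> \<tau> :: "nat \<Rightarrow> real ^ 'k"
  assume \<eta>\<Theta>: "\<forall>n\<ge>1. \<eta> n \<in> \<Theta>"
    and O: "(\<lambda>n. norm (\<eta> n - \<theta>)) \<in> O(\<lambda>n. 1 / sqrt (real n))"
    and bd: "bounded (range \<tau>)"
    and \<tau>\<Theta>: "\<forall>n\<ge>1. \<eta> n + (1 / sqrt (real n)) *\<^sub>R \<tau> n \<in> \<Theta>"
  obtain c where "\<forall>\<^sub>F n in sequentially. norm (norm (\<eta> n - \<theta>)) \<le> c * norm (1 / sqrt (real n))"
    using landau_o.bigE[OF O] by blast
  then have "\<forall>\<^sub>F n in sequentially. norm (\<eta> n - \<theta>) \<le> c * (1 / sqrt (real n))" by simp
  moreover have "(\<lambda>n. c * (1 / sqrt (real n))) \<longlonglongrightarrow> 0" by real_asymp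
  ultimately have "(\<lambda>n. \<eta> n - \<theta>) \<longlonglongrightarrow> 0" by (rule Lim_null_comparison)
  then have \<eta>: "\<eta> \<longlonglongrightarrow> \<theta>" by (simp only: Lim_null[symmetric])
  obtain B where B: "\<And>n. norm (\<tau> n) \<le> B" using bd by (auto simp: bounded_iff)
  show "small_o_in_prob (\<lambda>n. joint n (\<eta> n))
    (\<lambda>n x. log_lik_ratio (joint n (\<eta> n + (1 / sqrt (real n)) *\<^sub>R \<tau> n)) (joint n (\<eta> n)) x
       - (\<tau> n \<bullet> score n (\<eta> n) x - 1/2 * (\<tau> n \<bullet> (cov \<theta> *v \<tau> n))))"
    by (rule log_lik_ratio_expansion[OF \<theta> \<eta> _ B]) (use \<eta>\<Theta> \<tau>\<Theta> in auto)
  show "\<exists>N. mv_normal 0 (cov \<theta>) N \<and> converges_in_law (\<lambda>n. joint n (\<eta> n)) (\<lambda>n. score n (\<eta> n)) N"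
    by (rule score_asymptotically_normal[OF \<theta> \<eta>]) (use \<eta>\<Theta> in auto)
qed

end

section \<open>The generalized inverse Gaussian family\<close>

text \<open>The hypotheses of \<open>ulan_at\<close> confine the parameters to \<Theta> from n = 1
  on. At n = 0 they are arbitrary, so agreement is required there for all parameters.\<close>

lemma ulan_at_cong:
  fixes P P' :: "nat \<Rightarrow> real ^ 'k \<Rightarrow> 'a measure"
  assumes "ulan_at P \<Theta> \<theta> \<Delta> \<Gamma>"
    and P: "\<And>n \<eta>. n = 0 \<or> \<eta> \<in> \<Theta> \<Longrightarrow> P n \<eta> = P' n \<eta>"
    and \<Delta>: "\<And>n \<eta>. n = 0 \<or> \<eta> \<in> \<Theta> \<Longrightarrow> \<Delta> n \<eta> = \<Delta>' n \<eta>"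
  shows "ulan_at P' \<Theta> \<theta> \<Delta>' \<Gamma>"
  unfolding ulan_at_def
proof (intro allI impI)
  fix \<eta> \<tau> :: "nat \<Rightarrow> real ^ 'k"
  assume *: "(\<forall>n\<ge>1. \<eta> n \<in> \<Theta>) \<and> (\<lambda>n. norm (\<eta> n - \<theta>)) \<in> O(\<lambda>n. 1 / sqrt (real n)) \<and>
    bounded (range \<tau>) \<and> (\<forall>n\<ge>1. \<eta> n + (1 / sqrt (real n)) *\<^sub>R \<tau> n \<in> \<Theta>)"
  have n: "n = 0 \<or> 1 \<le> n" for n :: nat by linarith
  have "P n (\<eta> n) = P' n (\<eta> n)" "\<Delta> n (\<eta> n) = \<Delta>' n (\<eta> n)"
    "P n (\<eta> n + (1 / sqrt (real n)) *\<^sub>R \<tau> n) = P' n (\<eta> n + (1 / sqrt (real n)) *\<^sub>R \<tau> n)" for n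
    using * n[of n] by (intro P \<Delta>; blast)+
  with assms(1)[unfolded ulan_at_def, rule_format, OF *]
  show "small_o_in_prob (\<lambda>n. P' n (\<eta> n)) (\<lambda>n x.
      log_lik_ratio (P' n (\<eta> n + (1 / sqrt (real n)) *\<^sub>R \<tau> n)) (P' n (\<eta> n)) x -
      (\<tau> n \<bullet> \<Delta>' n (\<eta> n) x - 1 / 2 * (\<tau> n \<bullet> (\<Gamma> *v \<tau> n)))) \<and>
    (\<exists>N. mv_normal 0 \<Gamma> N \<and> converges_in_law (\<lambda>n. P' n (\<eta> n)) (\<lambda>n. \<Delta>' n (\<eta> n)) N)"
    by simp
qed

section \<open>The GIG laws as an exponential family\<close>

definition gig_kernel :: "real \<Rightarrow> real \<Rightarrow> real \<Rightarrow> real \<Rightarrow> real" where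
  "gig_kernel p a b x = (if x > 0 then x powr (p - 1) * exp (- (a * x + b / x) / 2) else 0)"

text \<open>The factor \<open>1 / x\<close> absorbs the -1 in the exponent \<open>p - 1\<close>; the
  natural parameter is then p itself, not p - 1.\<close>

definition gig_base :: "real measure" where
  "gig_base = density lborel (\<lambda>x. ennreal (if x > 0 then 1 / x else 0))"

definition gig_stat :: "real \<Rightarrow> real ^ 3" where
  "gig_stat x = vector [ln x, - (x / 2), - (1 / (2 * x))]"

lemma gig_kernel_measurable [measurable]: "gig_kernel p a b \<in> borel_measurable borel"
  unfolding gig_kernel_def by measurable

lemma integrable_exp_tail:
  assumes "l > (0 :: real)"
  shows "integrable lborel (\<lambda>x. if x < 0 then 0 else exp (- (l * x)))"
proof -
  interpret prob_space "density lborel (exponential_density l)"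
    by (rule prob_space_exponential_density[OF assms])
  have "(\<integral>\<^sup>+x. ennreal (exponential_density l x) \<partial>lborel) = 1"
    using emeasure_space_1 by (simp add: emeasure_density)
  then have "integrable lborel (exponential_density l)"
    using assms by (intro integrableI_nonneg) (auto simp: exponential_density_nonneg)
  then have "integrable lborel (\<lambda>x. (1 / l) * exponential_density l x)" by simp
  also have "(\<lambda>x. (1 / l) * exponential_density l x) = (\<lambda>x. if x < 0 then 0 else exp (- (l * x)))"
    using assms by (auto simp: exponential_density_def mult.commute)
  finally show ?thesis .
qed

text \<open>Any power of x, near 0 as well as near infinity, is beaten by a small exponential in x
  or in 1/x. A quarter of the rate is spent on this, and \<open>exp (- (a / 4 * x))\<close> remains
  as an integrable bound.\<close>

lemma integrable_gig_kernel:
  assumes "a > 0" "b > 0"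
  shows "integrable lborel (gig_kernel p a b)"
proof -
  define q where "q = \<bar>p - 1\<bar>"
  \<comment> \<open>From \<open>y / c \<le> exp (y / c)\<close>, a q-th power costs the rate
    \<open>q / c\<close>, which is thereby kept below a quarter of \<open>min a b\<close>. Using
    \<open>q + 1\<close> instead of \<open>q\<close> keeps \<open>c\<close> positive when p =
    1.\<close>
  define c where "c = 4 * (q + 1) / min a b"
  have q: "q \<ge> 0" by (simp add: q_def)
  have c: "c > 0" using assms q by (simp add: c_def)
  have qc: "q / c \<le> min a b / 4"
  proof -
    have "q / c = q / (q + 1) * (min a b / 4)" by (simp add: c_def)
    also have "\<dots> \<le> 1 * (min a b / 4)" using q assms by (intro mult_right_mono) auto
    finally show ?thesis by simp
  qed
  have pw: "y powr q \<le> c powr q * exp (min a b / 4 * y)" if "y > 0" for y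
  proof -
    have "y / c \<le> exp (y / c)" using exp_ge_add_one_self[of "y / c"] by linarith
    then have "y \<le> c * exp (y / c)" using c by (simp add: field_simps)
    then have "y powr q \<le> (c * exp (y / c)) powr q" using that q by (intro powr_mono2) auto
    also have "\<dots> = c powr q * exp (q / c * y)" using c by (simp add: powr_mult exp_powr_real mult.commute)
    also have "\<dots> \<le> c powr q * exp (min a b / 4 * y)"
      using mult_right_mono[OF qc, of y] that by (intro mult_left_mono) (simp_all only: exp_le_cancel_iff powr_ge_zero less_imp_le)
    finally show ?thesis .
  qed
  have bound: "gig_kernel p a b x \<le> 2 * c powr q * (if x < 0 then 0 else exp (- (a / 4 * x)))" for x
  proof (cases "x > 0")
    case True
    \<comment> \<open>One of the two powers is the given one, according to the sign of
      \<open>p - 1\<close>; adding the other avoids separate estimates at the two ends.\<close>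
    have xp: "x powr (p - 1) \<le> x powr q + (1 / x) powr q"
    proof (cases "p \<ge> 1")
      case True
      then show ?thesis by (simp add: q_def)
    next
      case False
      then have "(1 / x) powr q = x powr (p - 1)"
        using \<open>x > 0\<close> by (simp add: q_def powr_divide powr_minus_divide[symmetric])
      then show ?thesis by simp
    qed
    have le1: "min a b / 4 * x \<le> a / 4 * x" using True by (intro mult_right_mono) auto
    have le2: "min a b / 4 * (1 / x) \<le> b / 4 * (1 / x)" using True by (intro mult_right_mono) auto
    have nn: "0 \<le> a * x" "0 \<le> b / x" using True assms by auto
    have "gig_kernel p a b x \<le> (c powr q * exp (min a b / 4 * x) + c powr q * exp (min a b / 4 * (1 / x)))
        * exp (- (a * x + b / x) / 2)"
      unfolding gig_kernel_def using True pw[of x] pw[of "1 / x"] xp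
      by (auto intro!: mult_right_mono)
    also have "\<dots> = c powr q * (exp (min a b / 4 * x + - (a * x + b / x) / 2)
        + exp (min a b / 4 * (1 / x) + - (a * x + b / x) / 2))"
      by (simp add: exp_add algebra_simps)
    also have "\<dots> \<le> c powr q * (exp (- (a / 4 * x)) + exp (- (a / 4 * x)))"
    proof (intro mult_left_mono add_mono)
      have "min a b / 4 * x + - (a * x + b / x) / 2 \<le> - (a / 4 * x)" using le1 nn by argo
      then show "exp (min a b / 4 * x + - (a * x + b / x) / 2) \<le> exp (- (a / 4 * x))" by simp
      have "b / 4 * (1 / x) = b / x / 4" by simp
      then have "min a b / 4 * (1 / x) + - (a * x + b / x) / 2 \<le> - (a / 4 * x)" using le2 nn by argo
      then show "exp (min a b / 4 * (1 / x) + - (a * x + b / x) / 2) \<le> exp (- (a / 4 * x))" by simp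
    qed simp
    finally show ?thesis using True by simp
  next
    case False
    then show ?thesis by (simp add: gig_kernel_def)
  qed
  have "integrable lborel (\<lambda>x. 2 * c powr q * (if x < 0 then 0 else exp (- (a / 4 * x))))"
    by (intro integrable_mult_right integrable_exp_tail) (use assms in simp)
  then show ?thesis
  proof (rule Bochner_Integration.integrable_bound)
    show "AE x in lborel. norm (gig_kernel p a b x)
        \<le> norm (2 * c powr q * (if x < 0 then 0 else exp (- (a / 4 * x))))"
    proof (rule AE_I2)
      fix x
      have "gig_kernel p a b x \<ge> 0" by (simp add: gig_kernel_def)
      then have "norm (gig_kernel p a b x) = gig_kernel p a b x" by simp
      also have "\<dots> \<le> norm (2 * c powr q * (if x < 0 then 0 else exp (- (a / 4 * x))))"
        unfolding real_norm_def by (rule order_trans[OF bound abs_ge_self])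
      finally show "norm (gig_kernel p a b x)
        \<le> norm (2 * c powr q * (if x < 0 then 0 else exp (- (a / 4 * x))))" .
    qed
  qed measurable
qed

lemma inner_gig_stat: "\<theta> \<bullet> gig_stat x = \<theta> $ 1 * ln x - \<theta> $ 2 * x / 2 - \<theta> $ 3 / (2 * x)"
  by (simp add: gig_stat_def inner_vec_def sum_3)

lemma gig_stat_measurable: "gig_stat \<in> borel_measurable borel"
proof -
  have "gig_stat = (\<lambda>x. ln x *\<^sub>R axis 1 1 + (- (x / 2)) *\<^sub>R axis 2 1 + (- (1 / (2 * x))) *\<^sub>R axis 3 1)"
    by (simp add: gig_stat_def fun_eq_iff vec_eq_iff forall_3 axis_def)
  then show ?thesis by (rule ssubst) measurable
qed

lemma gig_base_times_exp:
  "(if x > 0 then 1 / x else 0) * exp (\<theta> \<bullet> gig_stat x) = gig_kernel (\<theta> $ 1) (\<theta> $ 2) (\<theta> $ 3) x"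
proof (cases "x > 0")
  case True
  then have "x powr (\<theta> $ 1 - 1) = exp (\<theta> $ 1 * ln x) / x"
    by (simp add: powr_diff) (simp add: powr_def)
  moreover have "exp (\<theta> \<bullet> gig_stat x) = exp (\<theta> $ 1 * ln x) * exp (- (\<theta> $ 2 * x + \<theta> $ 3 / x) / 2)"
    unfolding inner_gig_stat by (simp add: exp_add[symmetric] diff_divide_distrib add_divide_distrib algebra_simps)
  ultimately show ?thesis using True by (simp add: gig_kernel_def)
qed (simp add: gig_kernel_def)

interpretation gig: exponential_family gig_base gig_stat gig_params
proof
  show "gig_stat \<in> borel_measurable gig_base"
    using gig_stat_measurable by (simp add: gig_base_def)
  have eq: "gig_params = {\<theta>. \<theta> $ 2 > 0} \<inter> {\<theta>. \<theta> $ 3 > 0}" by (auto simp: gig_params_def)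
  show "open gig_params"
    unfolding eq by (intro open_Int open_Collect_less continuous_intros)
  show "integrable gig_base (\<lambda>x. exp (\<theta> \<bullet> gig_stat x))" if "\<theta> \<in> gig_params" for \<theta>
  proof -
    have "integrable lborel (\<lambda>x. (if x > 0 then 1 / x else 0) *\<^sub>R exp (\<theta> \<bullet> gig_stat x))"
      using that integrable_gig_kernel[of "\<theta> $ 2" "\<theta> $ 3" "\<theta> $ 1"]
      by (simp only: real_scaleR_def gig_base_times_exp) (simp add: gig_params_def)
    then show ?thesis unfolding gig_base_def
      using gig_stat_measurable by (subst integrable_density) auto
  qed
  show "emeasure gig_base (space gig_base) \<noteq> 0"
  proof
    assume "emeasure gig_base (space gig_base) = 0"
    then have "(\<integral>\<^sup>+x. ennreal (if x > 0 then 1 / x else 0) \<partial>lborel) = 0"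
      by (simp add: gig_base_def emeasure_density)
    then have "AE x in lborel. ennreal (if x > 0 then 1 / x else 0) = 0"
      by (subst (asm) nn_integral_0_iff_AE) auto
    \<comment> \<open>The density \<open>1 / x\<close> is positive on the unit interval, which would
      become a Lebesgue null set.\<close>
    then have "AE x in lborel. x \<notin> {0<..<1 :: real}"
      by eventually_elim (auto split: if_splits)
    then have "emeasure lborel {0<..<1 :: real} = 0"
      by (subst (asm) AE_iff_measurable[of "{0<..<1}"]) auto
    then show False by simp
  qed
qed

lemma gig_partition_function: "gig.partition_function \<theta> = (\<integral>x. gig_kernel (\<theta> $ 1) (\<theta> $ 2) (\<theta> $ 3) x \<partial>lborel)"
proof -
  have "gig.partition_function \<theta> = (\<integral>x. (if x > 0 then 1 / x else 0) *\<^sub>R exp (\<theta> \<bullet> gig_stat x) \<partial>lborel)"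
    using gig_stat_measurable unfolding gig.partition_function_def unfolding gig_base_def
    by (subst integral_density) auto
  then show ?thesis by (simp only: real_scaleR_def gig_base_times_exp)
qed

text \<open>The substitution \<open>x = sqrt (b / a) t\<close> symmetrises \<open>a x + b / x\<close> into \<open>sqrt (a b) (t + 1 / t)\<close>.\<close>

lemma integral_gig_kernel:
  assumes "a > 0" "b > 0"
  shows "(\<integral>x. gig_kernel p a b x \<partial>lborel) = 2 * besselK p (sqrt (a * b)) * (b / a) powr (p / 2)"
proof -
  define c where "c = sqrt (b / a)"
  have c: "c > 0" using assms by (simp add: c_def)
  have ac: "a * c = sqrt (a * b)"
    using assms by (simp add: c_def real_sqrt_divide real_sqrt_mult) (simp add: field_simps)
  have bc: "b / c = sqrt (a * b)"
    using assms by (simp add: c_def real_sqrt_divide real_sqrt_mult) (simp add: field_simps)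
  \<comment> \<open>The summand \<open>0 +\<close> is the translation part of the affine change of
    variables applied below.\<close>
  have kernel: "gig_kernel p a b (0 + c * t)
      = c powr (p - 1) * (indicator {0<..} t *\<^sub>R (t powr (p - 1) * exp (- sqrt (a * b) * (t + 1 / t) / 2)))" for t
  proof (cases "t > 0")
    case True
    have "a * (c * t) + b / (c * t) = sqrt (a * b) * (t + 1 / t)"
      using ac bc by (simp add: distrib_left mult.assoc[symmetric]) (simp add: divide_divide_eq_left[symmetric])
    then show ?thesis using True c by (simp add: gig_kernel_def powr_mult)
  next
    case False
    then show ?thesis using c by (simp add: gig_kernel_def zero_less_mult_iff)
  qed
  have "(\<integral>x. gig_kernel p a b x \<partial>lborel) = \<bar>c\<bar> *\<^sub>R (\<integral>t. gig_kernel p a b (0 + c * t) \<partial>lborel)"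
    using c by (intro lborel_integral_real_affine) simp
  also have "\<dots> = c * c powr (p - 1) * (2 * besselK p (sqrt (a * b)))"
    using c unfolding kernel by (simp add: besselK_def set_lebesgue_integral_def)
  also have "c * c powr (p - 1) = (b / a) powr (p / 2)"
    using assms c by (simp add: powr_mult_base) (simp add: c_def powr_half_sqrt[symmetric] powr_powr)
  finally show ?thesis by (simp add: mult_ac)
qed

lemma vector_3_params: "a > 0 \<Longrightarrow> b > 0 \<Longrightarrow> vector [p, a, b] \<in> gig_params"
  by (simp add: gig_params_def)

section \<open>Partial derivatives of the normalising constant and the Bessel function\<close>

lemma gig_const_eq:
  assumes "a > 0" "b > 0"
  shows "gig_const p a b = 1 / gig.partition_function (vector [p, a, b])"
proof -
  have "(a / b) powr (p / 2) = 1 / (b / a) powr (p / 2)"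
    using assms by (simp add: powr_divide)
  then show ?thesis
    by (simp add: gig_const_def gig_partition_function integral_gig_kernel[OF assms])
qed

definition gig_log_partition :: "real \<Rightarrow> real \<Rightarrow> real \<Rightarrow> real" where
  "gig_log_partition p a b = ln (gig.partition_function (vector [p, a, b]))"

text \<open>The factor \<open>(b / a) powr (p / 2)\<close> left by the symmetrising substitution is
  the source of all elementary correction terms in the central sequence and the information
  matrix.\<close>

lemma log_besselK_eq:
  assumes "a > 0" "b > 0"
  shows "log_besselK p a b = gig_log_partition p a b - ln 2 - p / 2 * (ln b - ln a)"
proof -
  let ?s = "(b / a) powr (p / 2)"
  have Z: "gig.partition_function (vector [p, a, b]) > 0"
    by (rule gig.partition_function_pos[OF vector_3_params[OF assms]])
  have s: "?s > 0" "ln ?s = p / 2 * (ln b - ln a)" using assms by (simp_all add: ln_powr ln_div)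
  have "besselK p (sqrt (a * b)) = gig.partition_function (vector [p, a, b]) / (2 * ?s)"
    using s(1) by (simp add: gig_partition_function integral_gig_kernel[OF assms])
  then have "log_besselK p a b = ln (gig.partition_function (vector [p, a, b]) / (2 * ?s))"
    by (simp add: log_besselK_def)
  also have "\<dots> = gig_log_partition p a b - (ln 2 + ln ?s)"
    using Z s(1) by (simp only: gig_log_partition_def ln_divide_pos ln_mult_pos mult_pos_pos zero_less_numeral)
  finally show ?thesis using s(2) by simp
qed

text \<open>Brings a change of one coordinate into the shape of \<open>has_derivative_axis\<close>,
  with \<open>s\<close> the current value of that coordinate.\<close>

lemma vector_3_line:
  "vector [t, a, b] = (vector [p, a, b] :: real ^ 3) + (t - p) *\<^sub>R axis 1 1"
  "vector [p, t, b] = (vector [p, a, b] :: real ^ 3) + (t - a) *\<^sub>R axis 2 1"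
  "vector [p, a, t] = (vector [p, a, b] :: real ^ 3) + (t - b) *\<^sub>R axis 3 1"
  by (simp_all add: vec_eq_iff forall_3 axis_def)

lemma gig_ln_partition_derivatives:
  assumes pos: "a > 0" "b > 0"
  shows "((\<lambda>t. gig_log_partition t a b) has_real_derivative gig.mean (vector [p, a, b]) $ 1) (at p)"
    and "((\<lambda>t. gig_log_partition p t b) has_real_derivative gig.mean (vector [p, a, b]) $ 2) (at a)"
    and "((\<lambda>t. gig_log_partition p a t) has_real_derivative gig.mean (vector [p, a, b]) $ 3) (at b)"
  using gig.ln_partition_has_derivative_axis[OF vector_3_params[OF pos]] unfolding gig_log_partition_def
  by (subst vector_3_line; blast)+

lemma gig_mean_derivatives:
  assumes pos: "a > 0" "b > 0"
  shows "((\<lambda>t. gig.mean (vector [t, a, b]) $ j) has_real_derivative gig.cov (vector [p, a, b]) $ j $ 1) (at p)"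
    and "((\<lambda>t. gig.mean (vector [p, t, b]) $ j) has_real_derivative gig.cov (vector [p, a, b]) $ j $ 2) (at a)"
    and "((\<lambda>t. gig.mean (vector [p, a, t]) $ j) has_real_derivative gig.cov (vector [p, a, b]) $ j $ 3) (at b)"
  using gig.mean_has_derivative_axis[OF vector_3_params[OF pos]]
  by (subst vector_3_line; blast)+

text \<open>The logarithmic partition function contributes the mean. The identity between it and the
  Bessel function needs a, b > 0, so derivatives in a and b are transferred on the open half-line; p
  ranges over all reals.\<close>

lemma pd_log_besselK:
  assumes pos: "a > 0" "b > 0"
  shows "pd_p log_besselK p a b = gig.mean (vector [p, a, b]) $ 1 - (ln b - ln a) / 2"
    and "pd_a log_besselK p a b = gig.mean (vector [p, a, b]) $ 2 + p / (2 * a)"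
    and "pd_b log_besselK p a b = gig.mean (vector [p, a, b]) $ 3 - p / (2 * b)"
proof -
  note D = gig_ln_partition_derivatives[OF pos, where p = p]
  show "pd_p log_besselK p a b = gig.mean (vector [p, a, b]) $ 1 - (ln b - ln a) / 2"
    unfolding pd_p_def
  proof (rule DERIV_imp_deriv, rule has_field_derivative_transform_within_open[of _ _ _ UNIV])
    show "((\<lambda>t. gig_log_partition t a b - ln 2 - t / 2 * (ln b - ln a))
        has_real_derivative gig.mean (vector [p, a, b]) $ 1 - (ln b - ln a) / 2) (at p)"
      by (auto intro!: derivative_eq_intros D(1))
  qed (use pos in \<open>auto simp: log_besselK_eq\<close>)
  show "pd_a log_besselK p a b = gig.mean (vector [p, a, b]) $ 2 + p / (2 * a)"
    unfolding pd_a_def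
  proof (rule DERIV_imp_deriv, rule has_field_derivative_transform_within_open[of _ _ _ "{0<..}"])
    show "((\<lambda>t. gig_log_partition p t b - ln 2 - p / 2 * (ln b - ln t))
        has_real_derivative gig.mean (vector [p, a, b]) $ 2 + p / (2 * a)) (at a)"
      using pos by (auto intro!: derivative_eq_intros D(2))
  qed (use pos in \<open>auto simp: log_besselK_eq\<close>)
  show "pd_b log_besselK p a b = gig.mean (vector [p, a, b]) $ 3 - p / (2 * b)"
    unfolding pd_b_def
  proof (rule DERIV_imp_deriv, rule has_field_derivative_transform_within_open[of _ _ _ "{0<..}"])
    show "((\<lambda>t. gig_log_partition p a t - ln 2 - p / 2 * (ln t - ln a))
        has_real_derivative gig.mean (vector [p, a, b]) $ 3 - p / (2 * b)) (at b)"
      using pos by (auto intro!: derivative_eq_intros D(3))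
  qed (use pos in \<open>auto simp: log_besselK_eq\<close>)
qed

text \<open>The constant is \<open>exp (- gig_log_partition p a b)\<close>, so its logarithmic
  derivatives are the centring terms of the score.\<close>

lemma pd_gig_const:
  assumes pos: "a > 0" "b > 0"
  shows "pd_p gig_const p a b / gig_const p a b = - gig.mean (vector [p, a, b]) $ 1"
    and "pd_a gig_const p a b / gig_const p a b = - gig.mean (vector [p, a, b]) $ 2"
    and "pd_b gig_const p a b / gig_const p a b = - gig.mean (vector [p, a, b]) $ 3"
proof -
  have eq: "gig_const p a b = exp (- gig_log_partition p a b)"
    if "a > 0" "b > 0" for p a b
    using gig.partition_function_pos[OF vector_3_params[OF that]] gig_const_eq[OF that]
    by (simp add: gig_log_partition_def exp_minus divide_inverse)
  note D = gig_ln_partition_derivatives[OF pos, where p = p]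
  have "pd_p gig_const p a b = - gig.mean (vector [p, a, b]) $ 1 * gig_const p a b"
    unfolding pd_p_def
  proof (rule DERIV_imp_deriv, rule has_field_derivative_transform_within_open[of _ _ _ UNIV])
    show "((\<lambda>t. exp (- gig_log_partition t a b))
        has_real_derivative - gig.mean (vector [p, a, b]) $ 1 * gig_const p a b) (at p)"
      unfolding eq[OF pos] by (auto intro!: derivative_eq_intros D(1))
  qed (use pos in \<open>auto simp: eq\<close>)
  then show "pd_p gig_const p a b / gig_const p a b = - gig.mean (vector [p, a, b]) $ 1"
    by (simp add: eq[OF pos])
  have "pd_a gig_const p a b = - gig.mean (vector [p, a, b]) $ 2 * gig_const p a b"
    unfolding pd_a_def
  proof (rule DERIV_imp_deriv, rule has_field_derivative_transform_within_open[of _ _ _ "{0<..}"])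
    show "((\<lambda>t. exp (- gig_log_partition p t b))
        has_real_derivative - gig.mean (vector [p, a, b]) $ 2 * gig_const p a b) (at a)"
      unfolding eq[OF pos] by (auto intro!: derivative_eq_intros D(2))
  qed (use pos in \<open>auto simp: eq\<close>)
  then show "pd_a gig_const p a b / gig_const p a b = - gig.mean (vector [p, a, b]) $ 2"
    by (simp add: eq[OF pos])
  have "pd_b gig_const p a b = - gig.mean (vector [p, a, b]) $ 3 * gig_const p a b"
    unfolding pd_b_def
  proof (rule DERIV_imp_deriv, rule has_field_derivative_transform_within_open[of _ _ _ "{0<..}"])
    show "((\<lambda>t. exp (- gig_log_partition p a t))
        has_real_derivative - gig.mean (vector [p, a, b]) $ 3 * gig_const p a b) (at b)"
      unfolding eq[OF pos] by (auto intro!: derivative_eq_intros D(3))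
  qed (use pos in \<open>auto simp: eq\<close>)
  then show "pd_b gig_const p a b / gig_const p a b = - gig.mean (vector [p, a, b]) $ 3"
    by (simp add: eq[OF pos])
qed

text \<open>The first derivatives have closed forms on a whole neighbourhood, not just at one point,
  so they can be differentiated again; the derivatives of the mean are covariances.\<close>

lemma pd2_log_besselK:
  fixes p a b :: real
  assumes pos: "a > 0" "b > 0"
  defines "S \<equiv> gig.cov (vector [p, a, b])"
  shows "pd_p (pd_p log_besselK) p a b = S $ 1 $ 1"
    and "pd_a (pd_p log_besselK) p a b = S $ 1 $ 2 + 1 / (2 * a)"
    and "pd_b (pd_p log_besselK) p a b = S $ 1 $ 3 - 1 / (2 * b)"
    and "pd_a (pd_a log_besselK) p a b = S $ 2 $ 2 - p / (2 * a\<^sup>2)"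
    and "pd_b (pd_b log_besselK) p a b = S $ 3 $ 3 + p / (2 * b\<^sup>2)"
    and "pd_a (pd_b log_besselK) p a b = S $ 3 $ 2"
proof -
  note D = gig_mean_derivatives[OF pos, where p = p, folded S_def]
  note pd = pd_log_besselK
  show "pd_p (pd_p log_besselK) p a b = S $ 1 $ 1"
    \<comment> \<open>The instantiation unfolds the outer derivative only; the inner one must stay
      intact to be replaced by its closed form.\<close>
    unfolding pd_p_def[of "pd_p log_besselK"]
  proof (rule DERIV_imp_deriv, rule has_field_derivative_transform_within_open[of _ _ _ UNIV])
    show "((\<lambda>t. gig.mean (vector [t, a, b]) $ 1 - (ln b - ln a) / 2) has_real_derivative S $ 1 $ 1) (at p)"
      by (auto intro!: derivative_eq_intros D(1))
  qed (use pos in \<open>auto simp: pd\<close>)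
  show "pd_a (pd_p log_besselK) p a b = S $ 1 $ 2 + 1 / (2 * a)"
    unfolding pd_a_def
  proof (rule DERIV_imp_deriv, rule has_field_derivative_transform_within_open[of _ _ _ "{0<..}"])
    show "((\<lambda>t. gig.mean (vector [p, t, b]) $ 1 - (ln b - ln t) / 2)
        has_real_derivative S $ 1 $ 2 + 1 / (2 * a)) (at a)"
      using pos by (auto intro!: derivative_eq_intros D(2))
  qed (use pos in \<open>auto simp: pd\<close>)
  show "pd_b (pd_p log_besselK) p a b = S $ 1 $ 3 - 1 / (2 * b)"
    unfolding pd_b_def
  proof (rule DERIV_imp_deriv, rule has_field_derivative_transform_within_open[of _ _ _ "{0<..}"])
    show "((\<lambda>t. gig.mean (vector [p, a, t]) $ 1 - (ln t - ln a) / 2)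
        has_real_derivative S $ 1 $ 3 - 1 / (2 * b)) (at b)"
      using pos by (auto intro!: derivative_eq_intros D(3))
  qed (use pos in \<open>auto simp: pd\<close>)
  show "pd_a (pd_a log_besselK) p a b = S $ 2 $ 2 - p / (2 * a\<^sup>2)"
    unfolding pd_a_def[of "pd_a log_besselK"]
  proof (rule DERIV_imp_deriv, rule has_field_derivative_transform_within_open[of _ _ _ "{0<..}"])
    show "((\<lambda>t. gig.mean (vector [p, t, b]) $ 2 + p / (2 * t))
        has_real_derivative S $ 2 $ 2 - p / (2 * a\<^sup>2)) (at a)"
      using pos by (auto intro!: derivative_eq_intros D(2) simp: power2_eq_square)
  qed (use pos in \<open>auto simp: pd\<close>)
  show "pd_b (pd_b log_besselK) p a b = S $ 3 $ 3 + p / (2 * b\<^sup>2)"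
    unfolding pd_b_def[of "pd_b log_besselK"]
  proof (rule DERIV_imp_deriv, rule has_field_derivative_transform_within_open[of _ _ _ "{0<..}"])
    show "((\<lambda>t. gig.mean (vector [p, a, t]) $ 3 - p / (2 * t))
        has_real_derivative S $ 3 $ 3 + p / (2 * b\<^sup>2)) (at b)"
      using pos by (auto intro!: derivative_eq_intros D(3) simp: power2_eq_square)
  qed (use pos in \<open>auto simp: pd\<close>)
  show "pd_a (pd_b log_besselK) p a b = S $ 3 $ 2"
    unfolding pd_a_def
  proof (rule DERIV_imp_deriv, rule has_field_derivative_transform_within_open[of _ _ _ "{0<..}"])
    show "((\<lambda>t. gig.mean (vector [p, t, b]) $ 3 - p / (2 * b)) has_real_derivative S $ 3 $ 2) (at a)"
      by (auto intro!: derivative_eq_intros D(2))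
  qed (use pos in \<open>auto simp: pd\<close>)
qed

section \<open>Identification of the model, the central sequence and the information matrix\<close>

lemma gig_params_cases:
  assumes "\<theta> \<in> gig_params"
  obtains p a b where "\<theta> = vector [p, a, b]" "a > 0" "b > 0"
proof (rule that)
  show "\<theta> = vector [\<theta> $ 1, \<theta> $ 2, \<theta> $ 3]" by (simp add: vec_eq_iff forall_3)
qed (use assms in \<open>auto simp: gig_params_def\<close>)

text \<open>The elementary terms in \<open>gig_fisher\<close> cancel those in the second derivatives
  of the Bessel function. Symmetry of the covariance settles the entries that
  \<open>gig_fisher\<close> obtains from only one order of differentiation.\<close>

lemma gig_fisher_eq_cov:
  assumes "\<theta> \<in> gig_params"
  shows "gig_fisher \<theta> = gig.cov \<theta>"
proof -
  obtain p a b where \<theta>: "\<theta> = vector [p, a, b]" and pos: "a > 0" "b > 0"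
    using assms by (rule gig_params_cases)
  note sym = gig.cov_symmetric[of \<theta> 2 1] gig.cov_symmetric[of \<theta> 3 1] gig.cov_symmetric[of \<theta> 3 2]
  show ?thesis
    unfolding gig_fisher_def Let_def
    using pd2_log_besselK[OF pos, where p = p, folded \<theta>] sym
    by (simp add: \<theta> vec_eq_iff forall_3)
qed

lemma gig_eq_law:
  assumes "\<theta> \<in> gig_params"
  shows "gig (\<theta> $ 1) (\<theta> $ 2) (\<theta> $ 3) = gig.law \<theta>"
proof -
  obtain p a b where \<theta>: "\<theta> = vector [p, a, b]" and pos: "a > 0" "b > 0"
    using assms by (rule gig_params_cases)
  have Z: "gig.partition_function \<theta> > 0" by (rule gig.partition_function_pos[OF assms])
  have dens: "gig_density p a b x = (if x > 0 then 1 / x else 0) * (exp (\<theta> \<bullet> gig_stat x) / gig.partition_function \<theta>)" for x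
    using gig_base_times_exp[of x \<theta>] Z
    by (simp add: gig_density_def gig_const_eq[OF pos] gig_kernel_def \<theta> split: if_splits)
  have [measurable]: "gig_stat \<in> borel_measurable borel" by (rule gig_stat_measurable)
  have "gig.law \<theta> = density gig_base (\<lambda>x. ennreal (exp (\<theta> \<bullet> gig_stat x) / gig.partition_function \<theta>))"
    by (rule gig.law_def)
  also have "\<dots> = density lborel (\<lambda>x. ennreal (if x > 0 then 1 / x else 0)
      * ennreal (exp (\<theta> \<bullet> gig_stat x) / gig.partition_function \<theta>))"
    by (subst gig_base_def) (rule density_density_eq; measurable)
  also have "\<dots> = gig p a b"
    unfolding gig_def dens using Z by (simp add: ennreal_mult'[symmetric])
  finally show ?thesis by (simp add: \<theta>)
qed

text \<open>At n = 0 both sides are the product over an empty index set, whatever the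
  parameter.\<close>

lemma gig_joint_eq_joint:
  assumes "n = 0 \<or> \<theta> \<in> gig_params"
  shows "gig.joint n \<theta> = gig_joint n \<theta>"
  unfolding gig.joint_def gig_joint_def using assms by (intro PiM_cong) (auto simp: gig_eq_law)

text \<open>The centring terms are minus the means of the coordinates of T, so each summand is T
  minus its mean; at n = 0 both sums are empty.\<close>

lemma gig_central_eq_score:
  assumes "n = 0 \<or> \<theta> \<in> gig_params"
  shows "gig.score n \<theta> = gig_central n \<theta>"
proof (cases "n = 0")
  case True
  then show ?thesis by (simp add: gig.score_def gig_central_def fun_eq_iff)
next
  case False
  with assms obtain p a b where \<theta>: "\<theta> = vector [p, a, b]" and pos: "a > 0" "b > 0"
    using gig_params_cases by blast
  show ?thesis
    unfolding gig.score_def gig_central_def Let_def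
    by (intro ext arg_cong[of _ _ "scaleR _"] sum.cong refl)
       (simp add: \<theta> pd_gig_const[OF pos] gig_stat_def vec_eq_iff forall_3)
qed

theorem theorem2p1:
  fixes p a b :: real and \<theta> :: "real ^ 3"
  assumes "a > 0" and "b > 0"
  defines "\<theta> \<equiv> vector [p, a, b]"
  shows "(\<forall>n x. gig_central n \<theta> x =
            (1 / sqrt (real n)) *\<^sub>R (\<Sum>i\<in>{1..n}. vector
              [1/2 * ln (a / b) - pd_p log_besselK p a b + ln (x i),
               p / (2 * a) - pd_a log_besselK p a b - x i / 2,
               - p / (2 * b) - pd_b log_besselK p a b - 1 / (2 * x i)]))
         \<and> ulan_at gig_joint gig_params \<theta> gig_central (gig_fisher \<theta>)"
proof (intro conjI allI)
  note pos = assms(1,2)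
  have \<theta>: "\<theta> \<in> gig_params" unfolding \<theta>_def by (rule vector_3_params[OF pos])
  \<comment> \<open>Both forms of the centring terms equal minus the mean of T: the elementary terms
    cancel those in the derivatives of \<open>log_besselK\<close>.\<close>
  show "gig_central n \<theta> x =
            (1 / sqrt (real n)) *\<^sub>R (\<Sum>i\<in>{1..n}. vector
              [1/2 * ln (a / b) - pd_p log_besselK p a b + ln (x i),
               p / (2 * a) - pd_a log_besselK p a b - x i / 2,
               - p / (2 * b) - pd_b log_besselK p a b - 1 / (2 * x i)])" for n x
    unfolding gig_central_def Let_def using pos
    by (simp add: \<theta>_def pd_gig_const[OF pos] pd_log_besselK[OF pos] ln_div diff_divide_distrib)
  have "ulan_at gig.joint gig_params \<theta> gig.score (gig.cov \<theta>)" by (rule gig.ulan[OF \<theta>])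
  then show "ulan_at gig_joint gig_params \<theta> gig_central (gig_fisher \<theta>)"
    unfolding gig_fisher_eq_cov[OF \<theta>]
    by (rule ulan_at_cong) (simp_all add: gig_joint_eq_joint gig_central_eq_score)
qed

end
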